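(* Suppose the Stationarity Assumption on $R$ (see context) holds. Suppose that $(\mu_t)_{t\ge0}$ is a family of Borel probability measures on $(0,\infty)$, absolutely continuous with respect to $\pi$, such that $t\mapsto\mu_t$ is Borel measurable and $$\sup_{t\ge0}\left\|\tfrac{d\mu_t}{d\pi}\right\|_{L^\infty(\pi)}<\infty .$$ Suppose further that for all $f\in C_c^1(0,\infty)$ and all $t\ge0$, $$(\mu_t,f)-(\mu_0,f)=\int_0^t(\mu_s,\mathscr Lf)\,ds .$$ Then $\mu_t=\mu_0P_t$ for all $t\ge0$.
   Context: Let $R:[0,\infty)\to[0,\infty)$ be a Borel function with $\int_0^kR(x)\,dx<\infty$ for all $k>0$. Notation: $(\mu,f)=\int f\,d\mu$. Stationarity Assumption. Let $\mathcal D$ be the set of c\`adl\`ag nondecreasing functions $F:[0,\infty]\to[0,1]$ (with $F(+\infty)=\lim_{x\to\infty}F(x)$). Let $\mathfrak R$ be the set of maps $t\mapsto F_t$ from $[0,\infty)$ to $\mathcal D$, Borel measurable for the $L^1_{\mathrm{loc}}([0,\infty))$ topology on $\mathcal D$, such that $dF_t\ll\mathrm{Leb}$, $F_t(+\infty)=1$, $F_t(0)=0$ for all $t\ge 0$, $\{F_t\}_{t\ge0}$ is tight, and for all $t\ge0,x>0$ $$F_t(x)=F_0(e^{-t}x)+\int_0^t(e^{s-t}x)^2\left[\int_{e^{s-t}x}^\infty\frac{R(z)}{z}\,dF_s(z)\right]ds .$$ It is assumed that there is a distribution function $F$ such that the constant family $F_t=F$ belongs to $\mathfrak R$; $\pi=dF$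 is the corresponding probability measure on $(0,\infty)$. The operator $\mathscr L:C_c^1(0,\infty)\to L^1(\pi)$ is $$\mathscr Lf(x)=xf'(x)+xR(x)\left[\int_0^x\frac{2u}{x^2}f(u)\,du-f(x)\right].$$ Cell process. For $z>0,t\ge0$ put $S_z(t)=\exp\left(-\int_z^{ze^t}R(u)\,du\right)$ and let $S_z^{-1}(u)=\inf\{t\ge0:S_z(t)\le u\}\in[0,\infty]$. Let $U_1,U_2,\dots$ be i.i.d. uniform on $(0,1)$. For a starting point $x>0$, set $\tau_0=0$, $Y_0=x$ and for $k\ge1$: $J_k=\sqrt{U_{2k}}$; $\tau_k=\infty$ if $\tau_{k-1}=\infty$, otherwise $\tau_k=\tau_{k-1}+S_{Y_{k-1}}^{-1}(U_{2k-1})$; $Y_k=xe^{\tau_k}\prod_{j=1}^kJ_j$ (when $\tau_k<\infty$). One assumes without loss $\prod_{k}J_k=0$ surely. Set $X_t=xe^t\prod_{j=1}^kJ_j$ if $\tau_k\le t<\tau_{k+1}$, and $X_t=0$ if $t\ge\zeta:=\lim_k\tau_k$. If the starting point is $0$, set $X_t=0$ for all $t$. $\mathbb P_x$ denotes the law under which $X$ starts at $x$, and $P_tf(x)=\mathbb E_x[f(X_t)]$ for bounded Borel $f$; $\mu P_t$ is the law of $X_t$ when $X_0\sim\mu$. *)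

theory Defs
  imports "HOL-Probability.Probability"
begin

definition rate_function :: "(real \<Rightarrow> real) \<Rightarrow> bool" where
  "rate_function R \<longleftrightarrow>
     R \<in> borel_measurable (restrict_space borel {0..}) \<and>
     (\<forall>x\<ge>0. 0 \<le> R x) \<and>
     (\<forall>k>0. (\<integral>\<^sup>+x\<in>{0..k}. ennreal (R x) \<partial>lborel) < \<infinity>)"

text \<open>The type of extended nonnegative reals is the half-line \<open>[0,\<infinity>]\<close>, so
  the functions \<open>[0,\<infinity>] \<rightarrow> [0,1]\<close> need no domain side conditions.\<close>

definition dist_funs :: "(ennreal \<Rightarrow> real) set" where
  "dist_funs = {F. mono F \<and> range F \<subseteq> {0..1} \<and>
     (\<forall>x. continuous (at_right x) F \<and> (\<exists>l. (F \<longlongrightarrow> l) (at_left x))) \<and>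
     (F \<longlongrightarrow> F \<top>) (at_left \<top>)}"

definition L1loc_topology :: "(ennreal \<Rightarrow> real) topology" where
  "L1loc_topology = topology_generated_by
     {{G \<in> dist_funs. (LBINT x:{0..k}. \<bar>G (ennreal x) - F (ennreal x)\<bar>) < e} | F k e.
        F \<in> dist_funs \<and> 0 < k \<and> 0 < e}"

definition L1loc_borel :: "(ennreal \<Rightarrow> real) measure" where
  "L1loc_borel = sigma dist_funs {V. openin L1loc_topology V}"

text \<open>The measure \<open>dF\<close>, as a Borel measure on the real line. Since \<open>ennreal x = 0\<close>
  for \<open>x \<le> 0\<close>, it gives no mass to \<open>(-\<infinity>, 0]\<close>, which is the right convention
  when \<open>F 0 = 0\<close>.\<close>

definition stieltjes :: "(ennreal \<Rightarrow> real) \<Rightarrow> real measure" where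
  "stieltjes F = interval_measure (\<lambda>x. F (ennreal x))"

text \<open>The last condition is stated in \<open>[0,\<infinity>]\<close>: both integrands are nonnegative, and
  finiteness of the integrals is part of what the equation says.\<close>

definition solution_family :: "(real \<Rightarrow> real) \<Rightarrow> (real \<Rightarrow> ennreal \<Rightarrow> real) set" where
  "solution_family R = {F.
     F \<in> measurable (restrict_space borel {0..}) L1loc_borel \<and>
     (\<forall>t\<ge>0. F t \<in> dist_funs \<and> absolutely_continuous lborel (stieltjes (F t)) \<and>
        F t \<top> = 1 \<and> F t 0 = 0) \<and>
     (\<forall>e>0. \<exists>K. compact K \<and> K \<subseteq> {0..} \<and> (\<forall>t\<ge>0. measure (stieltjes (F t)) (- K) < e)) \<and>
     (\<forall>t\<ge>0. \<forall>x>0. ennreal (F t (ennreal x)) =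
        ennreal (F 0 (ennreal (exp (- t) * x))) +
        (\<integral>\<^sup>+s\<in>{0..t}. ennreal ((exp (s - t) * x)\<^sup>2) *
           (\<integral>\<^sup>+z\<in>{exp (s - t) * x<..}. ennreal (R z / z) \<partial>stieltjes (F s)) \<partial>lborel))}"

text \<open>Functions on \<open>(0,\<infinity>)\<close> with compact support there are extended by \<open>0\<close> to the real line.\<close>

definition Cc1 :: "(real \<Rightarrow> real) set" where
  "Cc1 = {f. f C1_differentiable_on {0<..} \<and>
     (\<exists>K. compact K \<and> K \<subseteq> {0<..} \<and> (\<forall>x. x \<notin> K \<longrightarrow> f x = 0))}"

text \<open>Only the values at \<open>x > 0\<close> are meaningful.\<close>

definition generator :: "(real \<Rightarrow> real) \<Rightarrow> (real \<Rightarrow> real) \<Rightarrow> real \<Rightarrow> real" where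
  "generator R f x =
     x * deriv f x + x * R x * ((LBINT u:{0..x}. 2 * u / x\<^sup>2 * f u) - f x)"

text \<open>Measures on \<open>(0,\<infinity>)\<close> are represented by Borel measures on the real line that do not
  charge \<open>(-\<infinity>, 0]\<close>. The integral is taken over \<open>(0,\<infinity>)\<close>, because \<open>R\<close> is
  arbitrary, possibly not measurable, on the negative half-line.\<close>

definition pairing :: "real measure \<Rightarrow> (real \<Rightarrow> real) \<Rightarrow> real" where
  "pairing \<mu> f = (LINT x:{0<..}|\<mu>. f x)"

definition surv :: "(real \<Rightarrow> real) \<Rightarrow> real \<Rightarrow> real \<Rightarrow> real" where
  "surv R z t = exp (- (LBINT u:{z..z * exp t}. R u))"

definition surv_inv :: "(real \<Rightarrow> real) \<Rightarrow> real \<Rightarrow> real \<Rightarrow> ennreal" where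
  "surv_inv R z u = Inf {ennreal t | t. 0 \<le> t \<and> surv R z t \<le> u}"

text \<open>In the following \<open>u\<close> is a realisation of the sequence of uniform variables; the
  value \<open>u 0\<close> is not used.\<close>

definition jump :: "(nat \<Rightarrow> real) \<Rightarrow> nat \<Rightarrow> real" where
  "jump u k = sqrt (u (2 * k))"

text \<open>The argument of \<open>surv_inv\<close> is the position \<open>Y\<^sub>k\<close> just after the k-th jump.\<close>

primrec jump_time :: "(real \<Rightarrow> real) \<Rightarrow> real \<Rightarrow> (nat \<Rightarrow> real) \<Rightarrow> nat \<Rightarrow> ennreal" where
  "jump_time R x u 0 = 0"
| "jump_time R x u (Suc k) =
     (if jump_time R x u k = \<top> then \<top>
      else jump_time R x u k +
        surv_inv R (x * exp (enn2real (jump_time R x u k)) * (\<Prod>j=1..k. jump u j))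
          (u (2 * k + 1)))"

definition explosion_time :: "(real \<Rightarrow> real) \<Rightarrow> real \<Rightarrow> (nat \<Rightarrow> real) \<Rightarrow> ennreal" where
  "explosion_time R x u = lim (jump_time R x u)"

text \<open>Starting points are in \<open>[0,\<infinity>)\<close>; negative ones are treated like \<open>0\<close>.\<close>

definition cell_path :: "(real \<Rightarrow> real) \<Rightarrow> real \<Rightarrow> (nat \<Rightarrow> real) \<Rightarrow> real \<Rightarrow> real" where
  "cell_path R x u t =
     (if x \<le> 0 \<or> explosion_time R x u \<le> ennreal t then 0
      else x * exp t * (\<Prod>j=1..(THE k. jump_time R x u k \<le> ennreal t \<and>
                                      ennreal t < jump_time R x u (Suc k)). jump u j))"

definition driving_sequence :: "'w measure \<Rightarrow> (nat \<Rightarrow> 'w \<Rightarrow> real) \<Rightarrow> bool" where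
  "driving_sequence M U \<longleftrightarrow> prob_space M \<and>
     prob_space.indep_vars M (\<lambda>_. borel) U {1..} \<and>
     (\<forall>k\<ge>1. distr M borel (U k) = uniform_measure lborel {0<..<1}) \<and>
     (\<forall>k\<ge>1. \<forall>\<omega>\<in>space M. U k \<omega> \<in> {0<..<1}) \<and>
     (\<forall>\<omega>\<in>space M. (\<lambda>n. \<Prod>j=1..n. jump (\<lambda>i. U i \<omega>) j) \<longlonglongrightarrow> 0)"

text \<open>The measure \<open>\<mu>P\<^sub>t\<close>: the law of \<open>X\<^sub>t\<close> when \<open>X\<^sub>0\<close> has law
  \<open>\<mu>\<close> and is independent of the driving sequence.\<close>

definition cell_law ::
  "(real \<Rightarrow> real) \<Rightarrow> 'w measure \<Rightarrow> (nat \<Rightarrow> 'w \<Rightarrow> real) \<Rightarrow> real measure \<Rightarrow> real \<Rightarrow> real measure" where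
  "cell_law R M U \<mu> t =
     distr (\<mu> \<Otimes>\<^sub>M M) borel (\<lambda>(x, \<omega>). cell_path R x (\<lambda>i. U i \<omega>) t)"

end

(*
The stationary equation forces dF to have finite mean total jump rate: the integral of x R(x) against dF is
at most 2. Since the densities of the measures mu_t are uniformly bounded, the mean jump rates under mu_t
are bounded as well; this is all that is used of the stationary law.

Testing the weak equation along the flow x -> x e^t removes the drift, and Duhamel's formula then absorbs
the killing term into the survival probability. This gives mu_t(f) as the sum of mu_0(Q_t f), where Q is the
killed flow, and of the integral over s < t of mu_s(k J Q_{t-s} f), where k(x) = x R(x) and J averages
over the position after a jump. The contribution of the paths with exactly n jumps satisfies the same
recursion without the initial term, so by induction mu_t dominates the law of the cell process restricted to
fewer than n jumps, for all n. Moreover the expected number of jumps before t is at most the integral of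
mu_s(k) over s < t, hence finite, and the process does not explode. So mu_t dominates the law of X_t, and
two probability measures ordered in this way coincide.
*)
theory Submission
  imports Defs "HOL-Real_Asymp.Real_Asymp"
begin

section \<open>The survival probability along the flow\<close>

text \<open>\<open>R\<close> is only locally integrable, so the survival probability need not be
  differentiable, and a test function killed along the flow is in general no admissible test
  function. This fixes the order of the argument: the drift is removed first, with smooth test
  functions; the resulting identity is extended to all Borel functions with values in
  [0,\<infinity>]; only then is the killing term absorbed. To survive that extension, the identity
  keeps gains and losses on opposite sides, and cancelling the killing term rests on the finite mean
  jump rate. Calculus with the survival probability goes through the cumulative hazard, which
  carries the hazard measure to Lebesgue measure.

  The weak equation allows only test functions fixed in time. Letting them move costs one more
  derivative: x f'(x) must itself be a test function, hence the C^2 functions. The constant 2 comes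
  from the integral of y over (0, z), which is half of z^2, against the factor R(z) / z of the
  stationary equation.\<close>

locale hazard =
  fixes R :: "real \<Rightarrow> real"
  assumes R_meas [measurable]: "R \<in> borel_measurable borel"
    and R_nonneg: "\<And>x. 0 \<le> R x"
    and R_neg: "\<And>x. x < 0 \<Longrightarrow> R x = 0"
    and R_int: "\<And>x. set_integrable lborel {0..x} R"
begin

definition A :: "real \<Rightarrow> real" where
  "A x = (LBINT u:{0..x}. R u)"

text \<open>The jump rate per unit of time: the flow moves at speed x, which multiplies the hazard
  \<open>R\<close> per unit of length.\<close>

definition k :: "real \<Rightarrow> real" where
  "k x = x * R x"

text \<open>Agrees with \<open>surv\<close> for r \<ge> 0 (\<open>surv_eq\<close>). Written through
  differences of \<open>A\<close>, the cocycle rule \<open>S_mult\<close> holds for all real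
  arguments, without cases on signs.\<close>

definition S :: "real \<Rightarrow> real \<Rightarrow> real" where
  "S z r = exp (- (A (z * exp r) - A z))"

lemma k_nonneg: "0 \<le> k x"
  using R_nonneg[of x] R_neg[of x] by (cases "x < 0") (auto simp: k_def)

lemma k_measurable [measurable]: "k \<in> borel_measurable borel"
  unfolding k_def by measurable

lemma R_int_atMost: "set_integrable lborel {..x} R"
proof -
  have "indicator {..x} u *\<^sub>R R u = indicator {0..x} u *\<^sub>R R u" for u
    using R_neg[of u] by (auto simp: indicator_def)
  then have "(\<lambda>u. indicator {..x} u *\<^sub>R R u) = (\<lambda>u. indicator {0..x} u *\<^sub>R R u)" by (rule ext)
  then show ?thesis using R_int[of x] unfolding set_integrable_def by argo
qed

lemma R_int_Icc: "set_integrable lborel {x..y} R"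
  by (rule set_integrable_subset[OF R_int_atMost[of y]]) auto

text \<open>Since \<open>R\<close> vanishes on the negative half-line, the integral may start at
  -\<infinity>. Half-lines are nested, so increments of \<open>A\<close> are additive whatever the
  signs of the end points.\<close>

lemma A_atMost: "A x = (LBINT u:{..x}. R u)"
proof -
  have "indicator {..x} u *\<^sub>R R u = indicator {0..x} u *\<^sub>R R u" for u
    using R_neg[of u] by (auto simp: indicator_def)
  then have "(\<lambda>u. indicator {..x} u *\<^sub>R R u) = (\<lambda>u. indicator {0..x} u *\<^sub>R R u)" by (rule ext)
  then show ?thesis unfolding A_def set_lebesgue_integral_def by simp
qed

lemma A_diff_Ioc:
  assumes "x \<le> y"
  shows "(LBINT u:{x<..y}. R u) = A y - A x"
proof -
  have eq: "{..y} = {..x} \<union> {x<..y}" using assms by auto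
  have "A y = A x + (LBINT u:{x<..y}. R u)"
    unfolding A_atMost eq
    by (rule set_integral_Un)
       (auto intro: R_int_atMost set_integrable_subset[OF R_int_atMost[of y]])
  then show ?thesis by simp
qed

lemma A_diff:
  assumes "x \<le> y"
  shows "(LBINT u:{x..y}. R u) = A y - A x"
proof -
  have "(LBINT u:{x..y}. R u) = (LBINT u:{x<..y}. R u)"
    unfolding set_lebesgue_integral_def
  proof (rule integral_cong_AE)
    show "AE u in lborel. indicator {x..y} u *\<^sub>R R u = indicator {x<..y} u *\<^sub>R R u"
      using AE_lborel_singleton[of x] by eventually_elim (auto simp: indicator_def)
  qed auto
  then show ?thesis using A_diff_Ioc[OF assms] by simp
qed

lemma A_nn_Ioc:
  assumes "x \<le> y"
  shows "(\<integral>\<^sup>+u\<in>{x<..y}. ennreal (R u) \<partial>lborel) = ennreal (A y - A x)"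
proof -
  have "set_integrable lborel {x<..y} R"
    by (rule set_integrable_subset[OF R_int_Icc[of x y]]) auto
  then have "(\<integral>\<^sup>+u. ennreal (indicator {x<..y} u *\<^sub>R R u) \<partial>lborel) = ennreal (A y - A x)"
    using R_nonneg
    by (subst nn_integral_eq_integral)
       (auto simp: set_integrable_def A_diff_Ioc[OF assms, symmetric] set_lebesgue_integral_def)
  moreover have "(\<integral>\<^sup>+u. ennreal (indicator {x<..y} u *\<^sub>R R u) \<partial>lborel)
    = (\<integral>\<^sup>+u\<in>{x<..y}. ennreal (R u) \<partial>lborel)"
    by (rule nn_integral_cong) (simp add: indicator_def)
  ultimately show ?thesis by simp
qed

lemma A_mono: "x \<le> y \<Longrightarrow> A x \<le> A y"
proof -
  assume "x \<le> y"
  have "0 \<le> (LBINT u:{x<..y}. R u)"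
    unfolding set_lebesgue_integral_def using R_nonneg by (intro Bochner_Integration.integral_nonneg) auto
  then show ?thesis using A_diff_Ioc[OF \<open>x \<le> y\<close>] by simp
qed

lemma A_nonpos: "x \<le> 0 \<Longrightarrow> A x = 0"
proof -
  assume "x \<le> 0"
  have "A x \<le> A 0" using A_mono[OF \<open>x \<le> 0\<close>] .
  moreover have "A 0 = 0" using A_diff[of 0 0] by (simp add: A_def)
  moreover have "0 \<le> A x" unfolding A_def set_lebesgue_integral_def
    using R_nonneg by (intro Bochner_Integration.integral_nonneg) auto
  ultimately show "A x = 0" by simp
qed

lemma A_nonneg: "0 \<le> A x"
  using A_nonpos[of x] A_nonpos[of 0] A_mono[of 0 x] by (cases "x \<le> 0") auto

lemma A_continuous: "continuous_on UNIV A"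
proof -
  have "isCont A x" for x
  proof -
    \<comment> \<open>On [-c, c] the function \<open>A\<close> is the indefinite integral started at
      -c, because \<open>A\<close> vanishes there; x lies in the interior.\<close>
    define c where "c = \<bar>x\<bar> + 1"
    have eq: "A y = integral {- c..y} R" if "y \<in> {- c..c}" for y
    proof -
      have "A y = A y - A (- c)" using A_nonpos[of "-c"] by (simp add: c_def)
      also have "\<dots> = (LBINT u:{- c..y}. R u)" using that by (subst A_diff) auto
      also have "\<dots> = integral {- c..y} R"
        by (rule set_borel_integral_eq_integral) (rule R_int_Icc)
      finally show ?thesis .
    qed
    have "R integrable_on {- c..c}"
      by (rule set_borel_integral_eq_integral) (rule R_int_Icc)
    then have "continuous_on {- c..c} (\<lambda>y. integral {- c..y} R)"
      by (rule indefinite_integral_continuous_1)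
    then have "continuous_on {- c..c} A"
      by (rule continuous_on_eq) (simp only: eq)
    then have "continuous_on {- c<..<c} A"
      by (rule continuous_on_subset) auto
    then show "isCont A x"
      by (rule continuous_on_interior) (auto simp: c_def)
  qed
  then show ?thesis by (simp add: continuous_at_imp_continuous_on)
qed

lemma A_measurable [measurable]: "A \<in> borel_measurable borel"
  using A_continuous by (rule borel_measurable_continuous_onI)

lemma S_measurable [measurable]: "(\<lambda>(z, r). S z r) \<in> borel_measurable (borel \<Otimes>\<^sub>M borel)"
  unfolding S_def by measurable

lemma S_pos: "0 < S z r"
  by (simp add: S_def)

lemma S_le_1: "0 \<le> r \<Longrightarrow> S z r \<le> 1"
proof -
  assume r: "0 \<le> r"
  have "A z \<le> A (z * exp r)"
  proof (cases "z \<le> 0")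
    case True then show ?thesis using A_nonpos[of z] A_nonneg by simp
  next
    case False
    then have "z * 1 \<le> z * exp r" using r by (intro mult_left_mono) auto
    then show ?thesis by (intro A_mono) simp
  qed
  then show ?thesis by (simp add: S_def)
qed

lemma S_0: "S z 0 = 1"
  by (simp add: S_def)

lemma S_mult: "S z (r + s) = S z r * S (z * exp r) s"
  by (simp add: S_def mult.assoc flip: exp_add)

lemma S_antimono: "r \<le> s \<Longrightarrow> S z s \<le> S z r"
  using S_mult[of z r "s - r"] S_le_1[of "s - r" "z * exp r"] S_pos[of z r]
  by (simp add: mult_left_le)

section \<open>Change of variables by the cumulative hazard\<close>

lemma Ioc_inter_greaterThan: "{a<..b} \<inter> {y<..} = {max a y<..(b::real)}"
  by auto

text \<open>This stands in for the substitution y = A(u), where \<open>A\<close> need be neither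
  differentiable nor injective. Both measures are compared on half-lines: for y between A(a) and
  A(b), monotonicity and continuity make the part of (a, b] where \<open>A\<close> exceeds y an
  interval (c, b] with A(c) = y, whose hazard is A(b) - y.\<close>

lemma hazard_distr:
  assumes "a \<le> b"
  shows "distr (density lborel (\<lambda>u. ennreal (R u) * indicator {a<..b} u)) borel A
    = density lborel (indicator {A a<..A b})" (is "?M = ?N")
proof (rule measure_eqI_lessThan)
  fix y
  have N: "emeasure ?N {y<..} = ennreal (A b - max (A a) y)"
  proof -
    have "emeasure ?N {y<..} = (\<integral>\<^sup>+u. indicator {max (A a) y<..A b} u \<partial>lborel)"
      by (subst emeasure_density) (simp_all add: indicator_inter_arith[symmetric] Ioc_inter_greaterThan max.commute)
    also have "\<dots> = ennreal (A b - max (A a) y)"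
      by (cases "max (A a) y \<le> A b") (auto simp: ennreal_neg)
    finally show ?thesis .
  qed
  have M: "emeasure ?M {y<..} = (\<integral>\<^sup>+u\<in>{u. a < u \<and> u \<le> b \<and> y < A u}. ennreal (R u) \<partial>lborel)"
    by (subst emeasure_distr, measurable, subst emeasure_density)
       (auto intro!: nn_integral_cong measurable_sets_borel[OF A_measurable] simp: indicator_def)
  show eq: "emeasure ?M {y<..} = emeasure ?N {y<..}"
  proof -
    consider "y < A a" | "A b \<le> y" | "A a \<le> y" "y < A b" by linarith
    then show ?thesis
    proof cases
      case 1
      have "y < A u" if "a < u" for u using A_mono[of a u] 1 that by simp
      then have "{u. a < u \<and> u \<le> b \<and> y < A u} = {a<..b}" by auto
      then show ?thesis unfolding M N using 1 by (simp add: A_nn_Ioc[OF assms])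
    next
      case 2
      have "\<not> y < A u" if "u \<le> b" for u using A_mono[of u b] 2 that by simp
      then have "{u. a < u \<and> u \<le> b \<and> y < A u} = {}" by auto
      then show ?thesis unfolding M N using 2 A_mono[OF assms] by (simp add: ennreal_neg)
    next
      case 3
      \<comment> \<open>The last point c of level at most y is taken, because \<open>A\<close> may
        be flat at level y. Compactness provides c and the intermediate value theorem forces A(c) =
        y.\<close>
      define C where "C = {u\<in>{a..b}. A u \<le> y}"
      have "C = {a..b} \<inter> {u. A u \<le> y}" by (auto simp: C_def)
      then have "closed C"
        by (simp add: closed_Int closed_Collect_le[OF A_continuous continuous_on_const])
      then have "compact C"
        by (intro compact_eq_bounded_closed[THEN iffD2] conjI)
           (auto simp: C_def intro: bounded_subset[OF bounded_closed_interval[of a b]])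
      moreover have "a \<in> C" using 3 assms by (auto simp: C_def)
      ultimately obtain c where c: "c \<in> C" "\<And>u. u \<in> C \<Longrightarrow> u \<le> c"
        using compact_attains_sup[of C] by blast
      have ab: "a \<le> c" "c \<le> b" "A c \<le> y" using c by (auto simp: C_def)
      have "A c = y"
      proof (rule ccontr)
        assume "A c \<noteq> y"
        then have "A c < y" using ab by simp
        have "\<exists>u\<ge>c. u \<le> b \<and> A u = y"
          by (rule IVT') (use ab 3 in \<open>auto intro: continuous_on_subset[OF A_continuous]\<close>)
        then obtain u where u: "c \<le> u" "u \<le> b" "A u = y" by auto
        then have "u \<in> C" using ab by (auto simp: C_def)
        then show False using c u \<open>A c < y\<close> by fastforce
      qed
      have "{u. a < u \<and> u \<le> b \<and> y < A u} = {c<..b}"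
      proof safe
        fix u assume u: "a < u" "u \<le> b" "y < A u"
        then show "u \<in> {c<..b}" using A_mono[of u c] \<open>A c = y\<close> by (cases "u \<le> c") auto
      next
        fix u assume u: "u \<in> {c<..b}"
        then show "a < u" "u \<le> b" using ab by auto
        show "y < A u" using c(2)[of u] u ab by (cases "A u \<le> y") (auto simp: C_def)
      qed
      then show ?thesis unfolding M N using 3 ab \<open>A c = y\<close> by (simp add: A_nn_Ioc max_def)
    qed
  qed
  show "emeasure ?M {y<..} < \<infinity>" unfolding eq N by simp
qed auto

lemma hazard_subst:
  assumes "a \<le> b" and [measurable]: "g \<in> borel_measurable borel"
  shows "(\<integral>\<^sup>+u\<in>{a<..b}. ennreal (R u) * g (A u) \<partial>lborel) = (\<integral>\<^sup>+y\<in>{A a<..A b}. g y \<partial>lborel)"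
proof -
  have "(\<integral>\<^sup>+y\<in>{A a<..A b}. g y \<partial>lborel) = (\<integral>\<^sup>+y. g y \<partial>density lborel (indicator {A a<..A b}))"
    by (subst nn_integral_density) (auto simp: mult.commute)
  also have "\<dots> = (\<integral>\<^sup>+u. g (A u) \<partial>density lborel (\<lambda>u. ennreal (R u) * indicator {a<..b} u))"
    unfolding hazard_distr[OF assms(1), symmetric] by (subst nn_integral_distr) auto
  also have "\<dots> = (\<integral>\<^sup>+u\<in>{a<..b}. ennreal (R u) * g (A u) \<partial>lborel)"
    by (subst nn_integral_density) (auto simp: mult_ac)
  finally show ?thesis ..
qed

lemma nn_integral_Ioc_Icc:
  "(\<integral>\<^sup>+u\<in>{a<..b}. f u \<partial>lborel) = (\<integral>\<^sup>+u\<in>{a..b}. f u \<partial>(lborel :: real measure))"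
proof (rule nn_integral_cong_AE)
  show "AE u in lborel. f u * indicator {a<..b} u = f u * indicator {a..b} u"
    using AE_lborel_singleton[of a] by eventually_elim (auto simp: indicator_def)
qed

text \<open>In the variable y = A(u) the integrand is an exponential with an explicit primitive.
  Here the exponent is anchored at the right end b (survival from u to b); in
  \<open>hazard_exp_right\<close> it is anchored at a (survival from a to u).\<close>

lemma hazard_exp_left:
  assumes "a \<le> b"
  shows "(\<integral>\<^sup>+u\<in>{a..b}. ennreal (R u * exp (- (A b - A u))) \<partial>lborel) = ennreal (1 - exp (- (A b - A a)))"
proof -
  have "(\<integral>\<^sup>+u\<in>{a..b}. ennreal (R u * exp (- (A b - A u))) \<partial>lborel)
    = (\<integral>\<^sup>+u\<in>{a<..b}. ennreal (R u) * ennreal (exp (- (A b - A u))) \<partial>lborel)"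
    by (simp add: ennreal_mult R_nonneg nn_integral_Ioc_Icc)
  also have "\<dots> = (\<integral>\<^sup>+y\<in>{A a..A b}. ennreal (exp (- (A b - y))) \<partial>lborel)"
    by (subst hazard_subst[OF assms, of "\<lambda>y. ennreal (exp (- (A b - y)))"]) (auto simp: nn_integral_Ioc_Icc)
  also have "\<dots> = ennreal (exp (- (A b - A b)) - exp (- (A b - A a)))"
    by (rule nn_integral_FTC_Icc) (auto intro!: derivative_eq_intros A_mono assms)
  finally show ?thesis by simp
qed

lemma hazard_exp_right:
  assumes "a \<le> b"
  shows "(\<integral>\<^sup>+u\<in>{a..b}. ennreal (R u * exp (- (A u - A a))) \<partial>lborel) = ennreal (1 - exp (- (A b - A a)))"
proof -
  have "(\<integral>\<^sup>+u\<in>{a..b}. ennreal (R u * exp (- (A u - A a))) \<partial>lborel)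
    = (\<integral>\<^sup>+u\<in>{a<..b}. ennreal (R u) * ennreal (exp (- (A u - A a))) \<partial>lborel)"
    by (simp add: ennreal_mult R_nonneg nn_integral_Ioc_Icc)
  also have "\<dots> = (\<integral>\<^sup>+y\<in>{A a..A b}. ennreal (exp (- (y - A a))) \<partial>lborel)"
    by (subst hazard_subst[OF assms, of "\<lambda>y. ennreal (exp (- (y - A a)))"]) (auto simp: nn_integral_Ioc_Icc)
  also have "\<dots> = ennreal (- exp (- (A b - A a)) - (- exp (- (A a - A a))))"
    by (rule nn_integral_FTC_Icc) (auto intro!: derivative_eq_intros A_mono assms)
  finally show ?thesis by simp
qed

text \<open>The substitution u = x e^r: its Jacobian x e^r turns the hazard \<open>R\<close> per
  length into the rate \<open>k\<close> per time.\<close>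

lemma hazard_flow:
  assumes "0 < x" "0 \<le> T" and [measurable]: "g \<in> borel_measurable borel"
    and "\<And>u. 0 \<le> g u"
  shows "(\<integral>\<^sup>+r\<in>{0..T}. ennreal (k (x * exp r) * g (x * exp r)) \<partial>lborel)
    = (\<integral>\<^sup>+u\<in>{x..x * exp T}. ennreal (R u * g u) \<partial>lborel)"
proof -
  have "(\<integral>\<^sup>+u. ennreal (R u * g u * indicator {x * exp 0..x * exp T} u) \<partial>lborel)
    = (\<integral>\<^sup>+r. ennreal (R (x * exp r) * g (x * exp r) * (x * exp r) * indicator {0..T} r) \<partial>lborel)"
    using assms(1,2)
    by (intro nn_integral_substitution)
       (auto intro!: derivative_eq_intros continuous_intros simp: set_borel_measurable_def)
  moreover have "(\<integral>\<^sup>+u. ennreal (R u * g u * indicator {x * exp 0..x * exp T} u) \<partial>lborel)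
     = (\<integral>\<^sup>+u\<in>{x..x * exp T}. ennreal (R u * g u) \<partial>lborel)"
    by (rule nn_integral_cong) (simp add: indicator_def)
  moreover have "(\<integral>\<^sup>+r. ennreal (R (x * exp r) * g (x * exp r) * (x * exp r) * indicator {0..T} r) \<partial>lborel)
     = (\<integral>\<^sup>+r\<in>{0..T}. ennreal (k (x * exp r) * g (x * exp r)) \<partial>lborel)"
    by (rule nn_integral_cong) (simp add: indicator_def k_def mult_ac)
  ultimately show ?thesis by simp
qed

text \<open>The integrand is, for almost every r, the derivative in r of S(x e^r, T - r), which
  rises from S(x, T) to 1. This is the identity behind Duhamel's formula in
  \<open>killed_add_integral\<close>.\<close>

lemma S_backward:
  assumes "0 < x" "0 \<le> T"
  shows "ennreal (S x T) + (\<integral>\<^sup>+r\<in>{0..T}. ennreal (k (x * exp r) * S (x * exp r) (T - r)) \<partial>lborel) = 1"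
proof -
  have xT: "x \<le> x * exp T" using assms by simp
  have "(\<integral>\<^sup>+r\<in>{0..T}. ennreal (k (x * exp r) * S (x * exp r) (T - r)) \<partial>lborel)
     = (\<integral>\<^sup>+r\<in>{0..T}. ennreal (k (x * exp r) * exp (- (A (x * exp T) - A (x * exp r)))) \<partial>lborel)"
    by (intro nn_integral_cong) (simp add: S_def mult.assoc flip: exp_add)
  also have "\<dots> = (\<integral>\<^sup>+u\<in>{x..x * exp T}. ennreal (R u * exp (- (A (x * exp T) - A u))) \<partial>lborel)"
    using assms by (subst hazard_flow[of _ _ "\<lambda>u. exp (- (A (x * exp T) - A u))"]) auto
  also have "\<dots> = ennreal (1 - S x T)"
    unfolding hazard_exp_left[OF xT] by (simp add: S_def)
  finally show ?thesis using S_pos[of x T] S_le_1[OF assms(2), of x]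
    by (simp flip: ennreal_plus)
qed

text \<open>The integrand is the density of the first jump time for a path started at x.\<close>

lemma S_forward:
  assumes "0 < x" "0 \<le> T"
  shows "(\<integral>\<^sup>+r\<in>{0..T}. ennreal (k (x * exp r) * S x r) \<partial>lborel) = ennreal (1 - S x T)"
proof -
  have xT: "x \<le> x * exp T" using assms by simp
  have "(\<integral>\<^sup>+r\<in>{0..T}. ennreal (k (x * exp r) * S x r) \<partial>lborel)
     = (\<integral>\<^sup>+r\<in>{0..T}. ennreal (k (x * exp r) * exp (- (A (x * exp r) - A x))) \<partial>lborel)"
    by (simp add: S_def)
  also have "\<dots> = (\<integral>\<^sup>+u\<in>{x..x * exp T}. ennreal (R u * exp (- (A u - A x))) \<partial>lborel)"
    using assms by (subst hazard_flow[of _ _ "\<lambda>u. exp (- (A u - A x))"]) auto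
  also have "\<dots> = ennreal (1 - S x T)"
    unfolding hazard_exp_right[OF xT] by (simp add: S_def)
  finally show ?thesis .
qed

end

section \<open>Law of the waiting time until a jump\<close>

context hazard
begin

lemma surv_eq:
  assumes "0 \<le> t"
  shows "surv R z t = S z t"
proof (cases "z \<le> z * exp t")
  case True
  then show ?thesis by (simp add: surv_def S_def A_diff)
next
  case False
  then have "z \<le> 0" using assms mult_left_mono[of 1 "exp t" z] by (cases "z \<le> 0") auto
  then have "z * exp t \<le> 0" by (simp add: mult_le_0_iff)
  then show ?thesis using False \<open>z \<le> 0\<close>
    by (simp add: surv_def S_def A_nonpos set_lebesgue_integral_def)
qed

lemma S_continuous: "continuous_on UNIV (S z)"
  unfolding S_def by (intro continuous_intros continuous_on_compose2[OF A_continuous]) auto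

text \<open>The infimum in \<open>surv_inv\<close> is attained when finite: by continuity, a
  survival probability above u at time t is still above u a little later, so the infimum lies
  strictly beyond t.\<close>

lemma surv_inv_le_iff:
  assumes "0 \<le> t"
  shows "surv_inv R z u \<le> ennreal t \<longleftrightarrow> S z t \<le> u"
proof
  assume "S z t \<le> u"
  then show "surv_inv R z u \<le> ennreal t"
    unfolding surv_inv_def using assms by (intro Inf_lower) (auto simp: surv_eq)
next
  assume le: "surv_inv R z u \<le> ennreal t"
  show "S z t \<le> u"
  proof (rule ccontr)
    assume "\<not> S z t \<le> u"
    then have "0 < S z t - u" by simp
    moreover have "isCont (S z) t"
      using S_continuous by (simp add: continuous_on_eq_continuous_at)
    ultimately obtain d where d: "d > 0" "\<And>r. dist r t < d \<Longrightarrow> dist (S z r) (S z t) < S z t - u"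
      unfolding continuous_at_eps_delta by blast
    have gt: "u < S z (t + d / 2)"
      using d(2)[of "t + d / 2"] d(1) by (auto simp: dist_real_def abs_if split: if_splits)
    have "ennreal (t + d / 2) \<le> surv_inv R z u"
      unfolding surv_inv_def
    proof (intro Inf_greatest, clarify)
      fix r assume r: "0 \<le> r" "surv R z r \<le> u"
      then have "\<not> r \<le> t + d / 2"
        using S_antimono[of r "t + d / 2" z] gt by (auto simp: surv_eq)
      then show "ennreal (t + d / 2) \<le> ennreal r" by (intro ennreal_leI) simp
    qed
    with le have "ennreal (t + d / 2) \<le> ennreal t" by (rule order_trans[rotated])
    then show False using assms d(1) by (simp add: ennreal_le_iff)
  qed
qed

lemma surv_inv_measurable [measurable]:
  "(\<lambda>(z, u). surv_inv R z u) \<in> borel_measurable (borel \<Otimes>\<^sub>M borel)"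
proof (rule borel_measurableI_le)
  fix y :: ennreal
  show "{x \<in> space (borel \<Otimes>\<^sub>M borel). (case x of (z, u) \<Rightarrow> surv_inv R z u) \<le> y}
    \<in> sets (borel \<Otimes>\<^sub>M borel)"
  proof (cases y)
    case (real t)
    have "{x \<in> space (borel \<Otimes>\<^sub>M borel). (case x of (z, u) \<Rightarrow> surv_inv R z u) \<le> y}
      = {x \<in> space (borel \<Otimes>\<^sub>M borel). S (fst x) t \<le> snd x}"
      using real by (auto simp: surv_inv_le_iff split: prod.splits)
    also have "\<dots> \<in> sets (borel \<Otimes>\<^sub>M borel)" by measurable
    finally show ?thesis .
  next
    case top
    then have "{x \<in> space (borel \<Otimes>\<^sub>M borel). (case x of (z, u) \<Rightarrow> surv_inv R z u) \<le> y}
      = space (borel \<Otimes>\<^sub>M borel)" by auto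
    then show ?thesis by (simp only: sets.top)
  qed
qed

lemma S_forward_Ioc:
  assumes "0 < z" "0 \<le> r" "r \<le> T"
  shows "(\<integral>\<^sup>+s\<in>{r<..T}. ennreal (k (z * exp s) * S z s) \<partial>lborel) = ennreal (S z r - S z T)"
proof -
  let ?X = "\<integral>\<^sup>+s\<in>{r<..T}. ennreal (k (z * exp s) * S z s) \<partial>lborel"
  have "ennreal (1 - S z T) = (\<integral>\<^sup>+s\<in>{0..T}. ennreal (k (z * exp s) * S z s) \<partial>lborel)"
    using assms by (subst S_forward) auto
  also have "\<dots> = (\<integral>\<^sup>+s. ennreal (k (z * exp s) * S z s) * indicator {0..r} s
      + ennreal (k (z * exp s) * S z s) * indicator {r<..T} s \<partial>lborel)"
    using assms by (intro nn_integral_cong) (auto simp: indicator_def)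
  also have "\<dots> = ennreal (1 - S z r) + ?X"
    using assms by (subst nn_integral_add) (auto simp: S_forward)
  finally have eq: "ennreal (1 - S z r) + ?X = ennreal (1 - S z T)" ..
  have "ennreal (1 - S z r) + ennreal (S z r - S z T) = ennreal (1 - S z T)"
    using assms by (subst ennreal_plus[symmetric]) (auto simp: S_le_1 S_antimono)
  then have "ennreal (1 - S z r) + ?X = ennreal (1 - S z r) + ennreal (S z r - S z T)"
    by (simp only: eq)
  then show ?thesis by (simp only: ennreal_add_left_cancel) simp
qed

text \<open>Inverse transform sampling. It is restricted to waiting times up to T because survival
  need not tend to 0, and then \<open>surv_inv\<close> is infinite with positive probability. On a
  half-line, sampling gives the length of an interval of uniform values, and the density gives the
  same difference of survival probabilities by \<open>S_forward_Ioc\<close>.\<close>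

lemma surv_inv_distr:
  assumes "0 < z" "0 \<le> T"
  shows "distr (density lborel (indicator {u\<in>{0<..<1}. surv_inv R z u \<le> ennreal T})) borel
      (\<lambda>u. enn2real (surv_inv R z u))
    = density lborel (\<lambda>r. ennreal (k (z * exp r) * S z r) * indicator {0..T} r)" (is "?M = ?N")
proof (rule measure_eqI_lessThan)
  fix y :: real
  \<comment> \<open>Waiting times are nonnegative, so a half-line with y < 0 counts like the one
    starting at 0, up to a null set.\<close>
  define y' where "y' = max 0 y"
  have y': "0 \<le> y'" by (simp add: y'_def)
  have gt: "y < enn2real (surv_inv R z u) \<longleftrightarrow> u < S z y'"
    if "u \<in> {0<..<1}" "surv_inv R z u \<le> ennreal T" for u
  proof (cases "0 \<le> y")
    case True
    have fin: "surv_inv R z u = ennreal (enn2real (surv_inv R z u))"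
      using that(2) by (cases "surv_inv R z u") (auto simp: top_unique)
    have "enn2real (surv_inv R z u) \<le> y \<longleftrightarrow> surv_inv R z u \<le> ennreal y"
      using True by (subst (2) fin) (simp add: ennreal_le_iff)
    then show ?thesis using True by (simp add: surv_inv_le_iff y'_def flip: not_le)
  next
    case False
    then have "y < enn2real (surv_inv R z u)"
      by (meson enn2real_nonneg less_le_trans not_le)
    then show ?thesis using that False by (simp add: y'_def S_0)
  qed
  have "emeasure ?M {y<..} = emeasure lborel {u\<in>{0<..<1}. surv_inv R z u \<le> ennreal T \<and> y < enn2real (surv_inv R z u)}"
  proof -
    have [measurable]: "{u\<in>{0<..<1}. surv_inv R z u \<le> ennreal T} \<in> sets borel" by measurable
    have [measurable]: "(\<lambda>u. enn2real (surv_inv R z u)) -` {y<..} \<in> sets borel"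
      by (rule measurable_sets_borel) measurable
    show ?thesis
      by (subst emeasure_distr, measurable, subst emeasure_density)
         (auto simp: Int_def simp flip: indicator_inter_arith nn_integral_indicator intro!: nn_integral_cong
            split: split_indicator)
  qed
  also have "{u\<in>{0<..<1}. surv_inv R z u \<le> ennreal T \<and> y < enn2real (surv_inv R z u)} = {S z T..<S z y'}"
    using gt assms S_pos[of z T] S_le_1[OF y', of z] by (auto simp: surv_inv_le_iff)
  also have "emeasure lborel \<dots> = ennreal (S z y' - S z T)"
    by (cases "S z T \<le> S z y'") (auto simp: ennreal_neg)
  finally have M: "emeasure ?M {y<..} = ennreal (S z y' - S z T)" .
  have "emeasure ?N {y<..} = (\<integral>\<^sup>+s\<in>{y'<..T}. ennreal (k (z * exp s) * S z s) \<partial>lborel)"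
  proof -
    have "AE s in lborel. ennreal (k (z * exp s) * S z s) * indicator {0..T} s * indicator {y<..} s
       = ennreal (k (z * exp s) * S z s) * indicator {y'<..T} s"
      using AE_lborel_singleton[of 0] by eventually_elim (auto simp: indicator_def y'_def)
    then show ?thesis by (subst emeasure_density) (auto intro!: nn_integral_cong_AE)
  qed
  also have "\<dots> = ennreal (S z y' - S z T)"
  proof (cases "y' \<le> T")
    case True
    then show ?thesis using assms y' by (simp add: S_forward_Ioc)
  next
    case False
    then show ?thesis using S_antimono[of T y' z] by (simp add: ennreal_neg)
  qed
  finally show "emeasure ?M {y<..} = emeasure ?N {y<..}" by (simp only: M)
  show "emeasure ?M {y<..} < \<infinity>" unfolding M by simp
qed auto

lemma nn_integral_surv_inv:
  assumes "0 \<le> T" and [measurable]: "h \<in> borel_measurable borel"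
  shows "(\<integral>\<^sup>+u\<in>{0<..<1}. (if surv_inv R z u \<le> ennreal T then h (enn2real (surv_inv R z u)) else 0) \<partial>lborel)
    = (\<integral>\<^sup>+r\<in>{0..T}. ennreal (k (z * exp r) * S z r) * h r \<partial>lborel)" (is "?l = ?r")
proof (cases "0 < z")
  case True
  have [measurable]: "{u\<in>{0<..<1}. surv_inv R z u \<le> ennreal T} \<in> sets borel" by measurable
  have "?r = (\<integral>\<^sup>+r. h r \<partial>density lborel (\<lambda>r. ennreal (k (z * exp r) * S z r) * indicator {0..T} r))"
    by (subst nn_integral_density) (auto simp: mult_ac)
  also have "\<dots> = ?l"
    unfolding surv_inv_distr[OF True assms(1), symmetric]
    by (subst nn_integral_distr, measurable, subst nn_integral_density)
       (auto intro!: nn_integral_cong simp: indicator_def)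
  finally show ?thesis ..
next
  \<comment> \<open>There is no hazard left of 0: the rate is zero and survival is certain, so no u
    < 1 gives a finite waiting time, and both sides vanish.\<close>
  case False
  then have nonpos: "z \<le> 0" "z * exp r \<le> 0" for r by (simp_all add: mult_le_0_iff)
  have "k (z * exp r) = 0" for r
    using R_neg[of "z * exp r"] nonpos(2)[of r] by (cases "z * exp r = 0") (auto simp: k_def)
  moreover have "S z r = 1" for r
    using nonpos by (simp add: S_def A_nonpos)
  moreover have "?l = (\<integral>\<^sup>+(u::real). 0 \<partial>lborel)"
    using \<open>\<And>r. S z r = 1\<close> assms(1)
    by (intro nn_integral_cong) (auto simp: surv_inv_le_iff indicator_def)
  ultimately show ?thesis by simp
qed

end

section \<open>The jump chain\<close>

definition unif :: "real measure" where
  "unif = uniform_measure lborel {0<..<1}"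

lemma sets_unif [measurable_cong, simp]: "sets unif = sets borel"
  by (simp add: unif_def)

lemma space_unif [simp]: "space unif = UNIV"
  by (simp add: unif_def)

lemma prob_space_unif: "prob_space unif"
  unfolding unif_def by (rule prob_space_uniform_measure) auto

lemma nn_integral_unif:
  "f \<in> borel_measurable borel \<Longrightarrow> (\<integral>\<^sup>+v. f v \<partial>unif) = (\<integral>\<^sup>+v\<in>{0<..<1}. f v \<partial>lborel)"
  unfolding unif_def by (subst nn_integral_uniform_measure) (auto simp: divide_ennreal_def)

text \<open>Times and positions of the first jumps read finitely many uniforms; a finite product can
  be integrated one coordinate at a time, the last one innermost.\<close>

definition unifs :: "nat \<Rightarrow> (nat \<Rightarrow> real) measure" where
  "unifs n = PiM {1..n} (\<lambda>_. unif)"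

lemma sets_unifs [measurable_cong]: "sets (unifs n) = sets (PiM {1..n} (\<lambda>_. borel))"
  unfolding unifs_def by (rule sets_PiM_cong) auto

lemma prob_space_unifs: "prob_space (unifs n)"
  unfolding unifs_def by (rule prob_space_PiM) (rule prob_space_unif)

lemma unifs_component [simp]:
  assumes "1 \<le> i" "i \<le> n"
  shows "(\<lambda>u. u i) \<in> borel_measurable (unifs n)"
  unfolding measurable_cong_sets[OF sets_unifs refl]
  by (rule measurable_component_singleton) (use assms in auto)

lemma unifs_component_fst [simp]:
  assumes "1 \<le> i" "i \<le> n"
  shows "(\<lambda>w. fst w i) \<in> borel_measurable (unifs n \<Otimes>\<^sub>M N)"
  using assms by (intro measurable_compose[OF measurable_fst unifs_component])

lemma unifs_component_snd [simp]:
  assumes "1 \<le> i" "i \<le> n"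
  shows "(\<lambda>w. snd w i) \<in> borel_measurable (N \<Otimes>\<^sub>M unifs n)"
  using assms by (intro measurable_compose[OF measurable_snd unifs_component])

lemma nn_integral_unifs_0: "(\<integral>\<^sup>+u. f u \<partial>unifs 0) = f (\<lambda>_. undefined)"
  unfolding unifs_def by (simp add: PiM_empty nn_integral_count_space_finite)

lemma nn_integral_unifs_Suc:
  assumes f: "f \<in> borel_measurable (unifs (Suc n))"
  shows "(\<integral>\<^sup>+u. f u \<partial>unifs (Suc n)) = (\<integral>\<^sup>+u. \<integral>\<^sup>+v. f (u(Suc n := v)) \<partial>unif \<partial>unifs n)"
proof -
  interpret product_sigma_finite "\<lambda>_. unif"
    by (rule product_sigma_finite.intro) (rule prob_space_imp_sigma_finite[OF prob_space_unif])
  have eq: "{1..Suc n} = insert (Suc n) {1..n}" by auto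
  show ?thesis
    using f unfolding unifs_def eq by (subst product_nn_integral_insert) auto
qed

text \<open>The square root of a uniform variable has density 2u on (0, 1), so for x > 0 this is the
  average over [0, x] with weight 2u / x^2 from the generator, for functions with values in
  [0,\<infinity>].\<close>

definition mean_frag :: "(real \<Rightarrow> ennreal) \<Rightarrow> real \<Rightarrow> ennreal" where
  "mean_frag f x = (\<integral>\<^sup>+v. f (x * sqrt v) \<partial>unif)"

text \<open>The flow is multiplication by e^t and commutes with the multiplicative jumps, so the
  position after n jumps does not depend on when they happened.\<close>

definition pos :: "real \<Rightarrow> (nat \<Rightarrow> real) \<Rightarrow> nat \<Rightarrow> real \<Rightarrow> real" where
  "pos x u n t = x * exp t * (\<Prod>j=1..n. jump u j)"

lemma pos_0: "pos x u 0 t = x * exp t"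
  by (simp add: pos_def)

lemma pos_add: "pos x u n (s + t) = pos x u n s * exp t"
  by (simp add: pos_def exp_add)

lemma pos_Suc: "pos x u (Suc n) t = pos x u n t * sqrt (u (2 * n + 2))"
  by (simp add: pos_def jump_def)

lemma pos_cong: "(\<And>i. 1 \<le> i \<Longrightarrow> i \<le> 2 * n \<Longrightarrow> u i = v i) \<Longrightarrow> pos x u n t = pos x v n t"
  unfolding pos_def jump_def by (intro arg_cong2[where f=times] refl prod.cong) auto

lemma jump_time_Suc:
  "jump_time R x u (Suc n) = (if jump_time R x u n = \<top> then \<top> else jump_time R x u n +
    surv_inv R (pos x u n (enn2real (jump_time R x u n))) (u (2 * n + 1)))"
  by (simp add: pos_def)

text \<open>The n-th jump time reads coordinates up to 2n - 1, its own waiting time included, but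
  not coordinate 2n, which is the factor of the n-th jump. Hence that factor can be integrated out
  while the time is held fixed.\<close>

lemma jump_time_cong:
  "(\<And>i. 1 \<le> i \<Longrightarrow> i < 2 * n \<Longrightarrow> u i = v i) \<Longrightarrow> jump_time R x u n = jump_time R x v n"
proof (induction n)
  case (Suc n)
  then have "jump_time R x u n = jump_time R x v n" "u (2 * n + 1) = v (2 * n + 1)"
    "pos x u n t = pos x v n t" for t
    by (auto intro!: pos_cong)
  then show ?case by (simp only: jump_time_Suc)
qed simp

lemma pos_measurable:
  assumes [measurable]: "X \<in> borel_measurable N" "T \<in> borel_measurable N"
    and u: "\<And>i. 1 \<le> i \<Longrightarrow> i \<le> 2 * n \<Longrightarrow> (\<lambda>w. u w i) \<in> borel_measurable N"
  shows "(\<lambda>w. pos (X w) (u w) n (T w)) \<in> borel_measurable N"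
proof -
  have "(\<lambda>w. \<Prod>j=1..n. sqrt (u w (2 * j))) \<in> borel_measurable N"
    by (intro borel_measurable_prod borel_measurable_sqrt measurable_compose[OF u]) auto
  then show ?thesis unfolding pos_def jump_def by measurable
qed

section \<open>Laws of the paths with a given number of jumps\<close>

context hazard
begin

lemma jump_time_measurable:
  assumes [measurable]: "X \<in> borel_measurable N"
  shows "(\<And>i. 1 \<le> i \<Longrightarrow> i < 2 * n \<Longrightarrow> (\<lambda>w. u w i) \<in> borel_measurable N) \<Longrightarrow>
    (\<lambda>w. jump_time R (X w) (u w) n) \<in> borel_measurable N"
proof (induction n)
  case 0
  then show ?case by simp
next
  case (Suc n)
  have [measurable]: "(\<lambda>w. jump_time R (X w) (u w) n) \<in> borel_measurable N"
    by (rule Suc.IH) (auto intro: Suc.prems)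
  have [measurable]: "(\<lambda>w. u w (2 * n + 1)) \<in> borel_measurable N"
    by (rule Suc.prems) auto
  have [measurable]: "(\<lambda>w. pos (X w) (u w) n (enn2real (jump_time R (X w) (u w) n))) \<in> borel_measurable N"
    by (rule pos_measurable) (auto intro: Suc.prems)
  show ?case unfolding jump_time_Suc by measurable
qed

definition killed :: "real \<Rightarrow> (real \<Rightarrow> ennreal) \<Rightarrow> real \<Rightarrow> ennreal" where
  "killed r f z = f (z * exp r) * ennreal (S z r)"

text \<open>The conditional probability, given the first 2n uniforms, that exactly n jumps happen up
  to time t.\<close>

definition weight :: "real \<Rightarrow> (nat \<Rightarrow> real) \<Rightarrow> nat \<Rightarrow> real \<Rightarrow> ennreal" where
  "weight x u n t = (if jump_time R x u n \<le> ennreal t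
     then ennreal (S (pos x u n (enn2real (jump_time R x u n))) (t - enn2real (jump_time R x u n))) else 0)"

text \<open>The expectation of f at the position at time t on the event of exactly n jumps up to t,
  with the waiting time in coordinate 2n + 1 already integrated out; see
  \<open>occ_alive\<close>.\<close>

definition occ :: "nat \<Rightarrow> real \<Rightarrow> real \<Rightarrow> (real \<Rightarrow> ennreal) \<Rightarrow> ennreal" where
  "occ n x t f = (\<integral>\<^sup>+u. f (pos x u n t) * weight x u n t \<partial>unifs (2 * n))"

lemma weight_measurable:
  assumes [measurable]: "X \<in> borel_measurable N" "T \<in> borel_measurable N"
    and u: "\<And>i. 1 \<le> i \<Longrightarrow> i \<le> 2 * n \<Longrightarrow> (\<lambda>w. u w i) \<in> borel_measurable N"
  shows "(\<lambda>w. weight (X w) (u w) n (T w)) \<in> borel_measurable N"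
proof -
  have [measurable]: "(\<lambda>w. jump_time R (X w) (u w) n) \<in> borel_measurable N"
    by (rule jump_time_measurable) (auto intro: u)
  have [measurable]: "(\<lambda>w. pos (X w) (u w) n (enn2real (jump_time R (X w) (u w) n))) \<in> borel_measurable N"
    by (rule pos_measurable) (auto intro: u)
  show ?thesis unfolding weight_def by measurable
qed

lemma occ_0: "0 \<le> t \<Longrightarrow> occ 0 x t f = killed t f x"
  unfolding occ_def mult_0_right nn_integral_unifs_0 by (simp add: weight_def killed_def pos_0)

text \<open>Jump n + 1 happens at rate \<open>k\<close> along the paths with exactly n jumps so far;
  the arguments of h are its time and the position just before it. Given the first 2n uniforms,
  coordinate 2n + 1 yields a waiting time with density k S, and counted from time 0 the survival
  factor becomes \<open>weight\<close>.\<close>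

lemma next_jump:
  assumes "0 \<le> t" and h [measurable]: "(\<lambda>(s, y). h s y) \<in> borel_measurable (borel \<Otimes>\<^sub>M borel)"
  shows "(\<integral>\<^sup>+u. (if jump_time R x u (Suc n) \<le> ennreal t
      then h (enn2real (jump_time R x u (Suc n))) (pos x u n (enn2real (jump_time R x u (Suc n)))) else 0)
      \<partial>unifs (Suc (2 * n)))
    = (\<integral>\<^sup>+s\<in>{0..t}. occ n x s (\<lambda>y. ennreal (k y) * h s y) \<partial>lborel)" (is "?l = ?r")
proof -
  interpret unifs: prob_space "unifs (2 * n)" by (rule prob_space_unifs)
  interpret pair: pair_sigma_finite "unifs (2 * n)" "lborel :: real measure" ..
  define g where "g u = (if jump_time R x u (Suc n) \<le> ennreal t
      then h (enn2real (jump_time R x u (Suc n))) (pos x u n (enn2real (jump_time R x u (Suc n)))) else 0)" for u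
  have [measurable]: "(\<lambda>u. jump_time R x u (Suc n)) \<in> borel_measurable (unifs (Suc (2 * n)))"
    by (rule jump_time_measurable) auto
  have [measurable]: "(\<lambda>u. pos x u n (enn2real (jump_time R x u (Suc n)))) \<in> borel_measurable (unifs (Suc (2 * n)))"
    by (rule pos_measurable; (simp; fail)?; measurable)
  have g_meas: "g \<in> borel_measurable (unifs (Suc (2 * n)))"
    unfolding g_def by measurable
  have inner: "(\<integral>\<^sup>+v. g (u(Suc (2 * n) := v)) \<partial>unif)
    = (\<integral>\<^sup>+s\<in>{0..t}. ennreal (k (pos x u n s)) * h s (pos x u n s) * weight x u n s \<partial>lborel)" for u
  proof -
    define \<tau> where "\<tau> = jump_time R x u n"
    define z where "z = pos x u n (enn2real \<tau>)"
    have pos_eq: "pos x (u(Suc (2 * n) := v)) n s = pos x u n s" for v s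
      by (rule pos_cong) auto
    have jt_eq: "jump_time R x (u(Suc (2 * n) := v)) n = \<tau>" for v
      unfolding \<tau>_def by (rule jump_time_cong) auto
    have jt_Suc: "jump_time R x (u(Suc (2 * n) := v)) (Suc n) = (if \<tau> = \<top> then \<top> else \<tau> + surv_inv R z v)" for v
      unfolding jump_time_Suc jt_eq pos_eq z_def by simp
    have g_eq: "g (u(Suc (2 * n) := v)) = (if (if \<tau> = \<top> then \<top> else \<tau> + surv_inv R z v) \<le> ennreal t
        then h (enn2real (\<tau> + surv_inv R z v)) (pos x u n (enn2real (\<tau> + surv_inv R z v))) else 0)" for v
      unfolding g_def jt_Suc pos_eq by simp
    have w: "weight x u n s = (if \<tau> \<le> ennreal s then ennreal (S z (s - enn2real \<tau>)) else 0)" for s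
      by (simp add: weight_def \<tau>_def z_def)
    show ?thesis
    proof (cases "\<tau> \<le> ennreal t")
      \<comment> \<open>If jump n comes after t, so does jump n + 1, and no s in [0, t] carries
        weight.\<close>
      case False
      have nw: "weight x u n s = 0" if "s \<in> {0..t}" for s
      proof -
        have "ennreal s \<le> ennreal t" using that by (auto intro: ennreal_leI)
        then have "\<not> \<tau> \<le> ennreal s" using False by (meson order_trans)
        then show ?thesis by (simp add: w)
      qed
      have "\<not> \<tau> + surv_inv R z v \<le> ennreal t" for v
        using False by (meson le_add_same_cancel1 order_trans zero_le add_increasing2 le_iff_add)
      then have "g (u(Suc (2 * n) := v)) = 0" for v by (simp add: g_eq top_unique)
      moreover have "(\<integral>\<^sup>+s\<in>{0..t}. ennreal (k (pos x u n s)) * h s (pos x u n s) * weight x u n s \<partial>lborel)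
         = (\<integral>\<^sup>+(s::real). 0 \<partial>lborel)"
        by (rule nn_integral_cong) (auto simp: nw indicator_def)
      ultimately show ?thesis by simp
    next
      case True
      then obtain a where a: "0 \<le> a" "\<tau> = ennreal a"
        by (cases \<tau>) (auto simp: top_unique)
      have at: "a \<le> t" using True a assms(1) by simp
      have le: "\<tau> + y \<le> ennreal t \<longleftrightarrow> y \<le> ennreal (t - a)" for y
        using a at by (cases y) (auto simp: top_unique simp flip: ennreal_plus)
      have [simp]: "\<tau> \<noteq> \<top>" "enn2real \<tau> = a" using a by auto
      have pa: "pos x u n (a + r) = z * exp r" for r
        using pos_add[of x u n a r] by (simp add: z_def)
      define h' where "h' r = h (a + r) (z * exp r)" for r
      have [measurable]: "h' \<in> borel_measurable borel" unfolding h'_def by measurable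
      have "(\<integral>\<^sup>+v. g (u(Suc (2 * n) := v)) \<partial>unif) =
        (\<integral>\<^sup>+v. (if surv_inv R z v \<le> ennreal (t - a) then h' (enn2real (surv_inv R z v)) else 0) \<partial>unif)"
      proof (rule nn_integral_cong)
        fix v
        show "g (u(Suc (2 * n) := v)) = (if surv_inv R z v \<le> ennreal (t - a) then h' (enn2real (surv_inv R z v)) else 0)"
        proof (cases "surv_inv R z v \<le> ennreal (t - a)")
          case True
          then have "enn2real (\<tau> + surv_inv R z v) = a + enn2real (surv_inv R z v)"
            using a by (cases "surv_inv R z v") (auto simp: top_unique simp flip: ennreal_plus)
          then show ?thesis using True by (simp add: g_eq le h'_def pa)
        qed (simp add: g_eq le)
      qed
      also have "\<dots> = (\<integral>\<^sup>+r\<in>{0..t - a}. ennreal (k (z * exp r) * S z r) * h' r \<partial>lborel)"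
        using at by (subst nn_integral_unif, measurable) (simp add: nn_integral_surv_inv)
      \<comment> \<open>The waiting time r is replaced by the time s = a + r of the jump, where a is
        the n-th jump time. For s < a the indicator vanishes here and \<open>weight\<close> vanishes
        in the next expression.\<close>
      also have "\<dots> = (\<integral>\<^sup>+s. ennreal (k (z * exp (s - a)) * S z (s - a)) * h' (s - a) * indicator {0..t - a} (s - a) \<partial>lborel)"
        by (subst nn_integral_real_affine[where c=1 and t="-a"]) auto
      also have "\<dots> = (\<integral>\<^sup>+s\<in>{0..t}. ennreal (k (pos x u n s)) * h s (pos x u n s) * weight x u n s \<partial>lborel)"
      proof (rule nn_integral_cong)
        fix s
        have "pos x u n s = z * exp (s - a)" using pa[of "s - a"] by simp
        then show "ennreal (k (z * exp (s - a)) * S z (s - a)) * h' (s - a) * indicator {0..t - a} (s - a)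
          = ennreal (k (pos x u n s)) * h s (pos x u n s) * weight x u n s * indicator {0..t} s"
          using a(1) by (auto simp: w h'_def indicator_def a(2) ennreal_mult k_nonneg S_pos less_imp_le mult_ac)
      qed
      finally show ?thesis .
    qed
  qed
  have [measurable]: "(\<lambda>(u, s). pos x u n s) \<in> borel_measurable (unifs (2 * n) \<Otimes>\<^sub>M borel)"
    "(\<lambda>(u, s). weight x u n s) \<in> borel_measurable (unifs (2 * n) \<Otimes>\<^sub>M borel)"
    unfolding split_beta by (rule pos_measurable weight_measurable; (simp; fail)?; measurable)+
  have "?l = (\<integral>\<^sup>+u. g u \<partial>unifs (Suc (2 * n)))" by (simp add: g_def)
  also have "\<dots> = (\<integral>\<^sup>+u. \<integral>\<^sup>+s. ennreal (k (pos x u n s)) * h s (pos x u n s) * weight x u n s * indicator {0..t} s \<partial>lborel \<partial>unifs (2 * n))"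
    unfolding nn_integral_unifs_Suc[OF g_meas] inner ..
  also have "\<dots> = (\<integral>\<^sup>+s. \<integral>\<^sup>+u. ennreal (k (pos x u n s)) * h s (pos x u n s) * weight x u n s * indicator {0..t} s \<partial>unifs (2 * n) \<partial>lborel)"
    by (rule pair.Fubini'[symmetric]) measurable
  also have "\<dots> = ?r"
    unfolding occ_def by (intro nn_integral_cong) (auto simp: indicator_def)
  finally show ?thesis .
qed

lemma killed_measurable:
  assumes [measurable]: "f \<in> borel_measurable borel"
  shows "(\<lambda>(r, z). killed r f z) \<in> borel_measurable (borel \<Otimes>\<^sub>M borel)"
  unfolding killed_def by measurable

lemma mean_frag_measurable:
  assumes [measurable]: "(\<lambda>(s, z). f s z) \<in> borel_measurable (borel \<Otimes>\<^sub>M borel)"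
  shows "(\<lambda>(s, z). mean_frag (f s) z) \<in> borel_measurable (borel \<Otimes>\<^sub>M borel)"
proof -
  interpret prob_space unif by (rule prob_space_unif)
  show ?thesis unfolding mean_frag_def split_beta by measurable
qed

text \<open>Decomposition at the last jump: it happens at time s, rescales the position by its
  random factor, and the path then survives from s to t.\<close>

lemma occ_Suc:
  assumes "0 \<le> t" and [measurable]: "f \<in> borel_measurable borel"
  shows "occ (Suc n) x t f
    = (\<integral>\<^sup>+s\<in>{0..t}. occ n x s (\<lambda>y. ennreal (k y) * mean_frag (killed (t - s) f) y) \<partial>lborel)"
proof -
  have [measurable]: "(\<lambda>u. f (pos x u (Suc n) t) * weight x u (Suc n) t) \<in> borel_measurable (unifs (Suc (Suc (2 * n))))"
    by (intro borel_measurable_times_ennreal measurable_compose[OF _ assms(2)] pos_measurable weight_measurable) auto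
  note killed_measurable[measurable]
  have "(\<lambda>(s, z). mean_frag (killed (t - s) f) z) \<in> borel_measurable (borel \<Otimes>\<^sub>M borel)"
    by (rule mean_frag_measurable) measurable
  have "occ (Suc n) x t f = (\<integral>\<^sup>+u. f (pos x u (Suc n) t) * weight x u (Suc n) t \<partial>unifs (Suc (Suc (2 * n))))"
    by (simp add: occ_def)
  also have "\<dots> = (\<integral>\<^sup>+u. (if jump_time R x u (Suc n) \<le> ennreal t
      then mean_frag (killed (t - enn2real (jump_time R x u (Suc n))) f)
        (pos x u n (enn2real (jump_time R x u (Suc n)))) else 0) \<partial>unifs (Suc (2 * n)))"
  \<comment> \<open>The innermost coordinate 2n + 2 is the factor of the last jump: it leaves the
    jump time unchanged and only rescales the position.\<close>
  proof (subst nn_integral_unifs_Suc, measurable, rule nn_integral_cong)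
    fix u
    let ?\<tau> = "jump_time R x u (Suc n)"
    have jt: "jump_time R x (u(Suc (Suc (2 * n)) := v)) (Suc n) = ?\<tau>" for v
      unfolding jump_time_Suc
      using jump_time_cong[of n u "u(Suc (Suc (2 * n)) := v)" R x] pos_cong[of n u "u(Suc (Suc (2 * n)) := v)" x]
      by simp
    have ps: "pos x (u(Suc (Suc (2 * n)) := v)) (Suc n) s = pos x u n s * sqrt v" for v s
      using pos_cong[of n u "u(Suc (Suc (2 * n)) := v)" x s] by (simp add: pos_Suc)
    have "pos x u n t = pos x u n (enn2real ?\<tau>) * exp (t - enn2real ?\<tau>)"
      by (simp flip: pos_add)
    then show "(\<integral>\<^sup>+v. f (pos x (u(Suc (Suc (2 * n)) := v)) (Suc n) t) * weight x (u(Suc (Suc (2 * n)) := v)) (Suc n) t \<partial>unif)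
      = (if ?\<tau> \<le> ennreal t then mean_frag (killed (t - enn2real ?\<tau>) f) (pos x u n (enn2real ?\<tau>)) else 0)"
      unfolding weight_def jt ps mean_frag_def killed_def by (simp add: mult_ac)
  qed
  also have "\<dots> = (\<integral>\<^sup>+s\<in>{0..t}. occ n x s (\<lambda>y. ennreal (k y) * mean_frag (killed (t - s) f) y) \<partial>lborel)"
    by (rule next_jump) fact+
  finally show ?thesis .
qed

text \<open>Given the first 2n uniforms with jump n at time a \<le> t, the next jump comes after t
  exactly when coordinate 2n + 1 lies below the survival probability from a to t.\<close>

lemma occ_alive:
  assumes "0 \<le> t" and [measurable]: "f \<in> borel_measurable borel"
  shows "(\<integral>\<^sup>+u. (if jump_time R x u n \<le> ennreal t \<and> ennreal t < jump_time R x u (Suc n)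
      then f (pos x u n t) else 0) \<partial>unifs (Suc (2 * n))) = occ n x t f"
proof -
  define g where "g u = (if jump_time R x u n \<le> ennreal t \<and> ennreal t < jump_time R x u (Suc n)
      then f (pos x u n t) else 0)" for u
  have jt [measurable]: "(\<lambda>u. jump_time R x u n) \<in> borel_measurable (unifs (Suc (2 * n)))"
    by (rule jump_time_measurable) auto
  have [measurable]: "(\<lambda>u. jump_time R x u (Suc n)) \<in> borel_measurable (unifs (Suc (2 * n)))"
    by (rule jump_time_measurable) auto
  have [measurable]: "(\<lambda>u. pos x u n t) \<in> borel_measurable (unifs (Suc (2 * n)))"
    by (rule pos_measurable) auto
  have g_meas: "g \<in> borel_measurable (unifs (Suc (2 * n)))"
    unfolding g_def by measurable
  have "(\<integral>\<^sup>+v. g (u(Suc (2 * n) := v)) \<partial>unif) = f (pos x u n t) * weight x u n t" for u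
  proof -
    define \<tau> where "\<tau> = jump_time R x u n"
    define z where "z = pos x u n (enn2real \<tau>)"
    have pos_eq: "pos x (u(Suc (2 * n) := v)) n s = pos x u n s" for v s
      by (rule pos_cong) auto
    have jt_eq: "jump_time R x (u(Suc (2 * n) := v)) n = \<tau>" for v
      unfolding \<tau>_def by (rule jump_time_cong) auto
    have jt_Suc: "jump_time R x (u(Suc (2 * n) := v)) (Suc n) = (if \<tau> = \<top> then \<top> else \<tau> + surv_inv R z v)" for v
      unfolding jump_time_Suc jt_eq pos_eq z_def by simp
    show ?thesis
    proof (cases "\<tau> \<le> ennreal t")
      case False
      then show ?thesis by (simp add: g_def jt_eq weight_def \<tau>_def[symmetric] del: jump_time.simps)
    next
      case True
      then obtain a where a: "0 \<le> a" "\<tau> = ennreal a"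
        by (cases \<tau>) (auto simp: top_unique)
      have at: "a \<le> t" using True a assms(1) by simp
      have "\<tau> + y \<le> ennreal t \<longleftrightarrow> y \<le> ennreal (t - a)" for y
        using a at by (cases y) (auto simp: top_unique simp flip: ennreal_plus)
      then have lt: "ennreal t < \<tau> + y \<longleftrightarrow> \<not> y \<le> ennreal (t - a)" for y
        by (simp flip: not_le)
      have [simp]: "\<tau> \<noteq> \<top>" "enn2real \<tau> = a" using a by auto
      have g_eq: "g (u(Suc (2 * n) := v)) = f (pos x u n t) * indicator {..<S z (t - a)} v" for v
        unfolding g_def jt_Suc jt_eq pos_eq using True at
        by (simp add: lt surv_inv_le_iff indicator_def)
      have "(\<integral>\<^sup>+v. g (u(Suc (2 * n) := v)) \<partial>unif) = f (pos x u n t) * (\<integral>\<^sup>+v. indicator {..<S z (t - a)} v \<partial>unif)"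
        unfolding g_eq by (intro nn_integral_cmult borel_measurable_indicator) simp
      also have "(\<integral>\<^sup>+v. indicator {..<S z (t - a)} v \<partial>unif) = (\<integral>\<^sup>+v. indicator {0<..<S z (t - a)} v \<partial>lborel)"
      proof (subst nn_integral_unif, measurable, rule nn_integral_cong)
        fix v
        show "indicator {..<S z (t - a)} v * indicator {0<..<1} v = (indicator {0<..<S z (t - a)} v :: ennreal)"
          using S_le_1[of "t - a" z] at by (simp add: indicator_def)
      qed
      also have "\<dots> = weight x u n t"
        using True S_pos[of z "t - a"] by (simp add: weight_def \<tau>_def[symmetric] z_def del: jump_time.simps)
      finally show ?thesis .
    qed
  qed
  then show ?thesis
    using nn_integral_unifs_Suc[OF g_meas] by (simp add: g_def occ_def)
qed

end

section \<open>The mild equation\<close>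

lemma mean_frag_cong:
  assumes "0 < x" "\<And>y. 0 < y \<Longrightarrow> f y = g y"
    and [measurable]: "f \<in> borel_measurable borel" "g \<in> borel_measurable borel"
  shows "mean_frag f x = mean_frag g x"
  unfolding mean_frag_def using assms(1,2)
  by (subst (1 2) nn_integral_unif; (measurable; fail)?) (auto intro!: nn_integral_cong simp: indicator_def)

lemma mean_frag_add:
  assumes [measurable]: "f \<in> borel_measurable borel" "g \<in> borel_measurable borel"
  shows "mean_frag (\<lambda>y. f y + g y) x = mean_frag f x + mean_frag g x"
  unfolding mean_frag_def by (rule nn_integral_add) auto

context hazard
begin

text \<open>Duhamel's formula at a point. The flow from x ends at x e^(t-s) wherever along it the
  killing is recorded, so the value of f factors out and \<open>S_backward\<close> remains.\<close>

lemma killed_add_integral: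
  assumes "0 < x" "s \<le> t"
  shows "killed (t - s) f x
     + (\<integral>\<^sup>+r\<in>{s..t}. ennreal (k (x * exp (r - s))) * killed (t - r) f (x * exp (r - s)) \<partial>lborel)
     = f (x * exp (t - s))"
proof -
  have "(\<integral>\<^sup>+r\<in>{s..t}. ennreal (k (x * exp (r - s))) * killed (t - r) f (x * exp (r - s)) \<partial>lborel)
    = (\<integral>\<^sup>+r\<in>{s..t}. f (x * exp (t - s)) * ennreal (k (x * exp (r - s)) * S (x * exp (r - s)) (t - r)) \<partial>lborel)"
    by (intro nn_integral_cong)
       (simp add: killed_def mult.assoc ennreal_mult' k_nonneg mult.left_commute flip: exp_add)
  also have "\<dots> = (\<integral>\<^sup>+r. f (x * exp (t - s)) * (ennreal (k (x * exp (r - s)) * S (x * exp (r - s)) (t - r)) * indicator {s..t} r) \<partial>lborel)"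
    by (simp add: mult.assoc)
  also have "\<dots> = f (x * exp (t - s)) *
      (\<integral>\<^sup>+r. ennreal (k (x * exp (r - s)) * S (x * exp (r - s)) (t - r)) * indicator {s..t} r \<partial>lborel)"
    by (rule nn_integral_cmult) measurable
  also have "(\<integral>\<^sup>+r. ennreal (k (x * exp (r - s)) * S (x * exp (r - s)) (t - r)) * indicator {s..t} r \<partial>lborel)
    = (\<integral>\<^sup>+r\<in>{0..t - s}. ennreal (k (x * exp r) * S (x * exp r) (t - s - r)) \<partial>lborel)"
    by (subst nn_integral_real_affine[where c=1 and t=s])
       (auto intro!: nn_integral_cong simp: indicator_def algebra_simps)
  finally have "killed (t - s) f x
     + (\<integral>\<^sup>+r\<in>{s..t}. ennreal (k (x * exp (r - s))) * killed (t - r) f (x * exp (r - s)) \<partial>lborel)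
     = f (x * exp (t - s)) * (ennreal (S x (t - s)) +
        (\<integral>\<^sup>+r\<in>{0..t - s}. ennreal (k (x * exp r) * S (x * exp r) (t - s - r)) \<partial>lborel))"
    by (simp add: killed_def distrib_left)
  also have "\<dots> = f (x * exp (t - s))"
    using assms by (subst S_backward) auto
  finally show ?thesis .
qed

lemma occ_measurable:
  assumes [measurable]: "(\<lambda>(s, y). h s y) \<in> borel_measurable (borel \<Otimes>\<^sub>M borel)"
  shows "(\<lambda>(x, s). occ n x s (h s)) \<in> borel_measurable (borel \<Otimes>\<^sub>M borel)"
proof -
  interpret prob_space "unifs (2 * n)" by (rule prob_space_unifs)
  have [measurable]: "(\<lambda>w. pos (fst (fst w)) (snd w) n (snd (fst w)))
      \<in> borel_measurable ((borel \<Otimes>\<^sub>M borel) \<Otimes>\<^sub>M unifs (2 * n))"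
    "(\<lambda>w. weight (fst (fst w)) (snd w) n (snd (fst w)))
      \<in> borel_measurable ((borel \<Otimes>\<^sub>M borel) \<Otimes>\<^sub>M unifs (2 * n))"
    by (rule pos_measurable weight_measurable; (simp; fail)?; measurable)+
  show ?thesis unfolding occ_def split_beta by measurable
qed

end

text \<open>Times range over the whole line, which keeps measurability statements free of restricted
  spaces; in the final proof the family is continued to s < 0 by its initial law.\<close>

locale rate_kernel = hazard +
  fixes m :: "real \<Rightarrow> real measure" and C :: ennreal
  assumes kernel: "m \<in> borel \<rightarrow>\<^sub>M prob_algebra borel"
    and m_pos: "\<And>s. AE x in m s. 0 < x"
    and rate_bound: "\<And>s. (\<integral>\<^sup>+x. ennreal (k x) \<partial>m s) \<le> C"
    and C_finite: "C < \<top>"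
begin

lemma kernel_subprob: "m \<in> borel \<rightarrow>\<^sub>M subprob_algebra borel"
  using kernel by (rule measurable_prob_algebraD)

lemma m_prob: "prob_space (m s)"
  using measurable_space[OF kernel, of s] by (simp add: space_prob_algebra)

lemma m_sets [measurable_cong, simp]: "sets (m s) = sets borel"
  using measurable_space[OF kernel, of s] by (simp add: space_prob_algebra)

lemma m_space [simp]: "space (m s) = UNIV"
  using sets_eq_imp_space_eq[OF m_sets[of s]] by simp

lemma m_integral_measurable:
  assumes "(\<lambda>(w, x). h w x) \<in> borel_measurable (N \<Otimes>\<^sub>M borel)" "T \<in> borel_measurable N"
  shows "(\<lambda>w. \<integral>\<^sup>+x. h w x \<partial>m (T w)) \<in> borel_measurable N"
  by (rule nn_integral_measurable_subprob_algebra2[OF assms(1)])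
     (rule measurable_compose[OF assms(2) kernel_subprob])

end

text \<open>The equation tested with functions carried along the flow. Losses and gains stand on
  opposite sides, so that it makes sense for every f with values in [0,\<infinity>], even where
  terms are infinite.\<close>

locale transport = rate_kernel +
  assumes transport: "\<And>t f. 0 \<le> t \<Longrightarrow> f \<in> borel_measurable borel \<Longrightarrow>
      (\<integral>\<^sup>+x. f x \<partial>m t) + (\<integral>\<^sup>+s\<in>{0..t}. \<integral>\<^sup>+x. ennreal (k x) * f (x * exp (t - s)) \<partial>m s \<partial>lborel)
      = (\<integral>\<^sup>+x. f (x * exp t) \<partial>m 0)
        + (\<integral>\<^sup>+s\<in>{0..t}. \<integral>\<^sup>+x. ennreal (k x) * mean_frag (\<lambda>y. f (y * exp (t - s))) x \<partial>m s \<partial>lborel)"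
begin

text \<open>Tonelli on the triangle 0 \<le> s \<le> r \<le> t. The measure \<open>m s\<close>
  depends on s alone, so the integral over r can move inside it.\<close>

lemma triangle_swap:
  fixes t :: real and h :: "real \<Rightarrow> real \<Rightarrow> real \<Rightarrow> ennreal"
  assumes h: "(\<lambda>(r, s, x). h r s x) \<in> borel_measurable (borel \<Otimes>\<^sub>M borel \<Otimes>\<^sub>M borel)"
  shows "(\<integral>\<^sup>+r\<in>{0..t}. \<integral>\<^sup>+s\<in>{0..r}. \<integral>\<^sup>+x. h r s x \<partial>m s \<partial>lborel \<partial>lborel)
    = (\<integral>\<^sup>+s\<in>{0..t}. \<integral>\<^sup>+x. (\<integral>\<^sup>+r\<in>{s..t}. h r s x \<partial>lborel) \<partial>m s \<partial>lborel)"
proof -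
  interpret prob_space "m s" for s by (rule m_prob)
  interpret pair: pair_sigma_finite "m s" "lborel :: real measure" for s ..
  define g where "g r s x = h r s x * indicator {0..t} r * (if 0 \<le> s \<and> s \<le> r then 1 else 0)" for r s x
  have [measurable (raw)]: "(\<lambda>w. h (a w) (b w) (c w)) \<in> borel_measurable N"
    if "a \<in> borel_measurable N" "b \<in> borel_measurable N" "c \<in> borel_measurable N" for a b c and N :: "'z measure"
    using measurable_compose[OF measurable_Pair[OF that(1) measurable_Pair[OF that(2,3)]] h] by simp
  have [measurable (raw)]: "(\<lambda>w. g (a w) (b w) (c w)) \<in> borel_measurable N"
    if [measurable]: "a \<in> borel_measurable N" "b \<in> borel_measurable N" "c \<in> borel_measurable N" for a b c and N :: "'z measure"
    unfolding g_def by measurable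
  have gi: "(\<lambda>w. \<integral>\<^sup>+x. g (fst w) (snd w) x \<partial>m (snd w)) \<in> borel_measurable (borel \<Otimes>\<^sub>M borel)"
    by (rule m_integral_measurable) measurable
  have "(\<integral>\<^sup>+r\<in>{0..t}. \<integral>\<^sup>+s\<in>{0..r}. \<integral>\<^sup>+x. h r s x \<partial>m s \<partial>lborel \<partial>lborel)
    = (\<integral>\<^sup>+r. \<integral>\<^sup>+s. \<integral>\<^sup>+x. g r s x \<partial>m s \<partial>lborel \<partial>lborel)"
    by (auto simp: g_def indicator_def intro!: nn_integral_cong)
  also have "\<dots> = (\<integral>\<^sup>+s. \<integral>\<^sup>+r. \<integral>\<^sup>+x. g r s x \<partial>m s \<partial>lborel \<partial>lborel)"
    using gi by (intro lborel_pair.Fubini'[symmetric]) (simp add: split_beta')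
  also have "\<dots> = (\<integral>\<^sup>+s. \<integral>\<^sup>+x. \<integral>\<^sup>+r. g r s x \<partial>lborel \<partial>m s \<partial>lborel)"
  proof (rule nn_integral_cong)
    fix s
    show "(\<integral>\<^sup>+r. \<integral>\<^sup>+x. g r s x \<partial>m s \<partial>lborel) = (\<integral>\<^sup>+x. \<integral>\<^sup>+r. g r s x \<partial>lborel \<partial>m s)"
      by (rule pair.Fubini') measurable
  qed
  also have "\<dots> = (\<integral>\<^sup>+s\<in>{0..t}. \<integral>\<^sup>+x. (\<integral>\<^sup>+r\<in>{s..t}. h r s x \<partial>lborel) \<partial>m s \<partial>lborel)"
  proof (rule nn_integral_cong)
    fix s
    show "(\<integral>\<^sup>+x. \<integral>\<^sup>+r. g r s x \<partial>lborel \<partial>m s) = (\<integral>\<^sup>+x. (\<integral>\<^sup>+r\<in>{s..t}. h r s x \<partial>lborel) \<partial>m s) * indicator {0..t} s"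
    proof (cases "0 \<le> s \<and> s \<le> t")
      case True
      then have "g r s x = h r s x * indicator {s..t} r" for r x
        by (auto simp: g_def indicator_def)
      then show ?thesis using True by simp
    next
      case False
      then have "g r s x = 0" for r x
        by (auto simp: g_def indicator_def)
      then show ?thesis using False by simp
    qed
  qed
  finally show ?thesis .
qed

text \<open>For bounded f the killing term is finite, which permits cancelling it in
  \<open>mild_bounded\<close>.\<close>

lemma k_integral_finite:
  assumes "\<And>x. f x \<le> B" "B < \<top>" and [measurable]: "f \<in> borel_measurable borel"
  shows "(\<integral>\<^sup>+s\<in>{0..t}. \<integral>\<^sup>+x. ennreal (k x) * f (x * exp (t - s)) \<partial>m s \<partial>lborel) < \<top>"
proof -
  have "(\<integral>\<^sup>+s\<in>{0..t}. \<integral>\<^sup>+x. ennreal (k x) * f (x * exp (t - s)) \<partial>m s \<partial>lborel)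
    \<le> (\<integral>\<^sup>+s\<in>{0..t}. C * B \<partial>lborel)"
  proof (intro nn_integral_mono mult_right_mono)
    fix s
    have "(\<integral>\<^sup>+x. ennreal (k x) * f (x * exp (t - s)) \<partial>m s) \<le> (\<integral>\<^sup>+x. ennreal (k x) * B \<partial>m s)"
      by (intro nn_integral_mono mult_left_mono assms) auto
    also have "\<dots> = (\<integral>\<^sup>+x. ennreal (k x) \<partial>m s) * B"
      by (rule nn_integral_multc) simp
    also have "\<dots> \<le> C * B" by (intro mult_right_mono rate_bound) auto
    finally show "(\<integral>\<^sup>+x. ennreal (k x) * f (x * exp (t - s)) \<partial>m s) \<le> C * B" .
  qed auto
  also have "\<dots> = C * B * emeasure lborel {0..t}" by (subst nn_integral_cmult) auto
  also have "\<dots> < \<top>" using C_finite assms(2)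
    by (cases "0 \<le> t") (auto simp: ennreal_mult_less_top)
  finally show ?thesis .
qed

text \<open>Duhamel's formula for the flow without killing, integrated against the equation, turns into the one
  for the killed flow.\<close>

lemma mild_bounded:
  assumes t: "0 \<le> t" and B: "\<And>x. f x \<le> B" "B < \<top>" and f [measurable]: "f \<in> borel_measurable borel"
  shows "(\<integral>\<^sup>+x. f x \<partial>m t) = (\<integral>\<^sup>+x. killed t f x \<partial>m 0)
    + (\<integral>\<^sup>+s\<in>{0..t}. \<integral>\<^sup>+x. ennreal (k x) * mean_frag (killed (t - s) f) x \<partial>m s \<partial>lborel)"
proof -
  interpret unif: prob_space unif by (rule prob_space_unif)
  interpret unif_pair: pair_sigma_finite unif "lborel :: real measure" ..
  note killed_measurable[OF f, measurable]
  \<comment> \<open>\<open>P\<close> is the gap between the free flow and the killed flow from time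
    s to time t, by \<open>VP\<close>.\<close>
  define P where "P s x = (\<integral>\<^sup>+r\<in>{s..t}. ennreal (k (x * exp (r - s))) * killed (t - r) f (x * exp (r - s)) \<partial>lborel)" for s x
  have P_meas [measurable]: "(\<lambda>(s, x). P s x) \<in> borel_measurable (borel \<Otimes>\<^sub>M borel)"
  proof -
    have ind: "indicator {s..t} r = (if s \<le> r \<and> r \<le> t then 1 else 0 :: ennreal)" for s r :: real
      by (auto simp: indicator_def)
    show ?thesis unfolding P_def split_beta ind by measurable
  qed
  have VP: "killed (t - s) f x + P s x = f (x * exp (t - s))" if "0 < x" "s \<in> {0..t}" for s x
    using killed_add_integral[of x s t f] that by (simp add: P_def)
  have mf [measurable]: "(\<lambda>(s, x). mean_frag (killed (t - s) f) x) \<in> borel_measurable (borel \<Otimes>\<^sub>M borel)"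
    "(\<lambda>(s, x). mean_frag (P s) x) \<in> borel_measurable (borel \<Otimes>\<^sub>M borel)"
    by (rule mean_frag_measurable; measurable)+
  have [measurable]: "killed r f \<in> borel_measurable borel" "P s \<in> borel_measurable borel" for r s
    by measurable
  \<comment> \<open>\<open>\<kappa>\<close> is the loss term of the transport identity. Splitting f
    along the free flow into killed part and gap splits the loss into \<open>I1\<close> and
    \<open>I2\<close>, the initial term into its killed part and \<open>I3\<close>, and the gain
    into \<open>N\<close> and \<open>I4\<close>.\<close>
  define \<kappa> where "\<kappa> = (\<integral>\<^sup>+s\<in>{0..t}. \<integral>\<^sup>+x. ennreal (k x) * f (x * exp (t - s)) \<partial>m s \<partial>lborel)"
  define I1 where "I1 = (\<integral>\<^sup>+r\<in>{0..t}. \<integral>\<^sup>+x. ennreal (k x) * killed (t - r) f x \<partial>m r \<partial>lborel)"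
  define I2 where "I2 = (\<integral>\<^sup>+s\<in>{0..t}. \<integral>\<^sup>+x. ennreal (k x) * P s x \<partial>m s \<partial>lborel)"
  define I3 where "I3 = (\<integral>\<^sup>+x. P 0 x \<partial>m 0)"
  define I4 where "I4 = (\<integral>\<^sup>+s\<in>{0..t}. \<integral>\<^sup>+x. ennreal (k x) * mean_frag (P s) x \<partial>m s \<partial>lborel)"
  define N where "N = (\<integral>\<^sup>+s\<in>{0..t}. \<integral>\<^sup>+x. ennreal (k x) * mean_frag (killed (t - s) f) x \<partial>m s \<partial>lborel)"
  have kappa: "I1 + I2 = \<kappa>"
  proof -
    have "I1 + I2 = (\<integral>\<^sup>+s. (\<integral>\<^sup>+x. ennreal (k x) * killed (t - s) f x \<partial>m s) * indicator {0..t} s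
        + (\<integral>\<^sup>+x. ennreal (k x) * P s x \<partial>m s) * indicator {0..t} s \<partial>lborel)"
      unfolding I1_def I2_def
      by (rule nn_integral_add[symmetric]; intro borel_measurable_times_ennreal; (simp; fail)?;
          subst measurable_lborel2; rule m_integral_measurable; measurable)
    also have "\<dots> = \<kappa>"
      unfolding \<kappa>_def
    proof (rule nn_integral_cong)
      fix s
      show "(\<integral>\<^sup>+x. ennreal (k x) * killed (t - s) f x \<partial>m s) * indicator {0..t} s
        + (\<integral>\<^sup>+x. ennreal (k x) * P s x \<partial>m s) * indicator {0..t} s
        = (\<integral>\<^sup>+x. ennreal (k x) * f (x * exp (t - s)) \<partial>m s) * indicator {0..t} s"
      proof (cases "s \<in> {0..t}")
        case True
        have "(\<integral>\<^sup>+x. ennreal (k x) * killed (t - s) f x \<partial>m s) + (\<integral>\<^sup>+x. ennreal (k x) * P s x \<partial>m s)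
          = (\<integral>\<^sup>+x. ennreal (k x) * killed (t - s) f x + ennreal (k x) * P s x \<partial>m s)"
          by (rule nn_integral_add[symmetric]) measurable
        also have "\<dots> = (\<integral>\<^sup>+x. ennreal (k x) * f (x * exp (t - s)) \<partial>m s)"
          using m_pos[of s] True
          by (intro nn_integral_cong_AE) (auto elim!: eventually_mono simp: VP simp flip: distrib_left)
        finally show ?thesis using True by simp
      qed simp
    qed
    finally show ?thesis .
  qed
  have init: "(\<integral>\<^sup>+x. killed t f x \<partial>m 0) + I3 = (\<integral>\<^sup>+x. f (x * exp t) \<partial>m 0)"
  proof -
    have "(\<integral>\<^sup>+x. killed t f x \<partial>m 0) + I3 = (\<integral>\<^sup>+x. killed t f x + P 0 x \<partial>m 0)"
      unfolding I3_def by (rule nn_integral_add[symmetric]) measurable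
    also have "\<dots> = (\<integral>\<^sup>+x. f (x * exp t) \<partial>m 0)"
      using m_pos[of 0] t VP[of _ 0] by (intro nn_integral_cong_AE) (auto elim!: eventually_mono)
    finally show ?thesis .
  qed
  have frag: "N + I4 = (\<integral>\<^sup>+s\<in>{0..t}. \<integral>\<^sup>+x. ennreal (k x) * mean_frag (\<lambda>y. f (y * exp (t - s))) x \<partial>m s \<partial>lborel)"
  proof -
    have "N + I4 = (\<integral>\<^sup>+s. (\<integral>\<^sup>+x. ennreal (k x) * mean_frag (killed (t - s) f) x \<partial>m s) * indicator {0..t} s
        + (\<integral>\<^sup>+x. ennreal (k x) * mean_frag (P s) x \<partial>m s) * indicator {0..t} s \<partial>lborel)"
      unfolding N_def I4_def
      by (rule nn_integral_add[symmetric]; intro borel_measurable_times_ennreal; (simp; fail)?;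
          subst measurable_lborel2; rule m_integral_measurable; measurable)
    also have "\<dots> = (\<integral>\<^sup>+s\<in>{0..t}. \<integral>\<^sup>+x. ennreal (k x) * mean_frag (\<lambda>y. f (y * exp (t - s))) x \<partial>m s \<partial>lborel)"
    proof (rule nn_integral_cong)
      fix s
      show "(\<integral>\<^sup>+x. ennreal (k x) * mean_frag (killed (t - s) f) x \<partial>m s) * indicator {0..t} s
        + (\<integral>\<^sup>+x. ennreal (k x) * mean_frag (P s) x \<partial>m s) * indicator {0..t} s
        = (\<integral>\<^sup>+x. ennreal (k x) * mean_frag (\<lambda>y. f (y * exp (t - s))) x \<partial>m s) * indicator {0..t} s"
      proof (cases "s \<in> {0..t}")
        case True
        have eq: "mean_frag (killed (t - s) f) x + mean_frag (P s) x = mean_frag (\<lambda>y. f (y * exp (t - s))) x"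
          if "0 < x" for x
          using that True VP by (subst mean_frag_add[symmetric]) (auto intro!: mean_frag_cong)
        have "(\<integral>\<^sup>+x. ennreal (k x) * mean_frag (killed (t - s) f) x \<partial>m s) + (\<integral>\<^sup>+x. ennreal (k x) * mean_frag (P s) x \<partial>m s)
          = (\<integral>\<^sup>+x. ennreal (k x) * mean_frag (killed (t - s) f) x + ennreal (k x) * mean_frag (P s) x \<partial>m s)"
          by (rule nn_integral_add[symmetric]) measurable
        also have "\<dots> = (\<integral>\<^sup>+x. ennreal (k x) * mean_frag (\<lambda>y. f (y * exp (t - s))) x \<partial>m s)"
          using m_pos[of s] True
          by (intro nn_integral_cong_AE) (auto elim!: eventually_mono simp: eq simp flip: distrib_left)
        finally show ?thesis using True by simp
      qed simp
    qed
    finally show ?thesis .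
  qed
  \<comment> \<open>The transport identity at time r, tested with \<open>k\<close> times
    \<open>killed (t - r) f\<close>, is integrated over r in [0, t]. Exchanging the order on the
    triangle turns its double integrals into \<open>I2\<close> and \<open>I4\<close>.\<close>
  have main: "I1 + I2 = I3 + I4"
  proof -
    define g where "g r x = ennreal (k x) * killed (t - r) f x" for r x
    have [measurable]: "(\<lambda>(r, x). g r x) \<in> borel_measurable (borel \<Otimes>\<^sub>M borel)"
      unfolding g_def by measurable
    have mg [measurable]: "(\<lambda>w. mean_frag (\<lambda>y. g (fst w) (y * exp (fst w - fst (snd w)))) (snd (snd w)))
      \<in> borel_measurable (borel \<Otimes>\<^sub>M borel \<Otimes>\<^sub>M borel)"
      unfolding mean_frag_def by measurable
    have mg': "(\<lambda>r. mean_frag (\<lambda>y. g r (y * exp (r - s))) x) \<in> borel_measurable borel" for s x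
      unfolding mean_frag_def by measurable
    have P_g: "P s x = (\<integral>\<^sup>+r\<in>{s..t}. g r (x * exp (r - s)) \<partial>lborel)" for s x
      by (simp add: P_def g_def)
    have i2: "(\<integral>\<^sup>+r\<in>{0..t}. \<integral>\<^sup>+s\<in>{0..r}. \<integral>\<^sup>+x. ennreal (k x) * g r (x * exp (r - s)) \<partial>m s \<partial>lborel \<partial>lborel) = I2"
      unfolding I2_def P_g
      by (subst triangle_swap, measurable)
         (auto intro!: nn_integral_cong simp: mult.assoc nn_integral_cmult)
    have i4: "(\<integral>\<^sup>+r\<in>{0..t}. \<integral>\<^sup>+s\<in>{0..r}. \<integral>\<^sup>+x. ennreal (k x) * mean_frag (\<lambda>y. g r (y * exp (r - s))) x \<partial>m s \<partial>lborel \<partial>lborel) = I4"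
    proof -
      have "mean_frag (P s) x = (\<integral>\<^sup>+r\<in>{s..t}. mean_frag (\<lambda>y. g r (y * exp (r - s))) x \<partial>lborel)" for s x
      proof -
        have "mean_frag (P s) x = (\<integral>\<^sup>+r. \<integral>\<^sup>+v. g r (x * sqrt v * exp (r - s)) * indicator {s..t} r \<partial>unif \<partial>lborel)"
          unfolding mean_frag_def P_g by (rule unif_pair.Fubini'[symmetric]) measurable
        then show ?thesis
          by (simp add: mean_frag_def nn_integral_multc)
      qed
      then have "ennreal (k x) * mean_frag (P s) x
          = (\<integral>\<^sup>+r\<in>{s..t}. ennreal (k x) * mean_frag (\<lambda>y. g r (y * exp (r - s))) x \<partial>lborel)" for s x
        using mg' by (simp add: mult.assoc nn_integral_cmult)
      then show ?thesis
        unfolding I4_def using mg by (subst triangle_swap) (auto simp: split_beta')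
    qed
    have i3: "(\<integral>\<^sup>+r\<in>{0..t}. \<integral>\<^sup>+x. g r (x * exp r) \<partial>m 0 \<partial>lborel) = I3"
    proof -
      interpret m0: prob_space "m 0" by (rule m_prob)
      interpret p: pair_sigma_finite "m 0" "lborel :: real measure" ..
      have "I3 = (\<integral>\<^sup>+r. \<integral>\<^sup>+x. g r (x * exp r) * indicator {0..t} r \<partial>m 0 \<partial>lborel)"
        unfolding I3_def P_g diff_0_right by (rule p.Fubini'[symmetric]) measurable
      then show ?thesis by (simp add: nn_integral_multc)
    qed
    have [measurable]: "(\<lambda>w. \<integral>\<^sup>+x. ennreal (k x) * g (fst w) (x * exp (fst w - snd w)) \<partial>m (snd w)) \<in> borel_measurable (borel \<Otimes>\<^sub>M borel)"
      by (rule m_integral_measurable) measurable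
    have [measurable]: "(\<lambda>w. \<integral>\<^sup>+x. ennreal (k x) * mean_frag (\<lambda>y. g (fst w) (y * exp (fst w - snd w))) x \<partial>m (snd w)) \<in> borel_measurable (borel \<Otimes>\<^sub>M borel)"
      by (rule m_integral_measurable) (auto simp: mean_frag_def)
    have ind: "indicator {0..r} s = (if 0 \<le> s \<and> s \<le> r then 1 else 0 :: ennreal)" for r s :: real
      by (auto simp: indicator_def)
    have [measurable]: "(\<lambda>r. \<integral>\<^sup>+x. g r x \<partial>m r) \<in> borel_measurable borel"
      "(\<lambda>r. \<integral>\<^sup>+x. g r (x * exp r) \<partial>m 0) \<in> borel_measurable borel"
      by (rule m_integral_measurable; measurable)+
    have [measurable]: "(\<lambda>r. \<integral>\<^sup>+s\<in>{0..r}. \<integral>\<^sup>+x. ennreal (k x) * g r (x * exp (r - s)) \<partial>m s \<partial>lborel) \<in> borel_measurable borel"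
      unfolding ind by measurable
    have [measurable]: "(\<lambda>r. \<integral>\<^sup>+s\<in>{0..r}. \<integral>\<^sup>+x. ennreal (k x) * mean_frag (\<lambda>y. g r (y * exp (r - s))) x \<partial>m s \<partial>lborel) \<in> borel_measurable borel"
      unfolding ind by measurable
    have "I1 + I2 = (\<integral>\<^sup>+r. (\<integral>\<^sup>+x. g r x \<partial>m r) * indicator {0..t} r
      + (\<integral>\<^sup>+s\<in>{0..r}. \<integral>\<^sup>+x. ennreal (k x) * g r (x * exp (r - s)) \<partial>m s \<partial>lborel) * indicator {0..t} r \<partial>lborel)"
      unfolding i2[symmetric] I1_def g_def[symmetric] by (rule nn_integral_add[symmetric]) measurable
    also have "\<dots> = (\<integral>\<^sup>+r. (\<integral>\<^sup>+x. g r (x * exp r) \<partial>m 0) * indicator {0..t} r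
      + (\<integral>\<^sup>+s\<in>{0..r}. \<integral>\<^sup>+x. ennreal (k x) * mean_frag (\<lambda>y. g r (y * exp (r - s))) x \<partial>m s \<partial>lborel) * indicator {0..t} r \<partial>lborel)"
    proof (rule nn_integral_cong)
      fix r
      show "(\<integral>\<^sup>+x. g r x \<partial>m r) * indicator {0..t} r
        + (\<integral>\<^sup>+s\<in>{0..r}. \<integral>\<^sup>+x. ennreal (k x) * g r (x * exp (r - s)) \<partial>m s \<partial>lborel) * indicator {0..t} r
        = (\<integral>\<^sup>+x. g r (x * exp r) \<partial>m 0) * indicator {0..t} r
        + (\<integral>\<^sup>+s\<in>{0..r}. \<integral>\<^sup>+x. ennreal (k x) * mean_frag (\<lambda>y. g r (y * exp (r - s))) x \<partial>m s \<partial>lborel) * indicator {0..t} r"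
      proof (cases "r \<in> {0..t}")
        case True
        have "g r \<in> borel_measurable borel" by measurable
        from transport[OF _ this, of r] True show ?thesis by simp
      qed simp
    qed
    also have "\<dots> = I3 + I4"
      unfolding i3[symmetric] i4[symmetric] by (rule nn_integral_add) measurable
    finally show ?thesis .
  qed
  have "(\<integral>\<^sup>+x. f x \<partial>m t) + \<kappa> = (\<integral>\<^sup>+x. f (x * exp t) \<partial>m 0)
      + (\<integral>\<^sup>+s\<in>{0..t}. \<integral>\<^sup>+x. ennreal (k x) * mean_frag (\<lambda>y. f (y * exp (t - s))) x \<partial>m s \<partial>lborel)"
    unfolding \<kappa>_def by (rule transport[OF t f])
  also have "\<dots> = ((\<integral>\<^sup>+x. killed t f x \<partial>m 0) + N) + (I3 + I4)"
    unfolding init[symmetric] frag[symmetric] by (simp add: ac_simps)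
  also have "I3 + I4 = \<kappa>" using main kappa by simp
  finally have "\<kappa> + (\<integral>\<^sup>+x. f x \<partial>m t) = \<kappa> + ((\<integral>\<^sup>+x. killed t f x \<partial>m 0) + N)"
    by (simp add: ac_simps)
  moreover have "\<kappa> \<noteq> \<top>" using k_integral_finite[OF B f, of t] by (simp add: \<kappa>_def less_top)
  ultimately show ?thesis by (simp add: ennreal_add_left_cancel N_def)
qed

end

section \<open>Comparison with the cell process\<close>

lemma jump_time_incseq: "incseq (jump_time R x u)"
  by (rule incseq_SucI) simp

declare jump_time.simps(2) [simp del]

lemma explosion_time_SUP: "explosion_time R x u = (SUP n. jump_time R x u n)"
  unfolding explosion_time_def by (rule limI[OF LIMSEQ_SUP[OF jump_time_incseq]])

lemma explosion_time_le_iff: "explosion_time R x u \<le> t \<longleftrightarrow> (\<forall>n. jump_time R x u n \<le> t)"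
  by (simp add: explosion_time_SUP SUP_le_iff)

lemma jump_interval_unique:
  assumes "jump_time R x u n \<le> t" "t < jump_time R x u (Suc n)"
    and "jump_time R x u l \<le> t" "t < jump_time R x u (Suc l)"
  shows "n = l"
proof (rule ccontr)
  assume "n \<noteq> l"
  then consider "Suc n \<le> l" | "Suc l \<le> n" by linarith
  then show False
  proof cases
    case 1
    then have "jump_time R x u (Suc n) \<le> jump_time R x u l" by (rule incseqD[OF jump_time_incseq])
    with assms show False by (meson leD order_trans)
  next
    case 2
    then have "jump_time R x u (Suc l) \<le> jump_time R x u n" by (rule incseqD[OF jump_time_incseq])
    with assms show False by (meson leD order_trans)
  qed
qed

lemma jump_interval_Least:
  assumes "\<not> (\<forall>n. jump_time R x u n \<le> t)"
  defines "l \<equiv> (LEAST n. t < jump_time R x u (Suc n))"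
  shows "jump_time R x u l \<le> t" "t < jump_time R x u (Suc l)"
proof -
  obtain n where n: "t < jump_time R x u n" using assms(1) by (auto simp: not_le)
  then obtain n' where "n = Suc n'" by (cases n) auto
  with n have ex: "t < jump_time R x u (Suc n')" by simp
  show "t < jump_time R x u (Suc l)" unfolding l_def using ex by (rule LeastI)
  show "jump_time R x u l \<le> t"
  proof (cases l)
    case (Suc l')
    then have "\<not> t < jump_time R x u (Suc l')"
      unfolding l_def using not_less_Least by (metis lessI)
    then show ?thesis using Suc by simp
  qed simp
qed

text \<open>The definite description in \<open>cell_path\<close> becomes a least index, a countable
  selection that is measurable jointly in the starting point and the uniforms.\<close>

lemma cell_path_Least:
  "cell_path R x u t = (if x \<le> 0 \<or> (\<forall>n. jump_time R x u n \<le> ennreal t) then 0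
    else pos x u (LEAST n. ennreal t < jump_time R x u (Suc n)) t)"
proof (cases "x \<le> 0 \<or> (\<forall>n. jump_time R x u n \<le> ennreal t)")
  case False
  then have "(THE n. jump_time R x u n \<le> ennreal t \<and> ennreal t < jump_time R x u (Suc n))
    = (LEAST n. ennreal t < jump_time R x u (Suc n))"
    using jump_interval_Least[of R x u "ennreal t"] jump_interval_unique[of R x u _ "ennreal t"]
    by (intro the_equality) auto
  then show ?thesis
    unfolding cell_path_def explosion_time_le_iff pos_def if_not_P[OF False] by (simp only: if_False)
qed (auto simp: cell_path_def explosion_time_le_iff)

text \<open>The finite product sees the driving sequence restricted to the indices 1 to n. Since g
  reads only these coordinates, the restricted sequence may be replaced by the whole one.\<close>

lemma driving_nn_integral:
  assumes drv: "driving_sequence M U" and n: "1 \<le> n"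
    and g [measurable]: "g \<in> borel_measurable (unifs n)"
    and dep: "\<And>u v. (\<And>i. 1 \<le> i \<Longrightarrow> i \<le> n \<Longrightarrow> u i = v i) \<Longrightarrow> g u = g v"
  shows "(\<integral>\<^sup>+\<omega>. g (\<lambda>i. U i \<omega>) \<partial>M) = (\<integral>\<^sup>+u. g u \<partial>unifs n)"
proof -
  interpret prob_space M using drv by (simp add: driving_sequence_def)
  have ind: "indep_vars (\<lambda>_. borel) U {1..n}"
    using drv by (auto simp: driving_sequence_def intro: indep_vars_subset)
  then have rv: "random_variable borel (U i)" if "i \<in> {1..n}" for i
    using that by (auto simp: indep_vars_def)
  have "distr M (\<Pi>\<^sub>M i\<in>{1..n}. borel) (\<lambda>\<omega>. \<lambda>i\<in>{1..n}. U i \<omega>) = (\<Pi>\<^sub>M i\<in>{1..n}. distr M borel (U i))"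
    using ind rv n by (subst indep_vars_iff_distr_eq_PiM'[symmetric]) auto
  also have "\<dots> = unifs n"
    using drv unfolding unifs_def by (intro PiM_cong) (auto simp: driving_sequence_def unif_def)
  finally have eq: "unifs n = distr M (\<Pi>\<^sub>M i\<in>{1..n}. borel) (\<lambda>\<omega>. \<lambda>i\<in>{1..n}. U i \<omega>)" ..
  have U_meas: "(\<lambda>\<omega>. \<lambda>i\<in>{1..n}. U i \<omega>) \<in> M \<rightarrow>\<^sub>M (\<Pi>\<^sub>M i\<in>{1..n}. borel)"
    by (rule measurable_restrict) (rule rv)
  have "(\<integral>\<^sup>+u. g u \<partial>unifs n) = (\<integral>\<^sup>+\<omega>. g (\<lambda>i\<in>{1..n}. U i \<omega>) \<partial>M)"
    using g unfolding eq by (rule nn_integral_distr[OF U_meas])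
  also have "\<dots> = (\<integral>\<^sup>+\<omega>. g (\<lambda>i. U i \<omega>) \<partial>M)"
    by (intro nn_integral_cong dep) auto
  finally show ?thesis ..
qed

text \<open>The inequality for the complement of a set is the reverse inequality for the
  set.\<close>

lemma prob_measure_eqI:
  assumes "prob_space M" "prob_space N" "sets M = sets N"
    and le: "\<And>B. B \<in> sets M \<Longrightarrow> emeasure M B \<le> emeasure N B"
  shows "M = N"
proof (rule measure_eqI)
  interpret M: prob_space M by fact
  interpret N: prob_space N by fact
  fix B assume B: "B \<in> sets M"
  have B': "B \<in> sets N" "space M - B \<in> sets M" "space M - B \<in> sets N" "space M = space N"
    using B assms(3) sets_eq_imp_space_eq[OF assms(3)] by auto
  have "1 - M.prob B \<le> 1 - N.prob B"
    using le[OF B'(2)] M.prob_compl[OF B] N.prob_compl[OF B'(1)] B'(4)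
    by (simp add: M.emeasure_eq_measure N.emeasure_eq_measure)
  moreover have "M.prob B \<le> N.prob B"
    using le[OF B] by (simp add: M.emeasure_eq_measure N.emeasure_eq_measure)
  ultimately show "emeasure M B = emeasure N B"
    by (simp add: M.emeasure_eq_measure N.emeasure_eq_measure)
qed fact

section \<open>Domination of the process and identification of its law\<close>

context transport
begin

text \<open>Truncation of f at height n and monotone convergence. Unbounded f are unavoidable: one
  step of the recursion multiplies the test function by \<open>k\<close>.\<close>

lemma mild:
  assumes t: "0 \<le> t" and f [measurable]: "f \<in> borel_measurable borel"
  shows "(\<integral>\<^sup>+x. f x \<partial>m t) = (\<integral>\<^sup>+x. killed t f x \<partial>m 0)
    + (\<integral>\<^sup>+s\<in>{0..t}. \<integral>\<^sup>+x. ennreal (k x) * mean_frag (killed (t - s) f) x \<partial>m s \<partial>lborel)"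
proof -
  define h where "h n x = min (f x) (of_nat n)" for n :: nat and x
  have [measurable]: "h n \<in> borel_measurable borel" for n unfolding h_def by measurable
  have h_inc: "incseq (\<lambda>n. h n x)" for x
    by (auto simp: h_def incseq_def min.coboundedI2)
  have h_SUP: "(SUP n. h n x) = f x" for x
  proof -
    have "(SUP n. h n x) = inf (f x) (SUP n. of_nat n)"
      unfolding h_def inf_min[symmetric] inf_SUP ..
    then show ?thesis by (simp add: ennreal_SUP_of_nat_eq_top)
  qed
  have killed_inc: "incseq (\<lambda>n. killed r (h n) x)" for r x
    unfolding killed_def using h_inc by (auto simp: incseq_def intro!: mult_right_mono)
  have killed_SUP: "(SUP n. killed r (h n) x) = killed r f x" for r x
    by (simp add: killed_def SUP_mult_right_ennreal[symmetric] h_SUP)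
  have [measurable]: "(\<lambda>(r, z). killed r (h n) z) \<in> borel_measurable (borel \<Otimes>\<^sub>M borel)" for n
    by (rule killed_measurable) measurable
  have mf_inc: "incseq (\<lambda>n. mean_frag (killed r (h n)) x)" for r x
    unfolding mean_frag_def using killed_inc by (auto simp: incseq_def intro!: nn_integral_mono)
  have mf_SUP: "(SUP n. mean_frag (killed r (h n)) x) = mean_frag (killed r f) x" for r x
    unfolding mean_frag_def killed_SUP[symmetric]
    by (rule nn_integral_monotone_convergence_SUP[symmetric])
       (use killed_inc in \<open>auto simp: incseq_def le_fun_def\<close>)
  have [measurable]: "(\<lambda>(s, x). mean_frag (killed (t - s) (h n)) x) \<in> borel_measurable (borel \<Otimes>\<^sub>M borel)" for n
    by (rule mean_frag_measurable) measurable
  have [measurable]: "(\<lambda>s. \<integral>\<^sup>+x. ennreal (k x) * mean_frag (killed (t - s) (h n)) x \<partial>m s) \<in> borel_measurable borel" for n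
    by (rule m_integral_measurable) measurable
  have inner: "(\<integral>\<^sup>+x. ennreal (k x) * mean_frag (killed r f) x \<partial>m s)
    = (SUP n. \<integral>\<^sup>+x. ennreal (k x) * mean_frag (killed r (h n)) x \<partial>m s)" for r s
    unfolding mf_SUP[symmetric] SUP_mult_left_ennreal
  proof (rule nn_integral_monotone_convergence_SUP)
    show "incseq (\<lambda>n x. ennreal (k x) * mean_frag (killed r (h n)) x)"
      using mf_inc by (auto simp: incseq_def le_fun_def intro!: mult_left_mono)
    show "(\<lambda>x. ennreal (k x) * mean_frag (killed r (h n)) x) \<in> borel_measurable (m s)" for n
    proof -
      interpret prob_space unif by (rule prob_space_unif)
      show ?thesis unfolding mean_frag_def by measurable
    qed
  qed
  define a where "a n = (\<integral>\<^sup>+x. killed t (h n) x \<partial>m 0)" for n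
  define b where "b n = (\<integral>\<^sup>+s\<in>{0..t}. \<integral>\<^sup>+x. ennreal (k x) * mean_frag (killed (t - s) (h n)) x \<partial>m s \<partial>lborel)" for n
  have "(\<integral>\<^sup>+x. f x \<partial>m t) = (SUP n. \<integral>\<^sup>+x. h n x \<partial>m t)"
    unfolding h_SUP[symmetric]
    by (rule nn_integral_monotone_convergence_SUP) (use h_inc in \<open>auto simp: incseq_def le_fun_def\<close>)
  also have "\<dots> = (SUP n. a n + b n)"
    unfolding a_def b_def
  proof (intro SUP_cong refl)
    fix n
    show "(\<integral>\<^sup>+x. h n x \<partial>m t) = (\<integral>\<^sup>+x. killed t (h n) x \<partial>m 0)
      + (\<integral>\<^sup>+s\<in>{0..t}. \<integral>\<^sup>+x. ennreal (k x) * mean_frag (killed (t - s) (h n)) x \<partial>m s \<partial>lborel)"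
      by (rule mild_bounded[OF t, of _ "of_nat n"]) (auto simp: h_def of_nat_less_top)
  qed
  also have "\<dots> = (SUP n. a n) + (SUP n. b n)"
  proof (rule ennreal_SUP_add)
    show "incseq a" unfolding a_def using killed_inc by (auto simp: incseq_def intro!: nn_integral_mono)
    show "incseq b" unfolding b_def using mf_inc
      by (auto simp: incseq_def intro!: nn_integral_mono mult_right_mono mult_left_mono)
  qed
  also have "(SUP n. a n) = (\<integral>\<^sup>+x. killed t f x \<partial>m 0)"
    unfolding a_def killed_SUP[symmetric]
    by (rule nn_integral_monotone_convergence_SUP[symmetric])
       (use killed_inc in \<open>auto simp: incseq_def le_fun_def\<close>)
  also have "(SUP n. b n) = (\<integral>\<^sup>+s\<in>{0..t}. \<integral>\<^sup>+x. ennreal (k x) * mean_frag (killed (t - s) f) x \<partial>m s \<partial>lborel)"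
    unfolding b_def inner SUP_mult_right_ennreal
    by (rule nn_integral_monotone_convergence_SUP[symmetric])
       (use mf_inc in \<open>auto simp: incseq_def le_fun_def intro!: nn_integral_mono mult_right_mono mult_left_mono\<close>)
  finally show ?thesis .
qed

lemma occ_integral_swap:
  assumes [measurable]: "(\<lambda>(s, y). h s y) \<in> borel_measurable (borel \<Otimes>\<^sub>M borel)"
  shows "(\<integral>\<^sup>+x. (\<integral>\<^sup>+s\<in>{0..t}. occ n x s (h s) \<partial>lborel) \<partial>m 0)
    = (\<integral>\<^sup>+s\<in>{0..t}. \<integral>\<^sup>+x. occ n x s (h s) \<partial>m 0 \<partial>lborel)"
proof -
  interpret m0: prob_space "m 0" by (rule m_prob)
  interpret p: pair_sigma_finite "m 0" "lborel :: real measure" ..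
  have [measurable]: "(\<lambda>(x, s). occ n x s (h s)) \<in> borel_measurable (borel \<Otimes>\<^sub>M borel)"
    by (rule occ_measurable) measurable
  have "(\<integral>\<^sup>+x. (\<integral>\<^sup>+s\<in>{0..t}. occ n x s (h s) \<partial>lborel) \<partial>m 0)
    = (\<integral>\<^sup>+s. \<integral>\<^sup>+x. occ n x s (h s) * indicator {0..t} s \<partial>m 0 \<partial>lborel)"
    by (rule p.Fubini'[symmetric]) measurable
  then show ?thesis by (simp add: nn_integral_multc)
qed

lemma occ_integral_measurable:
  assumes [measurable]: "(\<lambda>(s, y). h s y) \<in> borel_measurable (borel \<Otimes>\<^sub>M borel)"
  shows "(\<lambda>s. \<integral>\<^sup>+x. occ n x s (h s) \<partial>m 0) \<in> borel_measurable borel"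
proof -
  have [measurable]: "(\<lambda>(x, s). occ n x s (h s)) \<in> borel_measurable (borel \<Otimes>\<^sub>M borel)"
    by (rule occ_measurable) measurable
  show ?thesis by (rule m_integral_measurable) measurable
qed

text \<open>The induction varies t and f, because removing the last jump passes from f at time t to
  \<open>k\<close> times the average of the killed f at an earlier time s. The recursions are
  \<open>occ_Suc\<close> on the left and \<open>mild\<close> on the right.\<close>

lemma occ_sum_le:
  assumes "0 \<le> t" "f \<in> borel_measurable borel"
  shows "(\<Sum>i<n. \<integral>\<^sup>+x. occ i x t f \<partial>m 0) \<le> (\<integral>\<^sup>+x. f x \<partial>m t)"
  using assms
proof (induction n arbitrary: t f)
  case (Suc n)
  note [measurable] = Suc.prems(2)
  define h where "h s y = ennreal (k y) * mean_frag (killed (t - s) f) y" for s y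
  note killed_measurable[OF Suc.prems(2), measurable]
  have "(\<lambda>(s, x). mean_frag (killed (t - s) f) x) \<in> borel_measurable (borel \<Otimes>\<^sub>M borel)"
    by (rule mean_frag_measurable) measurable
  then have h [measurable]: "(\<lambda>(s, y). h s y) \<in> borel_measurable (borel \<Otimes>\<^sub>M borel)"
    unfolding h_def by measurable
  note occ_integral_measurable[OF h, measurable]
  have "(\<Sum>i<Suc n. \<integral>\<^sup>+x. occ i x t f \<partial>m 0)
    = (\<integral>\<^sup>+x. killed t f x \<partial>m 0) + (\<Sum>i<n. \<integral>\<^sup>+x. occ (Suc i) x t f \<partial>m 0)"
    using Suc.prems by (simp add: sum.lessThan_Suc_shift occ_0 del: sum.lessThan_Suc)
  also have "(\<Sum>i<n. \<integral>\<^sup>+x. occ (Suc i) x t f \<partial>m 0)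
    = (\<Sum>i<n. \<integral>\<^sup>+s\<in>{0..t}. \<integral>\<^sup>+x. occ i x s (h s) \<partial>m 0 \<partial>lborel)"
    unfolding occ_Suc[OF Suc.prems] h_def[symmetric] occ_integral_swap[OF h] ..
  also have "\<dots> = (\<integral>\<^sup>+s. (\<Sum>i<n. (\<integral>\<^sup>+x. occ i x s (h s) \<partial>m 0) * indicator {0..t} s) \<partial>lborel)"
    by (rule nn_integral_sum[symmetric]) measurable
  also have "\<dots> \<le> (\<integral>\<^sup>+s\<in>{0..t}. \<integral>\<^sup>+x. h s x \<partial>m s \<partial>lborel)"
  proof (rule nn_integral_mono)
    fix s
    have "h s \<in> borel_measurable borel" by measurable
    then show "(\<Sum>i<n. (\<integral>\<^sup>+x. occ i x s (h s) \<partial>m 0) * indicator {0..t} s)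
      \<le> (\<integral>\<^sup>+x. h s x \<partial>m s) * indicator {0..t} s"
      using Suc.IH[of s "h s"] by (cases "s \<in> {0..t}") auto
  qed
  also have "(\<integral>\<^sup>+x. killed t f x \<partial>m 0) + (\<integral>\<^sup>+s\<in>{0..t}. \<integral>\<^sup>+x. h s x \<partial>m s \<partial>lborel) = (\<integral>\<^sup>+x. f x \<partial>m t)"
    unfolding h_def by (rule mild[OF Suc.prems, symmetric])
  finally show ?case by (simp add: add_left_mono)
qed simp

text \<open>The left-hand side bounds the expected number of jumps before \<open>t\<close>, so there is no explosion.\<close>

lemma jump_count_bound:
  assumes t: "0 \<le> t"
  shows "(\<Sum>i<n. \<integral>\<^sup>+x. \<integral>\<^sup>+u. (if jump_time R x u (Suc i) \<le> ennreal t then 1 else 0) \<partial>unifs (Suc (2 * i)) \<partial>m 0)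
    \<le> C * ennreal t"
proof -
  \<comment> \<open>With h constantly 1, \<open>next_jump\<close> expresses the probability of jump
    i + 1 up to time t through the rate along paths with exactly i jumps. The sum over i is then
    controlled by \<open>occ_sum_le\<close> with f = \<open>k\<close>.\<close>
  have "(\<Sum>i<n. \<integral>\<^sup>+x. \<integral>\<^sup>+u. (if jump_time R x u (Suc i) \<le> ennreal t then 1 else 0) \<partial>unifs (Suc (2 * i)) \<partial>m 0)
    = (\<Sum>i<n. \<integral>\<^sup>+x. (\<integral>\<^sup>+s\<in>{0..t}. occ i x s (\<lambda>y. ennreal (k y)) \<partial>lborel) \<partial>m 0)"
    using next_jump[OF t, of "\<lambda>_ _. 1"] by simp
  also have "\<dots> = (\<Sum>i<n. \<integral>\<^sup>+s\<in>{0..t}. \<integral>\<^sup>+x. occ i x s (\<lambda>y. ennreal (k y)) \<partial>m 0 \<partial>lborel)"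
    by (intro sum.cong refl occ_integral_swap) measurable
  also have "\<dots> = (\<integral>\<^sup>+s. (\<Sum>i<n. (\<integral>\<^sup>+x. occ i x s (\<lambda>y. ennreal (k y)) \<partial>m 0) * indicator {0..t} s) \<partial>lborel)"
  proof (rule nn_integral_sum[symmetric])
    fix i
    have "(\<lambda>s. \<integral>\<^sup>+x. occ i x s (\<lambda>y. ennreal (k y)) \<partial>m 0) \<in> borel_measurable borel"
      by (rule occ_integral_measurable) measurable
    then show "(\<lambda>s. (\<integral>\<^sup>+x. occ i x s (\<lambda>y. ennreal (k y)) \<partial>m 0) * indicator {0..t} s) \<in> borel_measurable lborel"
      by measurable
  qed
  also have "\<dots> \<le> (\<integral>\<^sup>+s. C * indicator {0..t} s \<partial>lborel)"
  proof (rule nn_integral_mono)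
    fix s
    show "(\<Sum>i<n. (\<integral>\<^sup>+x. occ i x s (\<lambda>y. ennreal (k y)) \<partial>m 0) * indicator {0..t} s) \<le> C * indicator {0..t} s"
      using order_trans[OF occ_sum_le[of s "\<lambda>y. ennreal (k y)" n] rate_bound[of s]]
      by (cases "s \<in> {0..t}") auto
  qed
  also have "\<dots> = C * ennreal t" using t by (subst nn_integral_cmult) auto
  finally show ?thesis .
qed

theorem law_unique:
  fixes M :: "'z measure"
  assumes t: "0 \<le> t" and drv: "driving_sequence M U"
  shows "m t = cell_law R M U (m 0) t"
proof -
  interpret M: prob_space M using drv by (simp add: driving_sequence_def)
  interpret m0: prob_space "m 0" by (rule m_prob)
  interpret P: pair_prob_space "m 0" M ..
  have "M.indep_vars (\<lambda>_. borel) U {1..}" using drv by (simp add: driving_sequence_def)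
  then have U: "(\<lambda>w. U i (snd w)) \<in> borel_measurable (m 0 \<Otimes>\<^sub>M M)" if "1 \<le> i" for i
    using that by (intro measurable_compose[OF measurable_snd]) (auto simp: M.indep_vars_def)
  let ?\<tau> = "\<lambda>n w. jump_time R (fst w) (\<lambda>i. U i (snd w)) n"
  let ?X = "\<lambda>w. cell_path R (fst w) (\<lambda>i. U i (snd w)) t"
  let ?p = "\<lambda>n w. pos (fst w) (\<lambda>i. U i (snd w)) n t"
  have [measurable]: "?\<tau> n \<in> borel_measurable (m 0 \<Otimes>\<^sub>M M)" for n
    by (rule jump_time_measurable) (auto intro: U)
  have [measurable]: "?p n \<in> borel_measurable (m 0 \<Otimes>\<^sub>M M)" for n
    by (rule pos_measurable) (auto intro: U)
  have X_meas [measurable]: "?X \<in> borel_measurable (m 0 \<Otimes>\<^sub>M M)"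
  proof -
    have "(\<lambda>w. ?p (LEAST n. ennreal t < ?\<tau> (Suc n) w) w) \<in> borel_measurable (m 0 \<Otimes>\<^sub>M M)"
      by (rule measurable_compose_countable[where f="?p" and g="\<lambda>w. LEAST n. ennreal t < ?\<tau> (Suc n) w"])
         measurable
    then show ?thesis unfolding cell_path_Least by measurable
  qed
  have law: "cell_law R M U (m 0) t = distr (m 0 \<Otimes>\<^sub>M M) borel ?X"
    by (simp add: cell_law_def split_beta')
  have dep: "jump_time R x u (Suc n) = jump_time R x v (Suc n)" "jump_time R x u n = jump_time R x v n"
    "pos x u n t = pos x v n t"
    if "\<And>i. 1 \<le> i \<Longrightarrow> i \<le> Suc (2 * n) \<Longrightarrow> u i = v i" for x u v n
    by (rule jump_time_cong pos_cong; use that in simp)+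
  have jt_meas: "(\<lambda>u. jump_time R x u (Suc n)) \<in> borel_measurable (unifs (Suc (2 * n)))"
    "(\<lambda>u. jump_time R x u n) \<in> borel_measurable (unifs (Suc (2 * n)))"
    "(\<lambda>u. pos x u n t) \<in> borel_measurable (unifs (Suc (2 * n)))" for x n
    by (rule jump_time_measurable pos_measurable; simp)+
  have E_sets: "{w \<in> space (m 0 \<Otimes>\<^sub>M M). \<forall>n. ?\<tau> n w \<le> ennreal t} \<in> sets (m 0 \<Otimes>\<^sub>M M)"
    by measurable
  \<comment> \<open>If the path explodes by time t, every jump happens up to t, so the probability
    of explosion is at most each summand in \<open>jump_count_bound\<close>. The bound there is
    uniform in the number of summands, which forces probability zero.\<close>
  have explode: "emeasure (m 0 \<Otimes>\<^sub>M M) {w \<in> space (m 0 \<Otimes>\<^sub>M M). \<forall>n. ?\<tau> n w \<le> ennreal t} = 0" (is "emeasure _ ?E = 0")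
  proof -
    have E_le: "emeasure (m 0 \<Otimes>\<^sub>M M) ?E
      \<le> (\<integral>\<^sup>+x. \<integral>\<^sup>+u. (if jump_time R x u (Suc i) \<le> ennreal t then 1 else 0) \<partial>unifs (Suc (2 * i)) \<partial>m 0)" for i
    proof -
      have "emeasure (m 0 \<Otimes>\<^sub>M M) ?E = (\<integral>\<^sup>+w. indicator ?E w \<partial>(m 0 \<Otimes>\<^sub>M M))"
        by (rule nn_integral_indicator[symmetric, OF E_sets])
      also have "\<dots> \<le> (\<integral>\<^sup>+w. (if ?\<tau> (Suc i) w \<le> ennreal t then 1 else 0) \<partial>(m 0 \<Otimes>\<^sub>M M))"
        by (intro nn_integral_mono) (auto simp: indicator_def simp del: jump_time.simps)
      also have "\<dots> = (\<integral>\<^sup>+x. \<integral>\<^sup>+\<omega>. (if ?\<tau> (Suc i) (x, \<omega>) \<le> ennreal t then 1 else 0) \<partial>M \<partial>m 0)"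
      proof -
        define h :: "real \<times> 'z \<Rightarrow> ennreal" where "h = (\<lambda>w. if ?\<tau> (Suc i) w \<le> ennreal t then 1 else 0)"
        have "h \<in> borel_measurable (m 0 \<Otimes>\<^sub>M M)" unfolding h_def by measurable
        from M.nn_integral_fst[OF this] show ?thesis by (simp only: h_def)
      qed
      also have "\<dots> = (\<integral>\<^sup>+x. \<integral>\<^sup>+u. (if jump_time R x u (Suc i) \<le> ennreal t then 1 else 0) \<partial>unifs (Suc (2 * i)) \<partial>m 0)"
      proof (intro nn_integral_cong)
        fix x
        note jt_meas[measurable]
        show "(\<integral>\<^sup>+\<omega>. (if ?\<tau> (Suc i) (x, \<omega>) \<le> ennreal t then 1 else 0) \<partial>M)
          = (\<integral>\<^sup>+u. (if jump_time R x u (Suc i) \<le> ennreal t then 1 else 0) \<partial>unifs (Suc (2 * i)))"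
          unfolding fst_conv snd_conv
        proof (rule driving_nn_integral[OF drv, where g="\<lambda>u. if jump_time R x u (Suc i) \<le> ennreal t then 1 else 0"])
          fix u v :: "nat \<Rightarrow> real"
          assume "\<And>j. 1 \<le> j \<Longrightarrow> j \<le> Suc (2 * i) \<Longrightarrow> u j = v j"
          then have "jump_time R x u (Suc i) = jump_time R x v (Suc i)" by (rule dep(1))
          then show "(if jump_time R x u (Suc i) \<le> ennreal t then 1 else 0 :: ennreal)
            = (if jump_time R x v (Suc i) \<le> ennreal t then 1 else 0)" by simp
        qed simp_all
      qed
      finally show ?thesis .
    qed
    have "of_nat n * emeasure (m 0 \<Otimes>\<^sub>M M) ?E \<le> C * ennreal t" for n
    proof -
      have "of_nat n * emeasure (m 0 \<Otimes>\<^sub>M M) ?E = (\<Sum>i<n. emeasure (m 0 \<Otimes>\<^sub>M M) ?E)" by simp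
      also have "\<dots> \<le> (\<Sum>i<n. \<integral>\<^sup>+x. \<integral>\<^sup>+u. (if jump_time R x u (Suc i) \<le> ennreal t then 1 else 0) \<partial>unifs (Suc (2 * i)) \<partial>m 0)"
        by (rule sum_mono) (rule E_le)
      also have "\<dots> \<le> C * ennreal t" by (rule jump_count_bound[OF t])
      finally show ?thesis .
    qed
    then have "(SUP n. of_nat n * emeasure (m 0 \<Otimes>\<^sub>M M) ?E) \<le> C * ennreal t"
      by (rule SUP_least)
    then have "\<top> * emeasure (m 0 \<Otimes>\<^sub>M M) ?E \<le> C * ennreal t"
      by (simp add: SUP_mult_right_ennreal[symmetric] ennreal_SUP_of_nat_eq_top)
    moreover have "C * ennreal t < \<top>" using C_finite by (simp add: ennreal_mult_less_top)
    ultimately show ?thesis by (auto simp: ennreal_top_mult split: if_splits)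
  qed
  have "distr (m 0 \<Otimes>\<^sub>M M) borel ?X = m t"
  proof (rule prob_measure_eqI)
    show "prob_space (distr (m 0 \<Otimes>\<^sub>M M) borel ?X)" by (rule P.prob_space_distr) measurable
    show "prob_space (m t)" by (rule m_prob)
    show "sets (distr (m 0 \<Otimes>\<^sub>M M) borel ?X) = sets (m t)" by simp
    fix B assume "B \<in> sets (distr (m 0 \<Otimes>\<^sub>M M) borel ?X)"
    then have B [measurable]: "B \<in> sets borel" by simp
    define f where "f = (indicator B :: real \<Rightarrow> ennreal)"
    have f [measurable]: "f \<in> borel_measurable borel" unfolding f_def by measurable
    define g where "g n x u = (if jump_time R x u n \<le> ennreal t \<and> ennreal t < jump_time R x u (Suc n)
      then f (pos x u n t) else 0)" for n x u
    have [measurable]: "(\<lambda>w. g n (fst w) (\<lambda>i. U i (snd w))) \<in> borel_measurable (m 0 \<Otimes>\<^sub>M M)" for n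
      unfolding g_def by measurable
    have "emeasure (distr (m 0 \<Otimes>\<^sub>M M) borel ?X) B = (\<integral>\<^sup>+y. f y \<partial>distr (m 0 \<Otimes>\<^sub>M M) borel ?X)"
      by (simp add: f_def)
    also have "\<dots> = (\<integral>\<^sup>+w. f (?X w) \<partial>(m 0 \<Otimes>\<^sub>M M))"
      by (rule nn_integral_distr) measurable
    \<comment> \<open>Almost surely the start is positive and there is no explosion, so t lies in an
      interval between two jumps and f at the path value is one term of the series. An inequality
      suffices for the domination.\<close>
    also have "\<dots> \<le> (\<integral>\<^sup>+w. (\<Sum>n. g n (fst w) (\<lambda>i. U i (snd w))) \<partial>(m 0 \<Otimes>\<^sub>M M))"
    proof (rule nn_integral_mono_AE)
      have "AE w in m 0 \<Otimes>\<^sub>M M. 0 < fst w"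
      proof (rule P.AE_pair_measure)
        have "fst \<in> borel_measurable (m 0 \<Otimes>\<^sub>M M)"
          using measurable_fst[of "m 0" M] by (simp cong: measurable_cong_sets)
        then show "{w \<in> space (m 0 \<Otimes>\<^sub>M M). 0 < fst w} \<in> sets (m 0 \<Otimes>\<^sub>M M)"
          by (intro borel_measurable_less) auto
      qed (use m_pos[of 0] in \<open>auto elim!: eventually_mono\<close>)
      moreover have "AE w in m 0 \<Otimes>\<^sub>M M. \<not> (\<forall>n. ?\<tau> n w \<le> ennreal t)"
        by (rule AE_I[OF _ explode E_sets]) auto
      ultimately show "AE w in m 0 \<Otimes>\<^sub>M M. f (?X w) \<le> (\<Sum>n. g n (fst w) (\<lambda>i. U i (snd w)))"
      proof eventually_elim
        case (elim w)
        define l where "l = (LEAST n. ennreal t < ?\<tau> (Suc n) w)"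
        have nb: "\<not> (fst w \<le> 0 \<or> (\<forall>n. ?\<tau> n w \<le> ennreal t))"
          using elim(1,2) by (simp only: not_le de_Morgan_disj simp_thms)
        have "?X w = ?p l w" unfolding cell_path_Least l_def if_not_P[OF nb] ..
        moreover have "?\<tau> l w \<le> ennreal t" "ennreal t < ?\<tau> (Suc l) w"
          using jump_interval_Least[OF elim(2)] by (simp_all only: l_def)
        ultimately have "f (?X w) = g l (fst w) (\<lambda>i. U i (snd w))"
          unfolding g_def by (simp only: if_True simp_thms)
        also have "\<dots> = (\<Sum>n\<in>{l}. g n (fst w) (\<lambda>i. U i (snd w)))" by simp
        also have "\<dots> \<le> (\<Sum>n. g n (fst w) (\<lambda>i. U i (snd w)))"
          by (rule sum_le_suminf) auto
        finally show ?case .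
      qed
    qed
    also have "\<dots> = (\<Sum>n. \<integral>\<^sup>+w. g n (fst w) (\<lambda>i. U i (snd w)) \<partial>(m 0 \<Otimes>\<^sub>M M))"
      by (rule nn_integral_suminf) measurable
    also have "\<dots> = (\<Sum>n. \<integral>\<^sup>+x. occ n x t f \<partial>m 0)"
    proof (intro arg_cong[where f=suminf] ext)
      fix n
      have "(\<integral>\<^sup>+w. g n (fst w) (\<lambda>i. U i (snd w)) \<partial>(m 0 \<Otimes>\<^sub>M M))
        = (\<integral>\<^sup>+x. \<integral>\<^sup>+\<omega>. g n (fst (x, \<omega>)) (\<lambda>i. U i (snd (x, \<omega>))) \<partial>M \<partial>m 0)"
      proof -
        define h :: "real \<times> 'z \<Rightarrow> ennreal" where "h = (\<lambda>w. g n (fst w) (\<lambda>i. U i (snd w)))"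
        have "h \<in> borel_measurable (m 0 \<Otimes>\<^sub>M M)" unfolding h_def by measurable
        from M.nn_integral_fst[OF this] show ?thesis by (simp only: h_def)
      qed
      also have "\<dots> = (\<integral>\<^sup>+x. \<integral>\<^sup>+u. g n x u \<partial>unifs (Suc (2 * n)) \<partial>m 0)"
      proof (intro nn_integral_cong)
        fix x
        note jt_meas[measurable]
        have dep_g: "g n x u = g n x v" if "\<And>i. 1 \<le> i \<Longrightarrow> i \<le> Suc (2 * n) \<Longrightarrow> u i = v i" for u v
          using dep[OF that] unfolding g_def by simp
        have "(\<lambda>u. g n x u) \<in> borel_measurable (unifs (Suc (2 * n)))"
          unfolding g_def by measurable
        from driving_nn_integral[OF drv _ this dep_g]
        show "(\<integral>\<^sup>+\<omega>. g n (fst (x, \<omega>)) (\<lambda>i. U i (snd (x, \<omega>))) \<partial>M) = (\<integral>\<^sup>+u. g n x u \<partial>unifs (Suc (2 * n)))"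
          unfolding fst_conv snd_conv by simp
      qed
      also have "\<dots> = (\<integral>\<^sup>+x. occ n x t f \<partial>m 0)"
        unfolding g_def occ_alive[OF t f] ..
      finally show "(\<integral>\<^sup>+w. g n (fst w) (\<lambda>i. U i (snd w)) \<partial>(m 0 \<Otimes>\<^sub>M M)) = (\<integral>\<^sup>+x. occ n x t f \<partial>m 0)" .
    qed
    also have "\<dots> = (SUP n. \<Sum>i<n. \<integral>\<^sup>+x. occ i x t f \<partial>m 0)"
      by (rule suminf_eq_SUP)
    also have "\<dots> \<le> (\<integral>\<^sup>+x. f x \<partial>m t)"
      by (rule SUP_least) (rule occ_sum_le[OF t f])
    also have "\<dots> = emeasure (m t) B" by (simp add: f_def)
    finally show "emeasure (distr (m 0 \<Otimes>\<^sub>M M) borel ?X) B \<le> emeasure (m t) B" .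
  qed
  then show ?thesis by (simp add: law)
qed

end

section \<open>Test functions moving with the flow\<close>

lemma integral_unif:
  fixes h :: "real \<Rightarrow> real"
  assumes [measurable]: "h \<in> borel_measurable borel"
  shows "(LINT v|unif. h v) = (LBINT v:{0..1}. h v)"
proof -
  have eq: "unif = density lborel (\<lambda>v. ennreal (indicator {0<..<1} v))"
    by (simp add: unif_def uniform_measure_def divide_ennreal_def ennreal_indicator)
  have "(LINT v|unif. h v) = (LBINT v. indicator {0<..<1} v * h v)"
    unfolding eq by (subst integral_density) auto
  also have "\<dots> = (LBINT v. indicator {0..1} v *\<^sub>R h v)"
  proof (rule integral_cong_AE)
    show "AE v in lborel. indicator {0<..<1} v * h v = indicator {0..1} v *\<^sub>R h v"
      using AE_lborel_singleton[of 0] AE_lborel_singleton[of 1]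
      by eventually_elim (auto simp: indicator_def)
  qed auto
  finally show ?thesis by (simp add: set_lebesgue_integral_def)
qed

text \<open>The average of \<open>mean_frag\<close> for signed functions; the generator is a
  difference, and derivatives of test functions change sign.\<close>

definition frag_avg :: "(real \<Rightarrow> real) \<Rightarrow> real \<Rightarrow> real" where
  "frag_avg f x = (LINT v|unif. f (x * sqrt v))"

lemma frag_avg_eq:
  assumes "0 < x" and f: "continuous_on UNIV f"
  shows "(LBINT u:{0..x}. 2 * u / x\<^sup>2 * f u) = frag_avg f x"
proof -
  have [measurable]: "f \<in> borel_measurable borel" using f by (rule borel_measurable_continuous_onI)
  \<comment> \<open>The substitution v = (u / x)^2 makes x times the root of v equal to u and
    supplies the weight 2u / x^2.\<close>
  define g where "g u = u\<^sup>2 / x\<^sup>2" for u :: real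
  have g: "g 0 = 0" "g x = 1" using assms(1) by (auto simp: g_def)
  have "(LBINT v. f (x * sqrt v) * indicator {g 0..g x} v)
    = (LBINT u. f (x * sqrt (g u)) * (2 * u / x\<^sup>2) * indicator {0..x} u)"
  proof (rule integral_substitution)
    have "continuous_on {0..1} (\<lambda>v. f (x * sqrt v))"
      by (rule continuous_on_compose2[OF f]) (auto intro!: continuous_intros)
    then show "set_integrable lborel {g 0..g x} (\<lambda>v. f (x * sqrt v))"
      unfolding g by (rule borel_integrable_atLeastAtMost')
    show "(g has_real_derivative 2 * u / x\<^sup>2) (at u)" for u
      unfolding g_def by (rule DERIV_cdivide) (auto intro!: derivative_eq_intros)
  qed (use assms(1) in \<open>auto intro!: continuous_intros\<close>)
  also have "\<dots> = (LBINT u. indicator {0..x} u *\<^sub>R (2 * u / x\<^sup>2 * f u))"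
    using assms(1) by (intro Bochner_Integration.integral_cong)
      (auto simp: g_def indicator_def real_sqrt_divide)
  finally show ?thesis
    unfolding frag_avg_def by (subst integral_unif) (auto simp: set_lebesgue_integral_def g mult.commute)
qed

definition frag_diff :: "(real \<Rightarrow> real) \<Rightarrow> real \<Rightarrow> real" where
  "frag_diff f x = frag_avg f x - f x"

lemma bounded_integrable_unif:
  fixes f :: "real \<Rightarrow> real"
  assumes [measurable]: "f \<in> borel_measurable borel" and "\<And>x. \<bar>f x\<bar> \<le> B"
  shows "integrable unif f"
proof -
  interpret prob_space unif by (rule prob_space_unif)
  show ?thesis by (rule integrable_const_bound[where B=B]) (use assms(2) in auto)
qed

lemma frag_avg_measurable [measurable]:
  assumes [measurable]: "f \<in> borel_measurable borel"
  shows "frag_avg f \<in> borel_measurable borel"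
proof -
  interpret prob_space unif by (rule prob_space_unif)
  show ?thesis unfolding frag_avg_def[abs_def] by measurable
qed

lemma frag_diff_measurable [measurable]:
  assumes [measurable]: "f \<in> borel_measurable borel"
  shows "frag_diff f \<in> borel_measurable borel"
  unfolding frag_diff_def[abs_def] by measurable

lemma frag_avg_bound:
  assumes [measurable]: "f \<in> borel_measurable borel" and B: "\<And>x. \<bar>f x\<bar> \<le> B"
  shows "\<bar>frag_avg f x\<bar> \<le> B"
proof -
  interpret prob_space unif by (rule prob_space_unif)
  have "\<bar>frag_avg f x\<bar> \<le> (LINT v|unif. \<bar>f (x * sqrt v)\<bar>)"
    unfolding frag_avg_def by (rule integral_abs_bound)
  also have "\<dots> \<le> (LINT v|unif. B)"
    using B order_trans[OF abs_ge_zero B] by (intro integral_mono bounded_integrable_unif[where B=B]) auto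
  finally show ?thesis using prob_space by simp
qed

lemma frag_diff_bound:
  assumes "f \<in> borel_measurable borel" and B: "\<And>x. \<bar>f x\<bar> \<le> B"
  shows "\<bar>frag_diff f x\<bar> \<le> 2 * B"
  using frag_avg_bound[OF assms, of x] B[of x] unfolding frag_diff_def by linarith

lemma mean_frag_frag_avg:
  assumes [measurable]: "f \<in> borel_measurable borel" and "\<And>x. 0 \<le> f x" "\<And>x. f x \<le> B"
  shows "mean_frag (\<lambda>y. ennreal (f (y * c))) x = ennreal (frag_avg f (x * c))"
proof -
  have eq: "x * sqrt v * c = x * c * sqrt v" for v by simp
  show ?thesis unfolding mean_frag_def frag_avg_def eq
    by (rule nn_integral_eq_integral) (use assms in \<open>auto intro!: bounded_integrable_unif[where B=B]\<close>)
qed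

text \<open>Carrying the derivative as an argument lets C^2 be said as \<open>test1 f f'\<close>
  together with \<open>test1 f' f''\<close>.\<close>

definition test1 :: "(real \<Rightarrow> real) \<Rightarrow> (real \<Rightarrow> real) \<Rightarrow> bool" where
  "test1 f f' \<longleftrightarrow> (\<forall>x. (f has_real_derivative f' x) (at x)) \<and> continuous_on UNIV f' \<and>
     (\<exists>a b. 0 < a \<and> (\<forall>x. x \<notin> {a..b} \<longrightarrow> f x = 0))"

lemma test1_continuous: "test1 f f' \<Longrightarrow> continuous_on UNIV f"
  unfolding test1_def by (meson DERIV_isCont continuous_at_imp_continuous_on)

lemma compact_support_bounded:
  fixes f :: "real \<Rightarrow> real"
  assumes "continuous_on UNIV f" "\<And>x. x \<notin> {a..b} \<Longrightarrow> f x = 0"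
  shows "\<exists>B\<ge>0. \<forall>x. \<bar>f x\<bar> \<le> B"
proof -
  have "compact (f ` {a..b})"
    by (intro compact_continuous_image continuous_on_subset[OF assms(1)]) auto
  then obtain B where B: "\<And>y. y \<in> f ` {a..b} \<Longrightarrow> norm y \<le> B"
    using compact_imp_bounded bounded_iff by metis
  have "\<bar>f x\<bar> \<le> max 0 B" for x
    using assms(2)[of x] B[of "f x"] by (cases "x \<in> {a..b}") (auto simp: max.coboundedI2)
  then show ?thesis by (intro exI[of _ "max 0 B"]) auto
qed

text \<open>The complement of [a, b] is open, so f is locally constant there and its derivative
  vanishes as well.\<close>

lemma test1_support:
  assumes "test1 f f'"
  shows "\<exists>a b. 0 < a \<and> (\<forall>x. x \<notin> {a..b} \<longrightarrow> f x = 0 \<and> f' x = 0)"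
proof -
  have "\<exists>a b. 0 < a \<and> (\<forall>x. x \<notin> {a..b} \<longrightarrow> f x = 0)"
    using assms by (simp only: test1_def)
  then obtain a b where a: "0 < a" and b: "\<forall>x. x \<notin> {a..b} \<longrightarrow> f x = 0"
    by (elim exE conjE)
  note ab = a b[rule_format]
  have "f' x = 0" if "x \<notin> {a..b}" for x
  proof -
    have "((\<lambda>_. 0) has_real_derivative f' x) (at x)"
    proof (rule DERIV_cong_ev[THEN iffD1, OF refl _ refl])
      show "(f has_real_derivative f' x) (at x)" using assms by (simp add: test1_def)
      have "open (- {a..b})" by auto
      then have "\<forall>\<^sub>F y in nhds x. y \<in> - {a..b}"
        using that by (intro eventually_nhds_in_open) auto
      then show "\<forall>\<^sub>F y in nhds x. f y = 0" by eventually_elim (rule ab(2), simp)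
    qed
    from DERIV_unique[OF this DERIV_const] show ?thesis .
  qed
  then have "\<forall>x. x \<notin> {a..b} \<longrightarrow> f x = 0 \<and> f' x = 0"
    using ab(2) by (intro allI impI conjI)
  then show ?thesis using ab(1) by (intro exI conjI)
qed

lemma test1_Cc1:
  assumes "test1 f f'"
  shows "(\<lambda>x. f (x * exp c)) \<in> Cc1"
proof -
  obtain a b where a: "0 < a" and b: "\<forall>x. x \<notin> {a..b} \<longrightarrow> f x = 0 \<and> f' x = 0"
    using test1_support[OF assms] by (elim exE conjE)
  note ab = a b[rule_format, THEN conjunct1] b[rule_format, THEN conjunct2]
  have f': "continuous_on UNIV f'" and d: "(f has_real_derivative f' x) (at x)" for x
    using assms by (auto simp: test1_def)
  have "(\<lambda>x. f (x * exp c)) C1_differentiable_on {0<..}"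
    unfolding C1_differentiable_on_def
  proof (intro exI conjI ballI)
    fix x :: real
    have "((\<lambda>x. f (x * exp c)) has_real_derivative f' (x * exp c) * exp c) (at x)"
      by (rule DERIV_chain2[OF d]) (auto intro!: derivative_eq_intros)
    then show "((\<lambda>x. f (x * exp c)) has_vector_derivative f' (x * exp c) * exp c) (at x)"
      by (simp add: has_real_derivative_iff_has_vector_derivative)
    show "continuous_on {0<..} (\<lambda>x. f' (x * exp c) * exp c)"
      by (intro continuous_intros continuous_on_compose2[OF f']) auto
  qed
  moreover have "\<exists>K. compact K \<and> K \<subseteq> {0<..} \<and> (\<forall>x. x \<notin> K \<longrightarrow> f (x * exp c) = 0)"
  proof (intro exI[of _ "{a * exp (- c)..b * exp (- c)}"] conjI allI impI)
    show "{a * exp (- c)..b * exp (- c)} \<subseteq> {0<..}"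
      using ab(1) by (auto intro: less_le_trans[of 0 "a * exp (- c)"])
    fix x assume "x \<notin> {a * exp (- c)..b * exp (- c)}"
    then have "x * exp c \<notin> {a..b}"
      by (auto simp: exp_minus field_simps)
    then show "f (x * exp c) = 0" by (rule ab(2))
  qed auto
  ultimately show ?thesis by (auto simp: Cc1_def)
qed

text \<open>x f'(x) is the derivative of f(x e^c) in c at c = 0. It commutes with the flow, so it
  gives the derivative at every c.\<close>

definition euler :: "(real \<Rightarrow> real) \<Rightarrow> real \<Rightarrow> real" where
  "euler f' x = x * f' x"

lemma euler_props:
  assumes "test1 f f'"
  shows "continuous_on UNIV (euler f')" "\<exists>B\<ge>0. \<forall>x. \<bar>euler f' x\<bar> \<le> B"
proof -
  obtain a b where a: "0 < a" and b: "\<forall>x. x \<notin> {a..b} \<longrightarrow> f x = 0 \<and> f' x = 0"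
    using test1_support[OF assms] by (elim exE conjE)
  note ab = a b[rule_format, THEN conjunct1] b[rule_format, THEN conjunct2]
  show c: "continuous_on UNIV (euler f')"
    using assms unfolding euler_def[abs_def] test1_def by (auto intro!: continuous_intros)
  show "\<exists>B\<ge>0. \<forall>x. \<bar>euler f' x\<bar> \<le> B"
    by (rule compact_support_bounded[OF c, of a b]) (simp add: euler_def ab(3))
qed

lemma test1_bounded:
  assumes "test1 f f'"
  shows "\<exists>B\<ge>0. \<forall>x. \<bar>f x\<bar> \<le> B"
proof -
  obtain a b where a: "0 < a" and b: "\<forall>x. x \<notin> {a..b} \<longrightarrow> f x = 0 \<and> f' x = 0"
    using test1_support[OF assms] by (elim exE conjE)
  note ab = a b[rule_format, THEN conjunct1] b[rule_format, THEN conjunct2]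
  show ?thesis by (rule compact_support_bounded[OF test1_continuous[OF assms], of a b]) (rule ab(2))
qed

lemma bounded_set_integrable:
  fixes g :: "real \<Rightarrow> real"
  assumes [measurable]: "g \<in> borel_measurable borel" and "\<And>x. \<bar>g x\<bar> \<le> B"
  shows "set_integrable lborel {a..b} g"
  unfolding set_integrable_def
proof (rule integrableI_bounded_set_indicator[where B=B])
  show "emeasure lborel {a..b} < \<infinity>" by (cases "a \<le> b") auto
qed (use assms(2) in auto)

lemma flow_FTC:
  assumes "test1 f f'" "0 \<le> c"
  shows "f (x * exp c) - f x = (LBINT c':{0..c}. euler f' (x * exp c'))"
proof -
  have d: "(f has_real_derivative f' x) (at x)" for x using assms by (simp add: test1_def)
  have "(\<integral>c'. euler f' (x * exp c') * indicator {0..c} c' \<partial>lborel) = f (x * exp c) - f (x * exp 0)"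
  proof (rule integral_FTC_Icc_real)
    fix c'
    have "((\<lambda>c. f (x * exp c)) has_real_derivative f' (x * exp c') * (x * exp c')) (at c')"
      by (rule DERIV_chain2[OF d]) (auto intro!: derivative_eq_intros)
    then show "((\<lambda>c. f (x * exp c)) has_real_derivative euler f' (x * exp c')) (at c')"
      by (simp add: euler_def mult.commute)
    have "continuous_on UNIV (\<lambda>c. euler f' (x * exp c))"
      by (intro continuous_on_compose2[OF euler_props(1)[OF assms(1)]] continuous_intros) auto
    then show "isCont (\<lambda>c. euler f' (x * exp c)) c'"
      by (simp add: continuous_on_eq_continuous_at)
  qed fact
  then show ?thesis by (simp add: set_lebesgue_integral_def mult.commute)
qed

text \<open>Averaging over the jump factor commutes with dilations, so the derivative along the flow
  passes through it.\<close>

lemma flow_FTC_frag: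
  assumes t: "test1 f f'" and c: "0 \<le> c"
  shows "frag_diff f (x * exp c) - frag_diff f x = (LBINT c':{0..c}. frag_diff (euler f') (x * exp c'))"
proof -
  interpret prob_space unif by (rule prob_space_unif)
  interpret pair: pair_sigma_finite unif "lborel :: real measure" ..
  have [measurable]: "f \<in> borel_measurable borel" "euler f' \<in> borel_measurable borel"
    using test1_continuous[OF t] euler_props(1)[OF t] by (auto intro: borel_measurable_continuous_onI)
  obtain B where B: "\<And>x. \<bar>f x\<bar> \<le> B" using test1_bounded[OF t] by blast
  obtain D where D: "0 \<le> D" "\<And>x. \<bar>euler f' x\<bar> \<le> D" using euler_props(2)[OF t] by blast
  let ?h = "\<lambda>(v, c'). indicator {0..c} c' *\<^sub>R euler f' (x * exp c' * sqrt v)"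
  have "frag_avg f (x * exp c) - frag_avg f x = (LINT v|unif. f (x * sqrt v * exp c) - f (x * sqrt v))"
    unfolding frag_avg_def
    by (subst Bochner_Integration.integral_diff[symmetric])
       (auto intro!: bounded_integrable_unif[OF _ B] Bochner_Integration.integral_cong simp: ac_simps)
  also have "\<dots> = (LINT v|unif. (LBINT c'. indicator {0..c} c' *\<^sub>R euler f' (x * exp c' * sqrt v)))"
    by (subst flow_FTC[OF t c]) (simp add: set_lebesgue_integral_def ac_simps)
  also have "\<dots> = (LBINT c'. (LINT v|unif. indicator {0..c} c' *\<^sub>R euler f' (x * exp c' * sqrt v)))"
  proof (rule pair.Fubini_integral[symmetric])
    show "integrable (unif \<Otimes>\<^sub>M lborel) ?h"
    proof (rule integrableI_bounded)
      have "(\<integral>\<^sup>+w. ennreal (norm (?h w)) \<partial>(unif \<Otimes>\<^sub>M lborel))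
        \<le> (\<integral>\<^sup>+w. ennreal D * indicator (UNIV \<times> {0..c}) w \<partial>(unif \<Otimes>\<^sub>M lborel))"
        using D by (intro nn_integral_mono) (auto simp: indicator_def)
      also have "\<dots> = ennreal D * emeasure (unif \<Otimes>\<^sub>M lborel) (UNIV \<times> {0..c})"
        by (subst nn_integral_cmult) auto
      also have "\<dots> < \<infinity>"
        using emeasure_space_1 c by (subst lborel.emeasure_pair_measure_Times) (auto simp: ennreal_mult_less_top)
      finally show "(\<integral>\<^sup>+w. ennreal (norm (?h w)) \<partial>(unif \<Otimes>\<^sub>M lborel)) < \<infinity>" .
    qed measurable
  qed
  also have "\<dots> = (LBINT c':{0..c}. frag_avg (euler f') (x * exp c'))"
    by (simp add: set_lebesgue_integral_def frag_avg_def)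
  finally have avg: "frag_avg f (x * exp c) - frag_avg f x = (LBINT c':{0..c}. frag_avg (euler f') (x * exp c'))" .
  have "(LBINT c':{0..c}. frag_diff (euler f') (x * exp c'))
    = (LBINT c':{0..c}. frag_avg (euler f') (x * exp c')) - (LBINT c':{0..c}. euler f' (x * exp c'))"
    unfolding frag_diff_def
    by (intro set_integral_diff(2) bounded_set_integrable[of _ D] frag_avg_bound D(2)) auto
  then show ?thesis using avg flow_FTC[OF t c, of x] by (simp add: frag_diff_def)
qed

text \<open>Fubini on the triangle s + c \<le> t; a bounded function is integrable on this bounded
  region.\<close>

lemma triangle_integral:
  fixes t :: real
  assumes [measurable]: "(\<lambda>(s, c). d s c) \<in> borel_measurable (borel \<Otimes>\<^sub>M borel)"
    and D: "\<And>s c. \<bar>d s c :: real\<bar> \<le> D"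
  shows "(LBINT s:{0..t}. (LBINT c:{0..t - s}. d s c)) = (LBINT c:{0..t}. (LBINT s:{0..t - c}. d s c))"
proof -
  define g where "g s c = (if 0 \<le> s \<and> 0 \<le> c \<and> s + c \<le> t then d s c else 0)" for s c
  have [measurable]: "(\<lambda>(s, c). g s c) \<in> borel_measurable (borel \<Otimes>\<^sub>M borel)"
    unfolding g_def by measurable
  have "integrable (lborel \<Otimes>\<^sub>M lborel) (\<lambda>(s, c). g s c)"
  proof (rule integrableI_bounded)
    have "0 \<le> D" using D[of 0 0] by linarith
    then have "(\<integral>\<^sup>+w. ennreal (norm (case w of (s, c) \<Rightarrow> g s c)) \<partial>(lborel \<Otimes>\<^sub>M lborel))
      \<le> (\<integral>\<^sup>+w. ennreal D * indicator ({0..t} \<times> {0..t}) w \<partial>(lborel \<Otimes>\<^sub>M lborel))"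
      using D by (intro nn_integral_mono) (auto simp: indicator_def g_def split: if_splits)
    also have "\<dots> = ennreal D * emeasure (lborel \<Otimes>\<^sub>M lborel) ({0..t} \<times> {0..t})"
      by (subst nn_integral_cmult) auto
    also have "\<dots> < \<infinity>"
      by (subst lborel.emeasure_pair_measure_Times) (cases "0 \<le> t"; auto simp: ennreal_mult_less_top)+
    finally show "(\<integral>\<^sup>+w. ennreal (norm (case w of (s, c) \<Rightarrow> g s c)) \<partial>(lborel \<Otimes>\<^sub>M lborel)) < \<infinity>" .
  qed measurable
  then have "(LBINT s. (LBINT c. g s c)) = (LBINT c. (LBINT s. g s c))"
    by (rule lborel_pair.Fubini_integral[symmetric])
  moreover have "(LBINT s. (LBINT c. g s c)) = (LBINT s:{0..t}. (LBINT c:{0..t - s}. d s c))"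
    unfolding set_lebesgue_integral_def
  proof (rule Bochner_Integration.integral_cong[OF refl])
    fix s
    have "g s c = indicator {0..t} s *\<^sub>R (indicator {0..t - s} c *\<^sub>R d s c)" for c
      by (auto simp: g_def indicator_def)
    then show "(LBINT c. g s c) = indicator {0..t} s *\<^sub>R (LBINT c. indicator {0..t - s} c *\<^sub>R d s c)"
      by simp
  qed
  moreover have "(LBINT c. (LBINT s. g s c)) = (LBINT c:{0..t}. (LBINT s:{0..t - c}. d s c))"
    unfolding set_lebesgue_integral_def
  proof (rule Bochner_Integration.integral_cong[OF refl])
    fix c
    have "g s c = indicator {0..t} c *\<^sub>R (indicator {0..t - c} s *\<^sub>R d s c)" for s
      by (auto simp: g_def indicator_def)
    then show "(LBINT s. g s c) = indicator {0..t} c *\<^sub>R (LBINT s. indicator {0..t - c} s *\<^sub>R d s c)"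
      by simp
  qed
  ultimately show ?thesis by simp
qed

lemma test1_euler:
  assumes "test1 f f'" "test1 f' f''"
  shows "test1 (euler f') (\<lambda>x. f' x + x * f'' x)"
proof -
  obtain a b where a: "0 < a" and b: "\<forall>x. x \<notin> {a..b} \<longrightarrow> f x = 0 \<and> f' x = 0"
    using test1_support[OF assms(1)] by (elim exE conjE)
  have d: "(f' has_real_derivative f'' x) (at x)" for x
    using assms(2) by (simp add: test1_def)
  have "continuous_on UNIV (\<lambda>x. f' x + x * f'' x)"
    using assms unfolding test1_def by (intro continuous_intros) auto
  moreover have "(euler f' has_real_derivative f' x + x * f'' x) (at x)" for x
    unfolding euler_def[abs_def] by (auto intro!: derivative_eq_intros d)
  moreover have "\<forall>x. x \<notin> {a..b} \<longrightarrow> euler f' x = 0"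
    using b by (simp add: euler_def)
  ultimately show ?thesis using a unfolding test1_def by blast
qed

text \<open>Dilations commute with \<open>euler\<close> and with the jump average but not with the
  rate, which remains at x. Hence the mixture of shifted and unshifted arguments in
  \<open>wint\<close>.\<close>

lemma generator_test1:
  assumes t: "test1 f f'" and x: "0 < x"
  shows "generator R (\<lambda>x. f (x * exp c)) x = euler f' (x * exp c) + x * R x * frag_diff f (x * exp c)"
proof -
  have d: "(f has_real_derivative f' x) (at x)" for x using t by (simp add: test1_def)
  have "((\<lambda>x. f (x * exp c)) has_real_derivative f' (x * exp c) * exp c) (at x)"
    by (rule DERIV_chain2[OF d]) (auto intro!: derivative_eq_intros)
  then have "deriv (\<lambda>x. f (x * exp c)) x = f' (x * exp c) * exp c" by (rule DERIV_imp_deriv)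
  moreover have "continuous_on UNIV (\<lambda>x. f (x * exp c))"
    by (rule continuous_on_compose2[OF test1_continuous[OF t]]) (auto intro!: continuous_intros)
  then have "(LBINT u:{0..x}. 2 * u / x\<^sup>2 * f (u * exp c)) = frag_avg (\<lambda>x. f (x * exp c)) x"
    by (rule frag_avg_eq[OF x])
  moreover have "frag_avg (\<lambda>x. f (x * exp c)) x = frag_avg f (x * exp c)"
    by (simp add: frag_avg_def mult_ac)
  ultimately show ?thesis by (simp add: generator_def euler_def frag_diff_def mult_ac)
qed

section \<open>Integrals of shifted test functions against the family\<close>

context rate_kernel
begin

lemma k_integrable: "integrable (m s) k" "(LINT x|m s. k x) \<le> enn2real C"
proof -
  show int: "integrable (m s) k"
    using rate_bound[of s] C_finite k_nonneg by (intro integrableI_bounded) (auto simp: top_unique)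
  have "ennreal (LINT x|m s. k x) \<le> C"
    using rate_bound[of s] nn_integral_eq_integral[OF int] k_nonneg by simp
  then show "(LINT x|m s. k x) \<le> enn2real C"
    using C_finite by (cases C) (auto simp: ennreal_le_iff)
qed

text \<open>Physical time s and flow time c are kept as separate variables: \<open>wint_FTC\<close>
  differentiates in c, \<open>weak_wint\<close> in s.\<close>

definition wint :: "(real \<Rightarrow> real) \<Rightarrow> (real \<Rightarrow> real) \<Rightarrow> real \<Rightarrow> real \<Rightarrow> real" where
  "wint f g s c = (LINT x|m s. f (x * exp c) + k x * g (x * exp c))"

definition bmeas :: "(real \<Rightarrow> real) \<Rightarrow> bool" where
  "bmeas f \<longleftrightarrow> f \<in> borel_measurable borel \<and> (\<exists>B\<ge>0. \<forall>x. \<bar>f x\<bar> \<le> B)"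

lemma bmeas_measurable: "bmeas f \<Longrightarrow> f \<in> borel_measurable borel"
  by (simp add: bmeas_def)

lemma bmeas_zero: "bmeas (\<lambda>_. 0)"
  by (auto simp: bmeas_def)

lemma wint_integrable:
  assumes "bmeas f" "bmeas g"
  shows "integrable (m s) (\<lambda>x. f (x * exp c))" "integrable (m s) (\<lambda>x. k x * g (x * exp c))"
proof -
  interpret prob_space "m s" by (rule m_prob)
  obtain B where B: "\<And>x. \<bar>f x\<bar> \<le> B" using assms by (auto simp: bmeas_def)
  obtain D where D: "0 \<le> D" "\<And>x. \<bar>g x\<bar> \<le> D" using assms by (auto simp: bmeas_def)
  have [measurable]: "f \<in> borel_measurable borel" "g \<in> borel_measurable borel"
    using assms by (auto simp: bmeas_def)
  show "integrable (m s) (\<lambda>x. f (x * exp c))"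
    by (rule integrable_const_bound[where B=B]) (use B in auto)
  show "integrable (m s) (\<lambda>x. k x * g (x * exp c))"
  proof (rule Bochner_Integration.integrable_bound[of _ "\<lambda>x. k x * D"])
    show "integrable (m s) (\<lambda>x. k x * D)" using k_integrable(1) by simp
    show "AE x in m s. norm (k x * g (x * exp c)) \<le> norm (k x * D)"
      using D by (auto simp: abs_mult intro!: mult_left_mono)
  qed measurable
qed

lemma wint_bound:
  assumes "bmeas f" "bmeas g"
  shows "\<exists>B. \<forall>s c. \<bar>wint f g s c\<bar> \<le> B"
proof -
  obtain B where B: "\<And>x. \<bar>f x\<bar> \<le> B" using assms by (auto simp: bmeas_def)
  obtain D where D: "0 \<le> D" "\<And>x. \<bar>g x\<bar> \<le> D" using assms by (auto simp: bmeas_def)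
  have "\<bar>wint f g s c\<bar> \<le> B + enn2real C * D" for s c
  proof -
    interpret prob_space "m s" by (rule m_prob)
    have "\<bar>wint f g s c\<bar> \<le> (LINT x|m s. \<bar>f (x * exp c) + k x * g (x * exp c)\<bar>)"
      unfolding wint_def by (rule integral_abs_bound)
    also have "\<dots> \<le> (LINT x|m s. B + k x * D)"
    proof (rule integral_mono)
      show "integrable (m s) (\<lambda>x. \<bar>f (x * exp c) + k x * g (x * exp c)\<bar>)"
        by (intro integrable_abs Bochner_Integration.integrable_add wint_integrable[OF assms])
      show "integrable (m s) (\<lambda>x. B + k x * D)"
        using k_integrable(1) by auto
      fix x
      have "\<bar>k x * g (x * exp c)\<bar> \<le> k x * D"
        using D k_nonneg by (auto simp: abs_mult intro!: mult_left_mono)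
      then show "\<bar>f (x * exp c) + k x * g (x * exp c)\<bar> \<le> B + k x * D"
        using B[of "x * exp c"] by linarith
    qed
    also have "\<dots> = B + (LINT x|m s. k x) * D"
      using k_integrable(1)[of s] prob_space by (simp add: Bochner_Integration.integral_add)
    also have "\<dots> \<le> B + enn2real C * D"
      using k_integrable(2) D(1) by (intro add_left_mono mult_right_mono) auto
    finally show ?thesis .
  qed
  then show ?thesis by blast
qed

lemma wint_measurable:
  assumes "bmeas f" "bmeas g"
  shows "(\<lambda>(s, c). wint f g s c) \<in> borel_measurable (borel \<Otimes>\<^sub>M borel)"
proof -
  have [measurable]: "f \<in> borel_measurable borel" "g \<in> borel_measurable borel"
    using assms by (auto simp: bmeas_def)
  have eq: "wint f g s c = enn2real (\<integral>\<^sup>+x. ennreal (f (x * exp c) + k x * g (x * exp c)) \<partial>m s)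
      - enn2real (\<integral>\<^sup>+x. ennreal (- (f (x * exp c) + k x * g (x * exp c))) \<partial>m s)" for s c
    unfolding wint_def
    by (rule real_lebesgue_integral_def) (intro Bochner_Integration.integrable_add wint_integrable[OF assms])
  have "(\<lambda>w. \<integral>\<^sup>+x. ennreal (f (x * exp (snd w)) + k x * g (x * exp (snd w))) \<partial>m (fst w)) \<in> borel_measurable (borel \<Otimes>\<^sub>M borel)"
    "(\<lambda>w. \<integral>\<^sup>+x. ennreal (- (f (x * exp (snd w)) + k x * g (x * exp (snd w)))) \<partial>m (fst w)) \<in> borel_measurable (borel \<Otimes>\<^sub>M borel)"
    by (rule m_integral_measurable; measurable)+
  then show ?thesis unfolding eq split_beta' by measurable
qed

lemma wint_split:
  assumes "bmeas f" "bmeas g"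
  shows "wint f g s c = wint f (\<lambda>_. 0) s c + wint (\<lambda>_. 0) g s c"
  unfolding wint_def using wint_integrable[OF assms] by simp

text \<open>The derivative in c acts on f and g under the integral; the factor \<open>k\<close> is
  not moved by the flow. Fubini applies because the mean rate is finite.\<close>

lemma wint_FTC:
  assumes bm: "bmeas f" "bmeas g" "bmeas f1" "bmeas g1"
    and f: "\<And>x. f (x * exp c) - f x = (LBINT c':{0..c}. f1 (x * exp c'))"
    and g: "\<And>x. g (x * exp c) - g x = (LBINT c':{0..c}. g1 (x * exp c'))"
  shows "wint f g s c - wint f g s 0 = (LBINT c':{0..c}. wint f1 g1 s c')"
proof -
  interpret prob_space "m s" by (rule m_prob)
  interpret pair: pair_sigma_finite "m s" "lborel :: real measure" ..
  have [measurable]: "f1 \<in> borel_measurable borel" "g1 \<in> borel_measurable borel"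
    using bm by (auto simp: bmeas_def)
  obtain B where B: "0 \<le> B" "\<And>x. \<bar>f1 x\<bar> \<le> B" using bm(3) by (auto simp: bmeas_def)
  obtain D where D: "0 \<le> D" "\<And>x. \<bar>g1 x\<bar> \<le> D" using bm(4) by (auto simp: bmeas_def)
  let ?h = "\<lambda>(x, c'). indicator {0..c} c' *\<^sub>R (f1 (x * exp c') + k x * g1 (x * exp c'))"
  have si: "set_integrable lborel {0..c} (\<lambda>c'. f1 (x * exp c'))" "set_integrable lborel {0..c} (\<lambda>c'. k x * g1 (x * exp c'))" for x
  proof -
    show "set_integrable lborel {0..c} (\<lambda>c'. f1 (x * exp c'))"
      by (rule bounded_set_integrable[of _ B]) (use B in auto)
    have "set_integrable lborel {0..c} (\<lambda>c'. g1 (x * exp c'))"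
      by (rule bounded_set_integrable[of _ D]) (use D in auto)
    then show "set_integrable lborel {0..c} (\<lambda>c'. k x * g1 (x * exp c'))" by simp
  qed
  have "wint f g s c - wint f g s 0
    = (LINT x|m s. (f (x * exp c) - f x) + k x * (g (x * exp c) - g x))"
    unfolding wint_def
    using wint_integrable[OF bm(1,2), of s c] wint_integrable[OF bm(1,2), of s 0]
    by (subst Bochner_Integration.integral_diff[symmetric]) (auto simp: algebra_simps)
  also have "\<dots> = (LINT x|m s. (LBINT c'. indicator {0..c} c' *\<^sub>R (f1 (x * exp c') + k x * g1 (x * exp c'))))"
    unfolding f g using set_integral_add(2)[OF si] by (simp add: set_lebesgue_integral_def)
  also have "\<dots> = (LBINT c'. (LINT x|m s. indicator {0..c} c' *\<^sub>R (f1 (x * exp c') + k x * g1 (x * exp c'))))"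
  proof (rule pair.Fubini_integral[symmetric])
    show "integrable (m s \<Otimes>\<^sub>M lborel) ?h"
    proof (rule integrableI_bounded)
      have bnd: "\<bar>f1 (x * exp c') + k x * g1 (x * exp c')\<bar> \<le> B + k x * D" for x c'
      proof -
        have "\<bar>k x * g1 (x * exp c')\<bar> \<le> k x * D"
          using D k_nonneg by (auto simp: abs_mult intro!: mult_left_mono)
        then show ?thesis using B(2)[of "x * exp c'"] by linarith
      qed
      have "(\<integral>\<^sup>+w. ennreal (norm (?h w)) \<partial>(m s \<Otimes>\<^sub>M lborel))
        = (\<integral>\<^sup>+x. \<integral>\<^sup>+c'. ennreal (norm (indicator {0..c} c' *\<^sub>R (f1 (x * exp c') + k x * g1 (x * exp c')))) \<partial>lborel \<partial>m s)"
        by (subst lborel.nn_integral_fst[symmetric]) auto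
      also have "\<dots> \<le> (\<integral>\<^sup>+x. \<integral>\<^sup>+c'. ennreal (B + k x * D) * indicator {0..c} c' \<partial>lborel \<partial>m s)"
        using bnd by (intro nn_integral_mono) (auto simp: indicator_def intro!: ennreal_leI)
      also have "\<dots> = (\<integral>\<^sup>+x. ennreal (B + k x * D) * emeasure lborel {0..c} \<partial>m s)"
        by (simp add: nn_integral_cmult)
      also have "\<dots> = (\<integral>\<^sup>+x. ennreal (B + k x * D) \<partial>m s) * emeasure lborel {0..c}"
        by (rule nn_integral_multc) measurable
      also have "\<dots> = ennreal (LINT x|m s. B + k x * D) * emeasure lborel {0..c}"
        using k_integrable(1)[of s] B(1) D(1) k_nonneg by (subst nn_integral_eq_integral) auto
      also have "\<dots> < \<infinity>" by (cases "0 \<le> c") (auto simp: ennreal_mult_less_top)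
      finally show "(\<integral>\<^sup>+w. ennreal (norm (?h w)) \<partial>(m s \<Otimes>\<^sub>M lborel)) < \<infinity>" .
    qed measurable
  qed
  also have "\<dots> = (LBINT c':{0..c}. wint f1 g1 s c')"
    by (simp add: wint_def set_lebesgue_integral_def)
  finally show ?thesis .
qed

lemma bmeas_test1:
  assumes "test1 f f'"
  shows "bmeas f" "bmeas (euler f')" "bmeas (frag_avg f)" "bmeas (frag_diff f)" "bmeas (frag_diff (euler f'))"
proof -
  have f: "f \<in> borel_measurable borel" "euler f' \<in> borel_measurable borel"
    using test1_continuous[OF assms] euler_props(1)[OF assms] by (auto intro: borel_measurable_continuous_onI)
  obtain B where B: "0 \<le> B" "\<And>x. \<bar>f x\<bar> \<le> B" using test1_bounded[OF assms] by blast
  obtain D where D: "0 \<le> D" "\<And>x. \<bar>euler f' x\<bar> \<le> D" using euler_props(2)[OF assms] by blast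
  show "bmeas f" "bmeas (euler f')" using f B D by (auto simp: bmeas_def)
  show "bmeas (frag_avg f)"
    unfolding bmeas_def using f B(1) frag_avg_bound[OF f(1) B(2)] by auto
  have "0 \<le> 2 * B" "0 \<le> 2 * D" using B D by auto
  then show "bmeas (frag_diff f)" "bmeas (frag_diff (euler f'))"
    unfolding bmeas_def using f frag_diff_bound[OF f(1) B(2)] frag_diff_bound[OF f(2) D(2)]
    by (blast intro: frag_diff_measurable)+
qed

end

section \<open>The weak equation along the flow\<close>

locale weak_solution = rate_kernel +
  assumes weak: "\<And>f t. f \<in> Cc1 \<Longrightarrow> 0 \<le> t \<Longrightarrow>
    pairing (m t) f - pairing (m 0) f = (LBINT s:{0..t}. pairing (m s) (generator R f))"
begin

lemma pairing_eq:
  assumes "\<And>x. 0 < x \<Longrightarrow> f x = g x"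
  shows "pairing (m s) f = (LINT x|m s. indicator {0<..} x *\<^sub>R g x)"
  unfolding pairing_def set_lebesgue_integral_def
  by (rule Bochner_Integration.integral_cong) (auto simp: indicator_def assms)

lemma pairing_wint:
  assumes "bmeas f" "bmeas g" "\<And>x. 0 < x \<Longrightarrow> h x = f (x * exp c) + k x * g (x * exp c)"
  shows "pairing (m s) h = wint f g s c"
proof -
  have [measurable]: "f \<in> borel_measurable borel" "g \<in> borel_measurable borel"
    using assms by (auto simp: bmeas_def)
  have "pairing (m s) h = (LINT x|m s. indicator {0<..} x *\<^sub>R (f (x * exp c) + k x * g (x * exp c)))"
    by (rule pairing_eq) (rule assms(3))
  also have "\<dots> = wint f g s c"
    unfolding wint_def
    by (rule integral_cong_AE) (use m_pos[of s] in \<open>auto elim!: eventually_mono\<close>)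
  finally show ?thesis .
qed

text \<open>For fixed c the function f(x e^c) is itself in \<open>Cc1\<close>, so the weak equation
  applies to it.\<close>

lemma weak_wint:
  assumes t1: "test1 f f'" and t: "0 \<le> t"
  shows "wint f (\<lambda>_. 0) t c - wint f (\<lambda>_. 0) 0 c = (LBINT s:{0..t}. wint (euler f') (frag_diff f) s c)"
proof -
  have "pairing (m s) (\<lambda>x. f (x * exp c)) = wint f (\<lambda>_. 0) s c" for s
    by (rule pairing_wint) (auto intro: bmeas_test1[OF t1] bmeas_zero)
  moreover have "pairing (m s) (generator R (\<lambda>x. f (x * exp c))) = wint (euler f') (frag_diff f) s c" for s
    by (rule pairing_wint) (auto intro: bmeas_test1[OF t1] simp: generator_test1[OF t1] k_def)
  ultimately show ?thesis using weak[OF test1_Cc1[OF t1, of c] t] by simp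
qed

text \<open>The test function \<open>f (x * exp (t - s))\<close> moves with the flow, so that the drift disappears. Moving it
  is justified by applying the weak equation to \<open>f\<close> and to its Euler derivative along fixed times: both
  double integrals that appear run over the triangle \<open>s + c \<le> t\<close> and cancel.\<close>

lemma transport_test_real:
  assumes t1: "test1 f f'" and t2: "test1 f' f''" and t: "0 \<le> t"
  shows "wint f (\<lambda>_. 0) t 0 - wint f (\<lambda>_. 0) 0 t = (LBINT s:{0..t}. wint (\<lambda>_. 0) (frag_diff f) s (t - s))"
proof -
  define p where "p = euler f'"
  \<comment> \<open>\<open>d\<close> is the mixed derivative. It arises in two ways, as the
    derivative in c of the generator term for f (\<open>rect\<close>) and as the generator term for
    p (\<open>time\<close>); this is why the two double integrals coincide.\<close>
  define d where "d = wint (euler (\<lambda>x. f' x + x * f'' x)) (frag_diff p)"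
  have tp: "test1 p (\<lambda>x. f' x + x * f'' x)"
    unfolding p_def by (rule test1_euler[OF t1 t2])
  note bf = bmeas_test1[OF t1, folded p_def] and bp = bmeas_test1[OF tp]
  have rect: "wint p (frag_diff f) s c - wint p (frag_diff f) s 0 = (LBINT c':{0..c}. d s c')" if "0 \<le> c" for s c
    unfolding d_def
    by (rule wint_FTC) (auto intro: bf bp flow_FTC[OF tp that] flow_FTC_frag[OF t1 that, folded p_def])
  have time: "wint p (\<lambda>_. 0) a c - wint p (\<lambda>_. 0) 0 c = (LBINT s:{0..a}. d s c)" if "0 \<le> a" for a c
    unfolding d_def by (rule weak_wint[OF tp that])
  have init: "wint f (\<lambda>_. 0) 0 t - wint f (\<lambda>_. 0) 0 0 = (LBINT c:{0..t}. wint p (\<lambda>_. 0) 0 c)"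
    by (rule wint_FTC) (auto intro: bf bp bmeas_zero simp: flow_FTC[OF t1 t, folded p_def] set_lebesgue_integral_def)
  obtain Dd where Dd: "\<And>s c. \<bar>d s c\<bar> \<le> Dd" using wint_bound[OF bp(2,4)] unfolding d_def by blast
  have d_meas [measurable]: "(\<lambda>(s, c). d s c) \<in> borel_measurable (borel \<Otimes>\<^sub>M borel)"
    unfolding d_def by (rule wint_measurable[OF bp(2,4)])
  have si: "set_integrable lborel {0..t} (\<lambda>s. wint u v (S s) (T s))"
    if uv: "bmeas u" "bmeas v" and [measurable]: "S \<in> borel_measurable borel" "T \<in> borel_measurable borel" for u v S T
  proof -
    obtain B where "\<And>s c. \<bar>wint u v s c\<bar> \<le> B" using wint_bound[OF uv] by blast
    moreover note wint_measurable[OF uv, measurable]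
    have "(\<lambda>s. wint u v (S s) (T s)) \<in> borel_measurable borel" by measurable
    ultimately show ?thesis by (intro bounded_set_integrable) auto
  qed
  have siE: "set_integrable lborel {0..t} (\<lambda>s. wint p (frag_diff f) s (t - s))"
    "set_integrable lborel {0..t} (\<lambda>s. wint p (frag_diff f) s 0)"
    by (rule si; use bf in simp)+
  have siB: "set_integrable lborel {0..t} (\<lambda>c. wint p (\<lambda>_. 0) (t - c) c)"
    "set_integrable lborel {0..t} (\<lambda>c. wint p (\<lambda>_. 0) 0 c)"
    "set_integrable lborel {0..t} (\<lambda>s. wint p (\<lambda>_. 0) s (t - s))"
    "set_integrable lborel {0..t} (\<lambda>s. wint (\<lambda>_. 0) (frag_diff f) s (t - s))"
    by (rule si; use bf bmeas_zero in simp)+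
  have "wint f (\<lambda>_. 0) t 0 - wint f (\<lambda>_. 0) 0 0 = (LBINT s:{0..t}. wint p (frag_diff f) s 0)"
    unfolding p_def by (rule weak_wint[OF t1 t])
  also have "\<dots> = (LBINT s:{0..t}. wint p (frag_diff f) s (t - s)) - (LBINT s:{0..t}. (LBINT c:{0..t - s}. d s c))"
  proof -
    have "(LBINT s:{0..t}. (LBINT c:{0..t - s}. d s c))
      = (LBINT s:{0..t}. wint p (frag_diff f) s (t - s) - wint p (frag_diff f) s 0)"
      by (rule set_lebesgue_integral_cong) (auto simp: rect)
    then show ?thesis using set_integral_diff(2)[OF siE] by simp
  qed
  finally have 1: "wint f (\<lambda>_. 0) t 0 - wint f (\<lambda>_. 0) 0 0
    = (LBINT s:{0..t}. wint p (frag_diff f) s (t - s)) - (LBINT s:{0..t}. (LBINT c:{0..t - s}. d s c))" .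
  have 2: "(LBINT c:{0..t}. wint p (\<lambda>_. 0) 0 c)
    = (LBINT c:{0..t}. wint p (\<lambda>_. 0) (t - c) c) - (LBINT c:{0..t}. (LBINT s:{0..t - c}. d s c))"
  proof -
    have "(LBINT c:{0..t}. (LBINT s:{0..t - c}. d s c))
      = (LBINT c:{0..t}. wint p (\<lambda>_. 0) (t - c) c - wint p (\<lambda>_. 0) 0 c)"
      by (rule set_lebesgue_integral_cong) (auto simp: time)
    then show ?thesis using set_integral_diff(2)[OF siB(1,2)] by simp
  qed
  have 3: "(LBINT c:{0..t}. wint p (\<lambda>_. 0) (t - c) c) = (LBINT s:{0..t}. wint p (\<lambda>_. 0) s (t - s))"
    unfolding set_lebesgue_integral_def
    by (subst lborel_integral_real_affine[where c="-1" and t=t])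
       (auto intro!: Bochner_Integration.integral_cong simp: indicator_def)
  have 4: "(LBINT s:{0..t}. wint p (frag_diff f) s (t - s))
    = (LBINT s:{0..t}. wint p (\<lambda>_. 0) s (t - s)) + (LBINT s:{0..t}. wint (\<lambda>_. 0) (frag_diff f) s (t - s))"
    using set_integral_add(2)[OF siB(3,4)] by (simp add: wint_split[OF bf(2,4)])
  show ?thesis using 1 2 3 4 init triangle_integral[OF d_meas Dd, of t] by simp
qed

text \<open>Writing \<open>frag_diff\<close> as average minus value and moving the value to the left
  leaves only nonnegative terms, so the real identity passes to [0,\<infinity>].\<close>

lemma transport_test:
  assumes t1: "test1 f f'" and t2: "test1 f' f''" and t: "0 \<le> t" and nn: "\<And>x. 0 \<le> f x"
  shows "(\<integral>\<^sup>+x. ennreal (f x) \<partial>m t)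
      + (\<integral>\<^sup>+s\<in>{0..t}. \<integral>\<^sup>+x. ennreal (k x) * ennreal (f (x * exp (t - s))) \<partial>m s \<partial>lborel)
    = (\<integral>\<^sup>+x. ennreal (f (x * exp t)) \<partial>m 0)
      + (\<integral>\<^sup>+s\<in>{0..t}. \<integral>\<^sup>+x. ennreal (k x) * mean_frag (\<lambda>y. ennreal (f (y * exp (t - s)))) x \<partial>m s \<partial>lborel)"
proof -
  note bf = bmeas_test1[OF t1]
  have fm: "f \<in> borel_measurable borel" using bf(1) by (rule bmeas_measurable)
  obtain B where B: "\<And>x. f x \<le> B" using bf(1) unfolding bmeas_def by (meson abs_le_D1)
  have avg_nn: "0 \<le> frag_avg f x" for x
    unfolding frag_avg_def by (rule Bochner_Integration.integral_nonneg) (rule nn)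
  have direct: "(\<integral>\<^sup>+x. ennreal (f (x * exp c)) \<partial>m s) = ennreal (wint f (\<lambda>_. 0) s c)" for s c
    unfolding wint_def using wint_integrable(1)[OF bf(1) bmeas_zero, of s c] nn
    by (simp add: nn_integral_eq_integral)
  have jump: "(\<integral>\<^sup>+s\<in>{0..t}. \<integral>\<^sup>+x. ennreal (k x) * ennreal (g (x * exp (t - s))) \<partial>m s \<partial>lborel)
      = ennreal (LBINT s:{0..t}. wint (\<lambda>_. 0) g s (t - s))"
    "0 \<le> (LBINT s:{0..t}. wint (\<lambda>_. 0) g s (t - s))"
    "set_integrable lborel {0..t} (\<lambda>s. wint (\<lambda>_. 0) g s (t - s))"
    if g: "bmeas g" "\<And>x. 0 \<le> g x" for g
  proof -
    have inner: "(\<integral>\<^sup>+x. ennreal (k x) * ennreal (g (x * exp c)) \<partial>m s) = ennreal (wint (\<lambda>_. 0) g s c)" for s c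
      unfolding wint_def using wint_integrable(2)[OF bmeas_zero g(1), of s c] g(2) k_nonneg
      by (simp add: nn_integral_eq_integral flip: ennreal_mult)
    have wnn: "0 \<le> wint (\<lambda>_. 0) g s c" for s c
      unfolding wint_def using g(2) k_nonneg by (intro Bochner_Integration.integral_nonneg) simp
    obtain D where "\<And>s c. \<bar>wint (\<lambda>_. 0) g s c\<bar> \<le> D" using wint_bound[OF bmeas_zero g(1)] by blast
    moreover note wint_measurable[OF bmeas_zero g(1), measurable]
    have "(\<lambda>s. wint (\<lambda>_. 0) g s (t - s)) \<in> borel_measurable borel" by measurable
    ultimately show si: "set_integrable lborel {0..t} (\<lambda>s. wint (\<lambda>_. 0) g s (t - s))"
      by (intro bounded_set_integrable) auto
    show "0 \<le> (LBINT s:{0..t}. wint (\<lambda>_. 0) g s (t - s))"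
      unfolding set_lebesgue_integral_def using wnn by (intro Bochner_Integration.integral_nonneg) simp
    have "(\<integral>\<^sup>+s\<in>{0..t}. \<integral>\<^sup>+x. ennreal (k x) * ennreal (g (x * exp (t - s))) \<partial>m s \<partial>lborel)
      = (\<integral>\<^sup>+s. ennreal (indicator {0..t} s *\<^sub>R wint (\<lambda>_. 0) g s (t - s)) \<partial>lborel)"
      unfolding inner by (intro nn_integral_cong) (simp add: indicator_def)
    also have "\<dots> = ennreal (LBINT s:{0..t}. wint (\<lambda>_. 0) g s (t - s))"
      using si wnn unfolding set_integrable_def set_lebesgue_integral_def
      by (intro nn_integral_eq_integral) auto
    finally show "(\<integral>\<^sup>+s\<in>{0..t}. \<integral>\<^sup>+x. ennreal (k x) * ennreal (g (x * exp (t - s))) \<partial>m s \<partial>lborel)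
      = ennreal (LBINT s:{0..t}. wint (\<lambda>_. 0) g s (t - s))" .
  qed
  have mf: "mean_frag (\<lambda>y. ennreal (f (y * exp c))) x = ennreal (frag_avg f (x * exp c))" for x c
    by (rule mean_frag_frag_avg[OF fm nn B])
  have "wint (\<lambda>_. 0) (frag_diff f) s c = wint (\<lambda>_. 0) (frag_avg f) s c - wint (\<lambda>_. 0) f s c" for s c
    unfolding wint_def frag_diff_def
    using wint_integrable(2)[OF bmeas_zero bf(3), of s c] wint_integrable(2)[OF bmeas_zero bf(1), of s c]
    by (simp add: right_diff_distrib)
  then have "wint f (\<lambda>_. 0) t 0 + (LBINT s:{0..t}. wint (\<lambda>_. 0) f s (t - s))
    = wint f (\<lambda>_. 0) 0 t + (LBINT s:{0..t}. wint (\<lambda>_. 0) (frag_avg f) s (t - s))"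
    using transport_test_real[OF t1 t2 t] set_integral_diff(2)[OF jump(3)[OF bf(3) avg_nn] jump(3)[OF bf(1) nn]]
    by simp
  moreover have "0 \<le> wint f (\<lambda>_. 0) s c" for s c
    unfolding wint_def using nn by (intro Bochner_Integration.integral_nonneg) simp
  moreover have "(\<integral>\<^sup>+x. ennreal (f x) \<partial>m t) = ennreal (wint f (\<lambda>_. 0) t 0)"
    using direct[where c=0 and s=t] by simp
  ultimately show ?thesis
    unfolding mf jump(1)[OF bf(1) nn] jump(1)[OF bf(3) avg_nn] direct
    using jump(2)[OF bf(1) nn] jump(2)[OF bf(3) avg_nn]
    by (simp flip: ennreal_plus)
qed

end

section \<open>From test functions to measurable functions\<close>

text \<open>The two sides of the transport identity are sums of iterated integrals of f. Instead of
  naming the measures behind them, these functionals are described as in Daniell's approach;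
  \<open>cont_linear_measure\<close> recovers the measure.\<close>

definition cont_linear :: "((real \<Rightarrow> ennreal) \<Rightarrow> ennreal) \<Rightarrow> bool" where
  "cont_linear P \<longleftrightarrow>
     (\<forall>f\<in>borel_measurable borel. \<forall>g\<in>borel_measurable borel. P (\<lambda>x. f x + g x) = P f + P g) \<and>
     (\<forall>f\<in>borel_measurable borel. \<forall>c. P (\<lambda>x. c * f x) = c * P f) \<and>
     (\<forall>F. (\<forall>i. F i \<in> borel_measurable borel) \<longrightarrow> incseq F \<longrightarrow> P (\<lambda>x. SUP i. F i x) = (SUP i::nat. P (F i)))"

lemma cont_linear_add:
  "cont_linear P \<Longrightarrow> f \<in> borel_measurable borel \<Longrightarrow> g \<in> borel_measurable borel \<Longrightarrow> P (\<lambda>x. f x + g x) = P f + P g"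
  by (simp add: cont_linear_def)

lemma cont_linear_cmult:
  "cont_linear P \<Longrightarrow> f \<in> borel_measurable borel \<Longrightarrow> P (\<lambda>x. c * f x) = c * P f"
  by (simp add: cont_linear_def)

lemma cont_linear_SUP:
  "cont_linear P \<Longrightarrow> (\<And>i. F i \<in> borel_measurable borel) \<Longrightarrow> incseq F \<Longrightarrow> P (\<lambda>x. SUP i. F i x) = (SUP i::nat. P (F i))"
  by (simp add: cont_linear_def)

lemma cont_linear_mono:
  assumes P: "cont_linear P" and [measurable]: "f \<in> borel_measurable borel" "g \<in> borel_measurable borel"
    and "\<And>x. f x \<le> g x"
  shows "P f \<le> P g"
proof -
  have "g = (\<lambda>x. f x + (g x - f x))" using assms(4) by (simp add: add_diff_inverse_ennreal)
  then have "P g = P f + P (\<lambda>x. g x - f x)" using cont_linear_add[OF P, of f "\<lambda>x. g x - f x"] by simp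
  then show ?thesis by simp
qed

lemma cont_linear_point: "cont_linear (\<lambda>f. f y)"
  by (simp add: cont_linear_def)

lemma cont_linear_plus:
  assumes P: "cont_linear P" and Q: "cont_linear Q"
  shows "cont_linear (\<lambda>f. P f + Q f)"
  unfolding cont_linear_def
proof (intro conjI ballI allI impI)
  fix F :: "nat \<Rightarrow> real \<Rightarrow> ennreal"
  assume F: "\<forall>i. F i \<in> borel_measurable borel" "incseq F"
  have "incseq (\<lambda>i. P (F i))" "incseq (\<lambda>i. Q (F i))"
    using F by (auto simp: incseq_def le_fun_def intro!: cont_linear_mono[OF P] cont_linear_mono[OF Q])
  then have "(SUP i. P (F i) + Q (F i)) = (SUP i. P (F i)) + (SUP i. Q (F i))"
    by (rule ennreal_SUP_add)
  then show "P (\<lambda>x. SUP i. F i x) + Q (\<lambda>x. SUP i. F i x) = (SUP i. P (F i) + Q (F i))"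
    using F cont_linear_SUP[OF P] cont_linear_SUP[OF Q] by simp
qed (simp_all add: cont_linear_add[OF P] cont_linear_add[OF Q] cont_linear_cmult[OF P] cont_linear_cmult[OF Q]
       distrib_left ac_simps)

text \<open>Closure under integration over a parameter builds the iterated integrals of the
  transport identity from point evaluations.\<close>

lemma cont_linear_integral:
  assumes P: "\<And>w. cont_linear (P w)"
    and meas: "\<And>f. f \<in> borel_measurable borel \<Longrightarrow> (\<lambda>w. P w f) \<in> borel_measurable M"
    and [measurable]: "c \<in> borel_measurable M"
  shows "cont_linear (\<lambda>f. \<integral>\<^sup>+w. c w * P w f \<partial>M)"
  unfolding cont_linear_def
proof (intro conjI ballI allI impI)
  fix f g :: "real \<Rightarrow> ennreal" assume f: "f \<in> borel_measurable borel" and g: "g \<in> borel_measurable borel"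
  note meas[OF f, measurable] meas[OF g, measurable]
  show "(\<integral>\<^sup>+w. c w * P w (\<lambda>x. f x + g x) \<partial>M) = (\<integral>\<^sup>+w. c w * P w f \<partial>M) + (\<integral>\<^sup>+w. c w * P w g \<partial>M)"
    by (simp add: cont_linear_add[OF P f g] distrib_left nn_integral_add)
next
  fix f :: "real \<Rightarrow> ennreal" and d assume f: "f \<in> borel_measurable borel"
  note meas[OF f, measurable]
  show "(\<integral>\<^sup>+w. c w * P w (\<lambda>x. d * f x) \<partial>M) = d * (\<integral>\<^sup>+w. c w * P w f \<partial>M)"
    by (simp add: cont_linear_cmult[OF P f] mult.left_commute nn_integral_cmult)
next
  fix F :: "nat \<Rightarrow> real \<Rightarrow> ennreal"
  assume F: "\<forall>i. F i \<in> borel_measurable borel" "incseq F"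
  have [measurable]: "(\<lambda>w. P w (F i)) \<in> borel_measurable M" for i by (rule meas) (use F in auto)
  have inc: "incseq (\<lambda>i w. c w * P w (F i))"
    using F by (auto simp: incseq_def le_fun_def intro!: mult_left_mono cont_linear_mono[OF P])
  have "(\<integral>\<^sup>+w. c w * P w (\<lambda>x. SUP i. F i x) \<partial>M) = (\<integral>\<^sup>+w. (SUP i. c w * P w (F i)) \<partial>M)"
    using F by (simp add: cont_linear_SUP[OF P] SUP_mult_left_ennreal)
  also have "\<dots> = (SUP i. \<integral>\<^sup>+w. c w * P w (F i) \<partial>M)"
    by (rule nn_integral_monotone_convergence_SUP[OF inc]) measurable
  finally show "(\<integral>\<^sup>+w. c w * P w (\<lambda>x. SUP i. F i x) \<partial>M) = (SUP i. \<integral>\<^sup>+w. c w * P w (F i) \<partial>M)" .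
qed

text \<open>The measure of a set is the value at its indicator. Continuity along increasing
  sequences gives countable additivity, and induction over measurable functions extends the equality
  from indicators.\<close>

lemma cont_linear_measure:
  assumes P: "cont_linear P"
  shows "\<exists>M. sets M = sets borel \<and> (\<forall>f\<in>borel_measurable borel. (\<integral>\<^sup>+x. f x \<partial>M) = P f)"
proof -
  define M where "M = measure_of UNIV (sets borel) (\<lambda>A. P (indicator A))"
  have sets_M [simp, measurable_cong]: "sets M = sets (borel :: real measure)"
    unfolding M_def using sets.sigma_sets_eq[of "borel :: real measure"] by simp
  have zero: "P (\<lambda>_. 0) = 0" using cont_linear_cmult[OF P, of "\<lambda>_. 0" 0] by simp
  have sum: "P (\<lambda>x. \<Sum>i<n. F i x) = (\<Sum>i<n. P (F i))" if "\<And>i. F i \<in> borel_measurable borel" for n and F :: "nat \<Rightarrow> real \<Rightarrow> ennreal"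
    using that by (induction n) (simp_all add: zero cont_linear_add[OF P])
  have em: "emeasure M A = P (indicator A)" if "A \<in> sets borel" for A
    unfolding M_def
  proof (rule emeasure_measure_of_sigma)
    show "sigma_algebra UNIV (sets (borel :: real measure))"
      using sets.sigma_algebra_axioms[of "borel :: real measure"] by simp
    show "positive (sets borel) (\<lambda>A. P (indicator A))"
    proof -
      have "(indicator {} :: real \<Rightarrow> ennreal) = (\<lambda>_. 0)" by auto
      then show ?thesis by (simp add: positive_def zero)
    qed
    show "countably_additive (sets borel) (\<lambda>A. P (indicator A))"
    proof (rule countably_additiveI)
      fix A :: "nat \<Rightarrow> real set"
      assume A: "range A \<subseteq> sets borel" "disjoint_family A"
      then have [measurable]: "A i \<in> sets borel" for i by auto
      have "(\<Sum>i. P (indicator (A i))) = (SUP n. P (\<lambda>x. \<Sum>i<n. indicator (A i) x))"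
        by (subst sum) (auto simp: suminf_eq_SUP)
      also have "\<dots> = P (\<lambda>x. SUP n. \<Sum>i<n. indicator (A i) x)"
        by (rule cont_linear_SUP[OF P, symmetric])
           (auto simp: incseq_def le_fun_def intro!: sum_mono2)
      also have "(\<lambda>x. SUP n. \<Sum>i<n. indicator (A i) x) = (indicator (\<Union>i. A i) :: real \<Rightarrow> ennreal)"
        using A(2) by (intro ext) (simp add: suminf_eq_SUP[symmetric] suminf_indicator)
      finally show "(\<Sum>i. P (indicator (A i))) = P (indicator (\<Union>i. A i))" .
    qed
  qed fact
  have "(\<integral>\<^sup>+x. f x \<partial>M) = P f" if "f \<in> borel_measurable borel" for f
    using that
  proof (induction rule: borel_measurable_induct)
    case (cong f g)
    then show ?case by (metis ext space_borel UNIV_I)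
  next
    case (set A)
    then show ?case by (simp add: em)
  next
    case (mult u c)
    then show ?case by (simp add: nn_integral_cmult cont_linear_cmult[OF P])
  next
    case (add u v)
    then show ?case by (simp add: nn_integral_add cont_linear_add[OF P])
  next
    case (seq U)
    have "(\<integral>\<^sup>+x. (SUP i. U i x) \<partial>M) = (SUP i. \<integral>\<^sup>+x. U i x \<partial>M)"
      by (rule nn_integral_monotone_convergence_SUP) (use seq in auto)
    also have "\<dots> = P (\<lambda>x. SUP i. U i x)"
      using seq by (subst cont_linear_SUP[OF P]) auto
    finally show ?case by (simp add: image_comp SUP_apply[abs_def])
  qed
  then show ?thesis using sets_M by blast
qed

section \<open>Smooth approximation of half-lines from below\<close>

lemma max0_power_deriv:
  "((\<lambda>y. max 0 y ^ Suc (Suc n)) has_real_derivative real (Suc (Suc n)) * max 0 y ^ Suc n) (at y)"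
proof -
  consider "0 < y" | "y < 0" | "y = 0" by linarith
  then show ?thesis
  proof cases
    case 1
    have d: "((\<lambda>y. y ^ Suc (Suc n)) has_real_derivative real (Suc (Suc n)) * max 0 y ^ Suc n) (at y)"
      using 1 DERIV_pow[of "Suc (Suc n)" y] by simp
    have ev: "\<forall>\<^sub>F z in nhds y. z ^ Suc (Suc n) = max 0 z ^ Suc (Suc n)"
      using eventually_nhds_in_open[of "{0<..}" y] 1 by (auto elim!: eventually_mono)
    show ?thesis by (rule DERIV_cong_ev[THEN iffD1, OF refl ev refl, OF d])
  next
    case 2
    have d: "((\<lambda>y. 0) has_real_derivative real (Suc (Suc n)) * max 0 y ^ Suc n) (at y)"
      using 2 by simp
    have ev: "\<forall>\<^sub>F z in nhds y. 0 = max 0 z ^ Suc (Suc n)"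
      using eventually_nhds_in_open[of "{..<0}" y] 2 by (auto elim!: eventually_mono)
    show ?thesis by (rule DERIV_cong_ev[THEN iffD1, OF refl ev refl, OF d])
  next
    case 3
    \<comment> \<open>At the kink the difference quotient is at most |h|^(n+1) in absolute value, so
      it tends to 0.\<close>
    have "((\<lambda>h::real. max 0 h ^ Suc (Suc n) / h) \<longlongrightarrow> 0) (at 0)"
    proof (rule Lim_null_comparison)
      have "norm (max 0 h ^ Suc (Suc n) / h) \<le> \<bar>h\<bar> ^ Suc n" for h :: real
      proof (cases "0 < h")
        case True
        then show ?thesis by (simp add: max_absorb2)
      next
        case False
        then have "norm (max 0 h ^ Suc (Suc n) / h) = 0" by simp
        then show ?thesis using zero_le_power[OF abs_ge_zero, of h "Suc n"] by (simp only:)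
      qed
      then show "\<forall>\<^sub>F h::real in at 0. norm (max 0 h ^ Suc (Suc n) / h) \<le> \<bar>h\<bar> ^ Suc n" by simp
      have "((\<lambda>h::real. \<bar>h\<bar> ^ Suc n) \<longlongrightarrow> \<bar>0\<bar> ^ Suc n) (at 0)" by (intro tendsto_intros)
      then show "((\<lambda>h::real. \<bar>h\<bar> ^ Suc n) \<longlongrightarrow> 0) (at 0)" by simp
    qed
    then show ?thesis using 3 by (simp add: DERIV_def)
  qed
qed

text \<open>The cube meets 0 to an order high enough for two continuous derivatives; the rational
  form keeps these explicit and rises to 1 at infinity.\<close>

definition ramp :: "real \<Rightarrow> real" where
  "ramp y = 1 - 1 / (1 + max 0 y ^ 3)"

definition ramp' :: "real \<Rightarrow> real" where
  "ramp' y = 3 * max 0 y ^ 2 / (1 + max 0 y ^ 3) ^ 2"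

definition ramp'' :: "real \<Rightarrow> real" where
  "ramp'' y = (6 * max 0 y * (1 + max 0 y ^ 3) - 18 * max 0 y ^ 4) / (1 + max 0 y ^ 3) ^ 3"

lemma ramp_denom: "0 < 1 + max 0 (y::real) ^ 3"
  by (rule add_pos_nonneg) auto

lemma ramp_deriv: "(ramp has_real_derivative ramp' y) (at y)"
proof -
  have 3: "((\<lambda>y. max 0 y ^ 3) has_real_derivative 3 * max 0 y ^ 2) (at y)"
    using max0_power_deriv[of 1 y] by (simp add: numeral_3_eq_3 numeral_2_eq_2)
  show ?thesis unfolding ramp_def[abs_def] ramp'_def
    using ramp_denom[of y]
    by (intro DERIV_cong[OF DERIV_diff[OF DERIV_const DERIV_divide[OF DERIV_const DERIV_add[OF DERIV_const 3]]]])
       (auto simp: power2_eq_square)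
qed

lemma ramp'_deriv: "(ramp' has_real_derivative ramp'' y) (at y)"
proof -
  have 3: "((\<lambda>y. max 0 y ^ 3) has_real_derivative 3 * max 0 y ^ 2) (at y)"
    using max0_power_deriv[of 1 y] by (simp add: numeral_3_eq_3 numeral_2_eq_2)
  have 2: "((\<lambda>y. max 0 y ^ 2) has_real_derivative 2 * max 0 y) (at y)"
    using max0_power_deriv[of 0 y] by (simp add: numeral_2_eq_2)
  have D: "((\<lambda>y. (1 + max 0 y ^ 3) ^ 2) has_real_derivative 2 * ((0 + 3 * max 0 y ^ 2) * (1 + max 0 y ^ 3))) (at y)"
    using DERIV_power[OF DERIV_add[OF DERIV_const 3], of 1 2] by simp
  have "(ramp' has_real_derivative (3 * (2 * max 0 y) * (1 + max 0 y ^ 3) ^ 2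
      - 3 * max 0 y ^ 2 * (2 * (1 + max 0 y ^ 3) * (3 * max 0 y ^ 2))) / ((1 + max 0 y ^ 3) ^ 2 * (1 + max 0 y ^ 3) ^ 2)) (at y)"
    unfolding ramp'_def[abs_def]
    using ramp_denom[of y]
    by (intro DERIV_cong[OF DERIV_divide[OF DERIV_cmult[OF 2] D]]) (auto simp: mult_ac)
  also have "(3 * (2 * max 0 y) * (1 + max 0 y ^ 3) ^ 2
      - 3 * max 0 y ^ 2 * (2 * (1 + max 0 y ^ 3) * (3 * max 0 y ^ 2))) / ((1 + max 0 y ^ 3) ^ 2 * (1 + max 0 y ^ 3) ^ 2) = ramp'' y"
  proof -
    have "(3 * (2 * M) * D ^ 2 - 3 * M ^ 2 * (2 * D * (3 * M ^ 2))) / (D ^ 2 * D ^ 2)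
      = (6 * M * D - 18 * M ^ 4) / D ^ 3" if "D > 0" for M D :: real
      using that by (simp add: divide_simps) (simp add: algebra_simps power2_eq_square power3_eq_cube power4_eq_xxxx)
    from this[OF ramp_denom] show ?thesis by (simp add: ramp''_def)
  qed
  finally show ?thesis .
qed

lemma ramp''_continuous: "continuous_on UNIV ramp''"
  unfolding ramp''_def[abs_def]
  using ramp_denom by (intro continuous_intros) (auto simp: less_imp_neq[symmetric])

lemma ramp_nonpos: "y \<le> 0 \<Longrightarrow> ramp y = 0" "y \<le> 0 \<Longrightarrow> ramp' y = 0"
  by (simp_all add: ramp_def ramp'_def)

lemma ramp_mono: "y \<le> z \<Longrightarrow> ramp y \<le> ramp z"
  unfolding ramp_def using ramp_denom[of y]
  by (auto intro!: frac_le power_mono)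

lemma ramp_nonneg: "0 \<le> ramp y"
  using ramp_mono[of "min y 0" y] ramp_nonpos(1)[of "min y 0"] by simp

lemma ramp_tendsto: "(ramp \<longlongrightarrow> 1) at_top"
proof -
  have "((\<lambda>y::real. 1 - 1 / (1 + y ^ 3)) \<longlongrightarrow> 1) at_top" by real_asymp
  then show ?thesis
  proof (rule Lim_transform_eventually)
    show "\<forall>\<^sub>F y in at_top. 1 - 1 / (1 + y ^ 3) = ramp y"
      using eventually_ge_at_top[of 0] by eventually_elim (simp add: ramp_def)
  qed
qed

text \<open>The first factor vanishes up to a + 1 / (n + 1), the second from n + 1 on. So for a
  \<ge> 0 the support is compact in the open half-line, even for a = 0, while both factors tend to 1
  at every point beyond a.\<close>

definition bump :: "real \<Rightarrow> nat \<Rightarrow> real \<Rightarrow> real" where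
  "bump a n y = ramp (real (Suc n) * (y - a) - 1) * ramp (real (Suc n) - y)"

lemma bump_test:
  assumes "0 \<le> a"
  shows "\<exists>f' f''. test1 (bump a n) f' \<and> test1 f' f''"
proof -
  define N where "N = real (Suc n)"
  define f' where "f' y = N * ramp' (N * (y - a) - 1) * ramp (N - y) - ramp (N * (y - a) - 1) * ramp' (N - y)" for y
  define f'' where "f'' y = N\<^sup>2 * ramp'' (N * (y - a) - 1) * ramp (N - y)
    - 2 * N * ramp' (N * (y - a) - 1) * ramp' (N - y) + ramp (N * (y - a) - 1) * ramp'' (N - y)" for y
  have N: "0 < N" by (simp add: N_def)
  have chain: "((\<lambda>y. ramp (N * (y - a) - 1)) has_real_derivative ramp' (N * (y - a) - 1) * N) (at y)"
    "((\<lambda>y. ramp' (N * (y - a) - 1)) has_real_derivative ramp'' (N * (y - a) - 1) * N) (at y)"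
    "((\<lambda>y. ramp (N - y)) has_real_derivative ramp' (N - y) * (- 1)) (at y)"
    "((\<lambda>y. ramp' (N - y)) has_real_derivative ramp'' (N - y) * (- 1)) (at y)" for y
    by (rule DERIV_chain2[OF ramp_deriv] DERIV_chain2[OF ramp'_deriv]; auto intro!: derivative_eq_intros)+
  have d1: "(bump a n has_real_derivative f' y) (at y)" for y
    unfolding bump_def[abs_def] f'_def N_def[symmetric]
    by (rule DERIV_cong[OF DERIV_mult[OF chain(1,3)]]) (simp add: algebra_simps)
  have d2: "(f' has_real_derivative f'' y) (at y)" for y
    unfolding f'_def[abs_def] f''_def
    by (rule DERIV_cong[OF DERIV_diff[OF DERIV_mult[OF DERIV_cmult[OF chain(2), of N] chain(3)] DERIV_mult[OF chain(1,4)]]])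
       (simp add: algebra_simps power2_eq_square)
  have c1: "continuous_on UNIV f'"
    using d2 by (meson DERIV_isCont continuous_at_imp_continuous_on)
  have cr: "continuous_on UNIV ramp" "continuous_on UNIV ramp'"
    using ramp_deriv ramp'_deriv by (meson DERIV_isCont continuous_at_imp_continuous_on)+
  have c2: "continuous_on UNIV f''"
    unfolding f''_def[abs_def]
    by (intro continuous_intros continuous_on_compose2[OF cr(1)] continuous_on_compose2[OF cr(2)]
          continuous_on_compose2[OF ramp''_continuous]) auto
  have supp: "bump a n y = 0 \<and> f' y = 0" if "y \<notin> {a + 1 / N..N}" for y
  proof -
    have "N * (y - a) - 1 \<le> 0 \<or> N - y \<le> 0"
      using that N by (auto simp: field_simps not_le)
    then show ?thesis unfolding bump_def f'_def N_def[symmetric] by (auto simp: ramp_nonpos)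
  qed
  have pos: "0 < a + 1 / N" using assms N by (intro add_nonneg_pos) auto
  have "test1 (bump a n) f'" unfolding test1_def using d1 c1 supp pos by blast
  moreover have "test1 f' f''" unfolding test1_def using d2 c2 supp pos by blast
  ultimately show ?thesis by blast
qed

lemma bump_nonneg: "0 \<le> bump a n y"
  by (simp add: bump_def ramp_nonneg)

lemma bump_incseq:
  assumes "0 \<le> a"
  shows "incseq (\<lambda>n y. ennreal (bump a n y))"
proof (rule incseq_SucI, rule le_funI, rule ennreal_leI)
  fix n y
  show "bump a n y \<le> bump a (Suc n) y"
  proof (cases "y \<le> a")
    \<comment> \<open>Left of a the growing slope lowers the argument of the first ramp, but there
      the bump is zero anyway.\<close>
    case True
    then have "real (Suc n) * (y - a) - 1 \<le> 0"
      using mult_nonneg_nonpos[of "real (Suc n)" "y - a"] by simp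
    then have "bump a n y = 0" by (simp add: bump_def ramp_nonpos)
    then show ?thesis by (simp add: bump_nonneg)
  next
    case False
    then show ?thesis unfolding bump_def
      by (intro mult_mono ramp_mono ramp_nonneg diff_right_mono mult_right_mono) auto
  qed
qed

lemma bump_SUP:
  assumes "0 \<le> a"
  shows "(SUP n. ennreal (bump a n y)) = indicator {a<..} y"
proof (rule LIMSEQ_unique)
  show "(\<lambda>n. ennreal (bump a n y)) \<longlonglongrightarrow> (SUP n. ennreal (bump a n y))"
    using bump_incseq[OF assms] by (intro LIMSEQ_SUP) (simp add: incseq_def le_fun_def)
  show "(\<lambda>n. ennreal (bump a n y)) \<longlonglongrightarrow> indicator {a<..} y"
  proof (cases "a < y")
    case True
    have "filterlim (\<lambda>n. real (Suc n) * (y - a) - 1) at_top sequentially"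
      using True by real_asymp
    moreover have "filterlim (\<lambda>n. real (Suc n) - y) at_top sequentially"
      by real_asymp
    ultimately have "(\<lambda>n. bump a n y) \<longlonglongrightarrow> 1 * 1"
      unfolding bump_def by (intro tendsto_mult filterlim_compose[OF ramp_tendsto])
    then have "(\<lambda>n. ennreal (bump a n y)) \<longlonglongrightarrow> ennreal 1"
      by (intro tendsto_ennrealI) simp
    then show ?thesis using True by simp
  next
    case False
    then have "real (Suc n) * (y - a) - 1 \<le> 0" for n
      using mult_nonneg_nonpos[of "real (Suc n)" "y - a"] by simp
    then show ?thesis using False by (simp add: bump_def ramp_nonpos)
  qed
qed

text \<open>Smooth test functions increase to the indicators of half-lines (a,\<infinity>) with a
  \<ge> 0, and these determine a finite measure on (0,\<infinity>). Since neither measure charges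
  the nonpositive half-line, a negative a reduces to a = 0.\<close>

lemma cont_linear_eqI:
  assumes P: "cont_linear P" and Q: "cont_linear Q"
    and null: "P (indicator {..0}) = 0" "Q (indicator {..0}) = 0"
    and fin: "P (\<lambda>_. 1) < \<top>"
    and test: "\<And>f f' f''. test1 f f' \<Longrightarrow> test1 f' f'' \<Longrightarrow> (\<And>x. 0 \<le> f x) \<Longrightarrow> P (\<lambda>x. ennreal (f x)) = Q (\<lambda>x. ennreal (f x))"
    and f: "f \<in> borel_measurable borel"
  shows "P f = Q f"
proof -
  obtain M where M: "sets M = sets borel" "\<And>f. f \<in> borel_measurable borel \<Longrightarrow> (\<integral>\<^sup>+x. f x \<partial>M) = P f"
    using cont_linear_measure[OF P] by blast
  obtain N where N: "sets N = sets borel" "\<And>f. f \<in> borel_measurable borel \<Longrightarrow> (\<integral>\<^sup>+x. f x \<partial>N) = Q f"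
    using cont_linear_measure[OF Q] by blast
  have emM: "emeasure M A = P (indicator A)" and emN: "emeasure N A = Q (indicator A)" if "A \<in> sets borel" for A
    using that M(2)[of "indicator A"] N(2)[of "indicator A"] by (simp_all add: M(1) N(1))
  have bump_meas: "(\<lambda>y. ennreal (bump a n y)) \<in> borel_measurable borel" if a: "0 \<le> a" for a n
  proof -
    obtain f' f'' where "test1 (bump a n) f'" "test1 f' f''" using bump_test[OF a, of n] by blast
    then have "bump a n \<in> borel_measurable borel"
      by (intro borel_measurable_continuous_onI test1_continuous)
    then show ?thesis by simp
  qed
  have P_half: "P (indicator {a<..}) = Q (indicator {a<..})" if a: "0 \<le> a" for a
  proof -
    have "P (indicator {a<..}) = (SUP n. P (\<lambda>y. ennreal (bump a n y)))"
      using cont_linear_SUP[OF P bump_meas[OF a] bump_incseq[OF a]] by (simp add: bump_SUP[OF a])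
    also have "\<dots> = (SUP n. Q (\<lambda>y. ennreal (bump a n y)))"
      using bump_test[OF a] by (intro SUP_cong refl) (metis test bump_nonneg)
    also have "\<dots> = Q (indicator {a<..})"
      using cont_linear_SUP[OF Q bump_meas[OF a] bump_incseq[OF a]] by (simp add: bump_SUP[OF a])
    finally show ?thesis .
  qed
  have reduce: "emeasure K {x<..} = emeasure K {max 0 x<..}" if "sets K = sets borel" "emeasure K {..0} = 0" for K and x :: real
  proof (rule emeasure_eq_AE)
    show "AE y in K. y \<in> {x<..} \<longleftrightarrow> y \<in> {max 0 x<..}"
      using that by (intro AE_I[of _ _ "{..0}"]) auto
  qed (use that in auto)
  have "M = N"
  proof (rule measure_eqI_lessThan)
    fix x
    have "emeasure M {x<..} = emeasure M {max 0 x<..}" "emeasure N {x<..} = emeasure N {max 0 x<..}"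
      by (rule reduce; simp add: M(1) N(1) emM emN null)+
    then show "emeasure M {x<..} = emeasure N {x<..}" using P_half[of "max 0 x"] by (simp add: emM emN)
    have "emeasure M {x<..} \<le> P (\<lambda>_. 1)"
      by (subst emM) (auto intro!: cont_linear_mono[OF P] simp: indicator_def)
    then show "emeasure M {x<..} < \<infinity>" using fin by (simp add: le_less_trans)
  qed (simp_all add: M N)
  then show ?thesis using M(2)[OF f] N(2)[OF f] by simp
qed

section \<open>The transport identity for Borel functions\<close>

context weak_solution
begin

lemma transport_all:
  assumes t: "0 \<le> t" and f: "f \<in> borel_measurable borel"
  shows "(\<integral>\<^sup>+x. f x \<partial>m t) + (\<integral>\<^sup>+s\<in>{0..t}. \<integral>\<^sup>+x. ennreal (k x) * f (x * exp (t - s)) \<partial>m s \<partial>lborel)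
      = (\<integral>\<^sup>+x. f (x * exp t) \<partial>m 0)
        + (\<integral>\<^sup>+s\<in>{0..t}. \<integral>\<^sup>+x. ennreal (k x) * mean_frag (\<lambda>y. f (y * exp (t - s))) x \<partial>m s \<partial>lborel)"
proof -
  interpret unif: prob_space unif by (rule prob_space_unif)
  \<comment> \<open>The two sides as functionals of f; the factors 1 and the indicator in front give
    every integral the shape required by \<open>cont_linear_integral\<close>.\<close>
  define P where "P f = (\<integral>\<^sup>+x. 1 * f x \<partial>m t)
    + (\<integral>\<^sup>+s. indicator {0..t} s * (\<integral>\<^sup>+x. ennreal (k x) * f (x * exp (t - s)) \<partial>m s) \<partial>lborel)" for f
  define Q where "Q f = (\<integral>\<^sup>+x. 1 * f (x * exp t) \<partial>m 0)
    + (\<integral>\<^sup>+s. indicator {0..t} s * (\<integral>\<^sup>+x. ennreal (k x) * (\<integral>\<^sup>+v. 1 * f (x * sqrt v * exp (t - s)) \<partial>unif) \<partial>m s) \<partial>lborel)" for f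
  have P: "cont_linear P" unfolding P_def
  proof (intro cont_linear_plus cont_linear_integral cont_linear_point)
    fix f :: "real \<Rightarrow> ennreal" assume [measurable]: "f \<in> borel_measurable borel"
    show "(\<lambda>x. f x) \<in> borel_measurable (m t)" by measurable
    show "(\<lambda>x. f (x * exp (t - s))) \<in> borel_measurable (m s)" for s by measurable
    have "(\<lambda>s. \<integral>\<^sup>+x. ennreal (k x) * f (x * exp (t - s)) \<partial>m s) \<in> borel_measurable borel"
      by (rule m_integral_measurable) measurable
    then show "(\<lambda>s. \<integral>\<^sup>+x. ennreal (k x) * f (x * exp (t - s)) \<partial>m s) \<in> borel_measurable lborel" by simp
  qed (auto simp: measurable_cong_sets[OF m_sets refl])
  have Q: "cont_linear Q" unfolding Q_def
  proof (intro cont_linear_plus cont_linear_integral cont_linear_point)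
    fix f :: "real \<Rightarrow> ennreal" assume [measurable]: "f \<in> borel_measurable borel"
    show "(\<lambda>x. f (x * exp t)) \<in> borel_measurable (m 0)" by measurable
    show "(\<lambda>v. f (x * sqrt v * exp (t - s))) \<in> borel_measurable unif" for x s by measurable
    show "(\<lambda>x. \<integral>\<^sup>+v. 1 * f (x * sqrt v * exp (t - s)) \<partial>unif) \<in> borel_measurable (m s)" for s by measurable
    have "(\<lambda>s. \<integral>\<^sup>+x. ennreal (k x) * (\<integral>\<^sup>+v. 1 * f (x * sqrt v * exp (t - s)) \<partial>unif) \<partial>m s) \<in> borel_measurable borel"
      by (rule m_integral_measurable) measurable
    then show "(\<lambda>s. \<integral>\<^sup>+x. ennreal (k x) * (\<integral>\<^sup>+v. 1 * f (x * sqrt v * exp (t - s)) \<partial>unif) \<partial>m s) \<in> borel_measurable lborel" by simp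
  qed (auto simp: measurable_cong_sets[OF m_sets refl])
  have P_eq: "P f = (\<integral>\<^sup>+x. f x \<partial>m t) + (\<integral>\<^sup>+s\<in>{0..t}. \<integral>\<^sup>+x. ennreal (k x) * f (x * exp (t - s)) \<partial>m s \<partial>lborel)" for f
    by (simp add: P_def mult.commute)
  have Q_eq: "Q f = (\<integral>\<^sup>+x. f (x * exp t) \<partial>m 0)
        + (\<integral>\<^sup>+s\<in>{0..t}. \<integral>\<^sup>+x. ennreal (k x) * mean_frag (\<lambda>y. f (y * exp (t - s))) x \<partial>m s \<partial>lborel)" for f
    by (simp add: Q_def mean_frag_def mult.commute)
  have zero: "(\<integral>\<^sup>+x. g x \<partial>m s) = 0" if "\<And>x. 0 < x \<Longrightarrow> g x = 0" for s and g :: "real \<Rightarrow> ennreal"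
  proof -
    have "(\<integral>\<^sup>+x. g x \<partial>m s) = (\<integral>\<^sup>+x. 0 \<partial>m s)"
      by (rule nn_integral_cong_AE) (use m_pos[of s] that in \<open>auto elim!: eventually_mono\<close>)
    then show ?thesis by simp
  qed
  have "P f = Q f"
  proof (rule cont_linear_eqI[OF P Q])
    show "P (indicator {..0}) = 0"
      by (simp add: P_def zero indicator_def mult_le_0_iff not_le)
    have "(\<integral>\<^sup>+v. 1 * indicator {..0} (x * sqrt v * exp c) \<partial>unif) = (0::ennreal)" if "0 < x" for x c
      using that by (subst nn_integral_unif) (auto intro!: nn_integral_zero' AE_I2 simp: indicator_def mult_le_0_iff)
    then show "Q (indicator {..0}) = 0"
      by (simp add: Q_def zero indicator_def mult_le_0_iff not_le)
    \<comment> \<open>At f = 1 the left-hand side is at most 1 + C t: the total mass plus the mean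
      rate integrated over [0, t].\<close>
    have "emeasure (m t) UNIV = 1" using prob_space.emeasure_space_1[OF m_prob[of t]] by simp
    moreover have "(\<integral>\<^sup>+s\<in>{0..t}. \<integral>\<^sup>+x. ennreal (k x) * 1 \<partial>m s \<partial>lborel) \<le> (\<integral>\<^sup>+s. C * indicator {0..t} s \<partial>lborel)"
      using rate_bound by (intro nn_integral_mono mult_right_mono) auto
    moreover have "(\<integral>\<^sup>+s. C * indicator {0..t} s \<partial>lborel) < \<top>"
      using C_finite t by (subst nn_integral_cmult) (auto simp: ennreal_mult_less_top)
    ultimately show "P (\<lambda>_. 1) < \<top>"
      by (simp add: P_eq le_less_trans)
    fix g g' g''
    assume "test1 g g'" "test1 g' g''" "\<And>x. 0 \<le> g x"
    then show "P (\<lambda>x. ennreal (g x)) = Q (\<lambda>x. ennreal (g x))"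
      unfolding P_eq Q_eq by (intro transport_test t)
  qed (rule f)
  then show ?thesis by (simp add: P_eq Q_eq)
qed

sublocale transport R m C
  by unfold_locales (rule transport_all)

end

section \<open>Uniqueness\<close>

lemma stieltjes_measure:
  assumes "F \<in> dist_funs"
  shows "sets (stieltjes F) = sets borel" "sigma_finite_measure (stieltjes F)"
proof -
  show "sets (stieltjes F) = sets borel" by (simp add: stieltjes_def)
  have F: "mono F" "continuous (at_right x) F" for x
    using assms by (auto simp: dist_funs_def)
  have "continuous (at_right a) (\<lambda>x. F (ennreal x))" for a
  proof (cases "0 \<le> a")
    case True
    have "filterlim ennreal (at_right (ennreal a)) (at_right a)"
      unfolding filterlim_at
    proof
      show "(ennreal \<longlongrightarrow> ennreal a) (at_right a)"
        by (intro tendsto_ennrealI tendsto_ident_at)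
      show "\<forall>\<^sub>F x in at_right a. ennreal x \<in> {ennreal a<..} \<and> ennreal x \<noteq> ennreal a"
        using eventually_at_right_less[of a]
        by eventually_elim (use True in \<open>auto simp: ennreal_less_iff\<close>)
    qed
    moreover have "(F \<longlongrightarrow> F (ennreal a)) (at_right (ennreal a))"
      using F(2) by (simp add: continuous_within)
    ultimately show ?thesis unfolding continuous_within by (rule filterlim_compose[rotated])
  next
    case False
    have "\<forall>\<^sub>F x in at_right a. x < 0"
      using False by (intro eventually_at_rightI[of a 0]) auto
    then have "\<forall>\<^sub>F x in at_right a. F (ennreal a) = F (ennreal x)"
      by eventually_elim (use False in \<open>simp add: ennreal_neg\<close>)
    then show ?thesis unfolding continuous_within
      by (rule Lim_transform_eventually[OF tendsto_const])
  qed
  moreover have "F (ennreal x) \<le> F (ennreal y)" if "x \<le> y" for x y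
    using monoD[OF F(1) ennreal_leI[OF that]] .
  ultimately show "sigma_finite_measure (stieltjes F)"
    unfolding stieltjes_def by (intro sigma_finite_interval_measure)
qed

text \<open>In the variable y = e^r this is the integral of y over (0, z); multiplied by R(z) / z it
  gives half of \<open>k z\<close>.\<close>

lemma nn_integral_exp_square:
  assumes "0 < z"
  shows "(\<integral>\<^sup>+r. ennreal ((exp r)\<^sup>2) * indicator {..<ln z} r \<partial>lborel) = ennreal (z\<^sup>2 / 2)"
proof -
  have "(\<integral>\<^sup>+r. ennreal ((exp r)\<^sup>2) * indicator {..<ln z} r \<partial>lborel)
    = (\<integral>\<^sup>+q. ennreal ((exp (- q))\<^sup>2) * indicator {..<ln z} (- q) \<partial>lborel)"
    by (subst nn_integral_real_affine[where c="-1" and t=0]) auto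
  also have "\<dots> = (\<integral>\<^sup>+q. ennreal ((exp (- q))\<^sup>2) * indicator {- ln z..} q \<partial>lborel)"
  proof (rule nn_integral_cong_AE)
    show "AE q in lborel. ennreal ((exp (- q))\<^sup>2) * indicator {..<ln z} (- q)
      = ennreal ((exp (- q))\<^sup>2) * indicator {- ln z..} q"
      using AE_lborel_singleton[of "- ln z"] by eventually_elim (auto simp: indicator_def)
  qed
  also have "\<dots> = ennreal (0 - (- ((exp (- (- ln z)))\<^sup>2) / 2))"
  proof (rule nn_integral_FTC_atLeast)
    show "((\<lambda>q. - ((exp (- q))\<^sup>2) / 2) has_real_derivative (exp (- q))\<^sup>2) (at q)" for q :: real
      by (auto intro!: derivative_eq_intros simp: power2_eq_square)
    show "((\<lambda>q::real. - ((exp (- q))\<^sup>2) / 2) \<longlongrightarrow> 0) at_top" by real_asymp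
  qed auto
  finally show ?thesis using assms by simp
qed

context hazard
begin

text \<open>The stationary law has density \<open>y G y\<close> with \<open>G y\<close> the inner integral of the equation, and
  integrates to at most one; exchanging the integrals gives the bound.\<close>

lemma stationary_rate_bound:
  assumes F: "(\<lambda>t. F) \<in> solution_family R0" and R0: "\<And>x. 0 \<le> x \<Longrightarrow> R0 x = R x"
  shows "(\<integral>\<^sup>+z. ennreal (k z) \<partial>stieltjes F) \<le> 2"
proof -
  have FD: "F \<in> dist_funs" using F by (auto simp: solution_family_def)
  interpret sigma_finite_measure "stieltjes F" by (rule stieltjes_measure(2)[OF FD])
  interpret pair: pair_sigma_finite "stieltjes F" "lborel :: real measure" ..
  note [measurable_cong] = stieltjes_measure(1)[OF FD]
  define G where "G y = (\<integral>\<^sup>+z. ennreal (R z / z) * (if y < z then 1 else 0) \<partial>stieltjes F)" for y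
  have G_meas [measurable]: "(\<lambda>y. G y) \<in> borel_measurable borel" unfolding G_def by measurable
  have eq: "ennreal (F (ennreal x)) = ennreal (F (ennreal (exp (- t) * x))) +
        (\<integral>\<^sup>+s\<in>{0..t}. ennreal ((exp (s - t) * x)\<^sup>2) *
           (\<integral>\<^sup>+z\<in>{exp (s - t) * x<..}. ennreal (R0 z / z) \<partial>stieltjes F) \<partial>lborel)"
    if "0 \<le> t" "0 < x" for t x
    using F that unfolding solution_family_def by blast
  have F_le: "F y \<le> 1" for y
  proof -
    have "range F \<subseteq> {0..1}" using FD by (simp add: dist_funs_def)
    from subsetD[OF this rangeI[of F y]] show ?thesis by simp
  qed
  have G_R0: "(\<integral>\<^sup>+z\<in>{y<..}. ennreal (R0 z / z) \<partial>stieltjes F) = G y" if "0 < y" for y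
    unfolding G_def using that R0 by (intro nn_integral_cong) (auto simp: indicator_def)
  \<comment> \<open>In logarithmic coordinates the measure y dy is e^(2r) dr. The truncation to
    [-n, n] matches a single instance of the stationary equation.\<close>
  define g where "g n r = ennreal ((exp r)\<^sup>2) * G (exp r) * indicator {- real n..real n} r" for n r
  have g_meas [measurable]: "(\<lambda>r. g n r) \<in> borel_measurable borel" for n unfolding g_def by measurable
  have le1: "(\<integral>\<^sup>+r. g n r \<partial>lborel) \<le> 1" for n
  proof -
    \<comment> \<open>The equation is used with t = 2n and x = e^n: the argument e^(s-t) x then runs
      from e^(-n) to e^n.\<close>
    have shift: "exp (s - 2 * real n) * exp (real n) = exp (s - real n)" for s
      by (simp flip: exp_add)
    have "(\<integral>\<^sup>+r. g n r \<partial>lborel) = (\<integral>\<^sup>+s. g n (s - real n) \<partial>lborel)"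
      by (subst nn_integral_real_affine[where c=1 and t="- real n"]) auto
    also have "\<dots> = (\<integral>\<^sup>+s\<in>{0..2 * real n}. ennreal ((exp (s - 2 * real n) * exp (real n))\<^sup>2) *
           (\<integral>\<^sup>+z\<in>{exp (s - 2 * real n) * exp (real n)<..}. ennreal (R0 z / z) \<partial>stieltjes F) \<partial>lborel)"
      unfolding shift G_R0[OF exp_gt_zero] by (intro nn_integral_cong) (auto simp: g_def indicator_def)
    also have "\<dots> \<le> ennreal (F (ennreal (exp (real n))))"
      by (subst eq[of "2 * real n"]) auto
    also have "\<dots> \<le> 1" using F_le by (simp add: ennreal_le_1)
    finally show ?thesis .
  qed
  have g_SUP: "(SUP n. g n r) = ennreal ((exp r)\<^sup>2) * G (exp r)" for r
  proof (rule antisym)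
    show "(SUP n. g n r) \<le> ennreal ((exp r)\<^sup>2) * G (exp r)"
      by (rule SUP_least) (simp add: g_def indicator_def)
    obtain n where "\<bar>r\<bar> \<le> real n" using real_arch_simple by blast
    then have "ennreal ((exp r)\<^sup>2) * G (exp r) = g n r" by (simp add: g_def indicator_def abs_le_iff)
    then show "ennreal ((exp r)\<^sup>2) * G (exp r) \<le> (SUP n. g n r)" by (metis SUP_upper UNIV_I)
  qed
  have g_inc: "incseq g"
    by (auto simp: incseq_def le_fun_def g_def indicator_def)
  have "(\<integral>\<^sup>+r. ennreal ((exp r)\<^sup>2) * G (exp r) \<partial>lborel) = (SUP n. \<integral>\<^sup>+r. g n r \<partial>lborel)"
    unfolding g_SUP[symmetric] by (rule nn_integral_monotone_convergence_SUP[OF g_inc]) simp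
  also have "\<dots> \<le> 1" using le1 by (rule SUP_least)
  finally have total: "(\<integral>\<^sup>+r. ennreal ((exp r)\<^sup>2) * G (exp r) \<partial>lborel) \<le> 1" .
  have "(\<integral>\<^sup>+z. ennreal (k z) \<partial>stieltjes F) = (\<integral>\<^sup>+z. 2 * ennreal (k z / 2) \<partial>stieltjes F)"
    using k_nonneg by (intro nn_integral_cong) (simp flip: ennreal_numeral ennreal_mult)
  also have "\<dots> = 2 * (\<integral>\<^sup>+z. ennreal (k z / 2) \<partial>stieltjes F)"
    by (rule nn_integral_cmult) measurable
  also have "(\<integral>\<^sup>+z. ennreal (k z / 2) \<partial>stieltjes F)
    \<le> (\<integral>\<^sup>+z. \<integral>\<^sup>+r. ennreal ((exp r)\<^sup>2) * (ennreal (R z / z) * (if exp r < z then 1 else 0)) \<partial>lborel \<partial>stieltjes F)"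
  proof (rule nn_integral_mono)
    fix z
    show "ennreal (k z / 2) \<le> (\<integral>\<^sup>+r. ennreal ((exp r)\<^sup>2) * (ennreal (R z / z) * (if exp r < z then 1 else 0)) \<partial>lborel)"
    proof (cases "0 < z")
      case True
      have "exp r < z \<longleftrightarrow> r < ln z" for r
        using True by (metis exp_less_cancel_iff exp_ln)
      then have "(\<integral>\<^sup>+r. ennreal ((exp r)\<^sup>2) * (ennreal (R z / z) * (if exp r < z then 1 else 0)) \<partial>lborel)
        = (\<integral>\<^sup>+r. ennreal (R z / z) * (ennreal ((exp r)\<^sup>2) * indicator {..<ln z} r) \<partial>lborel)"
        by (intro nn_integral_cong) (simp add: indicator_def mult_ac)
      also have "\<dots> = ennreal (R z / z) * ennreal (z\<^sup>2 / 2)"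
        by (subst nn_integral_cmult) (auto simp: nn_integral_exp_square[OF True])
      also have "\<dots> = ennreal (k z / 2)"
        using True R_nonneg by (simp add: k_def power2_eq_square flip: ennreal_mult)
      finally show ?thesis by simp
    next
      case False
      then have "k z = 0" using R_neg[of z] by (cases "z = 0") (auto simp: k_def)
      then show ?thesis by simp
    qed
  qed
  also have "(\<integral>\<^sup>+z. \<integral>\<^sup>+r. ennreal ((exp r)\<^sup>2) * (ennreal (R z / z) * (if exp r < z then 1 else 0)) \<partial>lborel \<partial>stieltjes F)
    = (\<integral>\<^sup>+r. \<integral>\<^sup>+z. ennreal ((exp r)\<^sup>2) * (ennreal (R z / z) * (if exp r < z then 1 else 0)) \<partial>stieltjes F \<partial>lborel)"
    by (rule pair.Fubini'[symmetric]) measurable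
  also have "\<dots> = (\<integral>\<^sup>+r. ennreal ((exp r)\<^sup>2) * G (exp r) \<partial>lborel)"
    unfolding G_def by (intro nn_integral_cong nn_integral_cmult) measurable
  also have "2 * (\<integral>\<^sup>+r. ennreal ((exp r)\<^sup>2) * G (exp r) \<partial>lborel) \<le> 2 * 1"
    by (intro mult_left_mono total) auto
  finally show ?thesis by (simp add: mult_left_mono)
qed

end

section \<open>Reduction to a rate on the whole line\<close>

lemma rate_function_hazard:
  assumes "rate_function R"
  shows "hazard (\<lambda>x. if 0 \<le> x then R x else 0)"
proof
  have "(\<lambda>x. if x \<in> {0..} then R x else 0) \<in> borel_measurable borel"
    using assms by (subst measurable_restrict_space_iff[symmetric]) (auto simp: rate_function_def)
  then show m [measurable]: "(\<lambda>x. if 0 \<le> x then R x else 0) \<in> borel_measurable borel" by simp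
  show nn: "0 \<le> (if 0 \<le> x then R x else 0)" for x using assms by (simp add: rate_function_def)
  show "(if 0 \<le> x then R x else 0) = 0" if "x < 0" for x using that by simp
  fix x :: real
  \<comment> \<open>The hypothesis speaks of intervals [0, k] with k > 0; the maximum with 1 covers
    x \<le> 0.\<close>
  have "set_integrable lborel {0..max 1 x} (\<lambda>x. if 0 \<le> x then R x else 0)"
    unfolding set_integrable_def
  proof (rule integrableI_nonneg)
    have "(\<integral>\<^sup>+y. ennreal (indicator {0..max 1 x} y *\<^sub>R (if 0 \<le> y then R y else 0)) \<partial>lborel)
      = (\<integral>\<^sup>+y\<in>{0..max 1 x}. ennreal (R y) \<partial>lborel)"
      by (intro nn_integral_cong) (simp add: indicator_def)
    then show "(\<integral>\<^sup>+y. ennreal (indicator {0..max 1 x} y *\<^sub>R (if 0 \<le> y then R y else 0)) \<partial>lborel) < \<infinity>"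
      using assms by (simp add: rate_function_def)
  qed (use nn in auto)
  then show "set_integrable lborel {0..x} (\<lambda>x. if 0 \<le> x then R x else 0)"
    by (rule set_integrable_subset) auto
qed

text \<open>Nonnegative uniforms keep all positions nonnegative, and there the two rates
  agree.\<close>

lemma cell_path_rate_cong:
  assumes "\<And>x. 0 \<le> x \<Longrightarrow> R x = R' x" and u: "\<And>i. 1 \<le> i \<Longrightarrow> 0 \<le> u i"
  shows "cell_path R x u t = cell_path R' x u t"
proof (cases "x \<le> 0")
  case False
  have surv: "surv R z s = surv R' z s" if "0 \<le> z" for z s
  proof -
    have "(LBINT u:{z..z * exp s}. R u) = (LBINT u:{z..z * exp s}. R' u)"
      by (rule set_lebesgue_integral_cong) (use assms(1) that in auto)
    then show ?thesis by (simp add: surv_def)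
  qed
  then have inv: "surv_inv R z v = surv_inv R' z v" if "0 \<le> z" for z v
    using that by (simp add: surv_inv_def)
  have pos: "0 \<le> pos x u n s" for n s
    using False u unfolding pos_def jump_def by (intro mult_nonneg_nonneg prod_nonneg) auto
  have "jump_time R x u n = jump_time R' x u n" for n
    by (induction n) (simp_all add: jump_time_Suc inv[OF pos])
  then have "jump_time R x u = jump_time R' x u" by (rule ext)
  then show ?thesis unfolding cell_path_def explosion_time_def by (simp only:)
qed (simp add: cell_path_def)

lemma cell_law_rate_cong:
  assumes "\<And>x. 0 \<le> x \<Longrightarrow> R x = R' x" and "driving_sequence M U"
  shows "cell_law R M U \<mu> t = cell_law R' M U \<mu> t"
  unfolding cell_law_def
proof (rule distr_cong)
  fix w assume "w \<in> space (\<mu> \<Otimes>\<^sub>M M)"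
  then have "0 \<le> U i (snd w)" if "1 \<le> i" for i
    using assms(2) that by (auto simp: driving_sequence_def space_pair_measure less_imp_le)
  then show "(case w of (x, \<omega>) \<Rightarrow> cell_path R x (\<lambda>i. U i \<omega>) t) = (case w of (x, \<omega>) \<Rightarrow> cell_path R' x (\<lambda>i. U i \<omega>) t)"
    unfolding split_beta by (intro cell_path_rate_cong assms(1)) auto
qed auto

lemma nn_integral_le_esssup:
  assumes "sigma_finite_measure M" "absolutely_continuous M N" "sets N = sets M"
    and "esssup M (RN_deriv M N) \<le> B" and [measurable]: "f \<in> borel_measurable M"
  shows "(\<integral>\<^sup>+x. f x \<partial>N) \<le> B * (\<integral>\<^sup>+x. f x \<partial>M)"
proof -
  interpret sigma_finite_measure M by fact
  have "(\<integral>\<^sup>+x. f x \<partial>N) = (\<integral>\<^sup>+x. RN_deriv M N x * f x \<partial>M)"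
    by (subst density_RN_deriv[OF assms(2,3), symmetric]) (simp add: nn_integral_density)
  also have "\<dots> \<le> (\<integral>\<^sup>+x. B * f x \<partial>M)"
    using esssup_AE[of "RN_deriv M N" M] assms(4)
    by (intro nn_integral_mono_AE) (auto elim!: eventually_mono intro!: mult_right_mono)
  also have "\<dots> = B * (\<integral>\<^sup>+x. f x \<partial>M)" by (rule nn_integral_cmult) simp
  finally show ?thesis .
qed

theorem proposition3p7:
  fixes R :: "real \<Rightarrow> real" and F :: "ennreal \<Rightarrow> real"
    and M :: "'w measure" and U :: "nat \<Rightarrow> 'w \<Rightarrow> real"
    and \<mu> :: "real \<Rightarrow> real measure"
  assumes "rate_function R"
    and "(\<lambda>t. F) \<in> solution_family R"
    and "driving_sequence M U"
    and "\<mu> \<in> measurable (restrict_space borel {0..}) (prob_algebra borel)"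
    and "\<And>t. 0 \<le> t \<Longrightarrow> emeasure (\<mu> t) {..0} = 0"
    and "\<And>t. 0 \<le> t \<Longrightarrow> absolutely_continuous (stieltjes F) (\<mu> t)"
    and "(SUP t\<in>{0..}. esssup (stieltjes F) (RN_deriv (stieltjes F) (\<mu> t))) < \<infinity>"
    and "\<And>f t. f \<in> Cc1 \<Longrightarrow> 0 \<le> t \<Longrightarrow>
           pairing (\<mu> t) f - pairing (\<mu> 0) f = (LBINT s:{0..t}. pairing (\<mu> s) (generator R f))"
  shows "\<forall>t\<ge>0. \<mu> t = cell_law R M U (\<mu> 0) t"
proof -
  \<comment> \<open>The given rate may be arbitrary, even nonmeasurable, on the negative half-line,
    where it is reset to 0; the family of laws is continued to negative times by its initial
    law.\<close>
  define R' where "R' x = (if 0 \<le> x then R x else 0)" for x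
  have R': "R x = R' x" if "0 \<le> x" for x using that by (simp add: R'_def)
  define m where "m s = \<mu> (max 0 s)" for s
  define B where "B = (SUP t\<in>{0..}. esssup (stieltjes F) (RN_deriv (stieltjes F) (\<mu> t)))"
  have FD: "F \<in> dist_funs" using assms(2) by (auto simp: solution_family_def)
  interpret hazard R' unfolding R'_def by (rule rate_function_hazard[OF assms(1)])
  have sets_mu: "sets (\<mu> t) = sets borel" if "0 \<le> t" for t
    using measurable_space[OF assms(4), of t] that by (simp add: space_prob_algebra space_restrict_space)
  \<comment> \<open>\<open>B\<close> bounds the densities and 2 bounds the mean rate under the
    stationary law (\<open>stationary_rate_bound\<close>), so their product bounds the mean rate
    under every law of the family.\<close>
  interpret weak_solution R' m "B * 2"
  proof
    have "(\<lambda>s. max 0 s) \<in> borel \<rightarrow>\<^sub>M restrict_space borel {0::real..}"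
      by (rule measurable_restrict_space2) auto
    from measurable_compose[OF this assms(4)] show "m \<in> borel \<rightarrow>\<^sub>M prob_algebra borel"
      unfolding m_def[abs_def] .
    show "AE x in m s. 0 < x" for s
      unfolding m_def using assms(5)[of "max 0 s"] sets_mu[of "max 0 s"]
      by (intro AE_I[of _ _ "{..0}"]) auto
    show "(\<integral>\<^sup>+x. ennreal (k x) \<partial>m s) \<le> B * 2" for s
    proof -
      have "(\<integral>\<^sup>+x. ennreal (k x) \<partial>m s) \<le> B * (\<integral>\<^sup>+x. ennreal (k x) \<partial>stieltjes F)"
        unfolding m_def
      proof (rule nn_integral_le_esssup)
        show "esssup (stieltjes F) (RN_deriv (stieltjes F) (\<mu> (max 0 s))) \<le> B"
          unfolding B_def by (rule SUP_upper) simp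
      qed (use assms(6) stieltjes_measure[OF FD] sets_mu in \<open>auto simp: measurable_cong_sets[OF stieltjes_measure(1)[OF FD] refl]\<close>)
      also have "\<dots> \<le> B * 2"
      proof (rule mult_left_mono)
        show "(\<integral>\<^sup>+x. ennreal (k x) \<partial>stieltjes F) \<le> 2"
          by (rule stationary_rate_bound[OF assms(2)]) (rule R')
      qed simp
      finally show ?thesis .
    qed
    show "B * 2 < \<top>" using assms(7) by (simp add: B_def ennreal_mult_less_top)
    fix f t assume f: "f \<in> Cc1" and t: "0 \<le> (t::real)"
    \<comment> \<open>The pairing integrates over (0,\<infinity>), and there the generator reads the
      rate at x > 0 only.\<close>
    have gen: "pairing (m s) (generator R' f) = pairing (\<mu> s) (generator R f)" if "0 \<le> s" for s
      unfolding pairing_def set_lebesgue_integral_def m_def using that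
      by (intro Bochner_Integration.integral_cong) (auto simp: indicator_def generator_def R')
    have "(LBINT s:{0..t}. pairing (m s) (generator R' f)) = (LBINT s:{0..t}. pairing (\<mu> s) (generator R f))"
      by (rule set_lebesgue_integral_cong) (auto simp: gen)
    then show "pairing (m t) f - pairing (m 0) f = (LBINT s:{0..t}. pairing (m s) (generator R' f))"
      using assms(8)[OF f t] t by (simp add: m_def)
  qed
  show ?thesis
  proof (intro allI impI)
    fix t :: real
    assume t: "0 \<le> t"
    then have "m t = \<mu> t" "m 0 = \<mu> 0" by (simp_all add: m_def)
    moreover have "cell_law R M U (\<mu> 0) t = cell_law R' M U (\<mu> 0) t"
      by (rule cell_law_rate_cong[OF R' assms(3)])
    ultimately show "\<mu> t = cell_law R M U (\<mu> 0) t"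
      using law_unique[OF t assms(3)] by metis
  qed
qed

end
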